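(* Let $(\Gamma,\Lambda)$ be a valued quiver. If $M$ is an indecomposable preprojective finite dimensional $k(\Gamma,\Lambda)$-module, then the shortest (+)-admissible sequence $S_M$ annihilating $M$ is a principal (+)-admissible sequence.
   Context: Setting. $\Gamma=(\Gamma_0,\Gamma_1)$ is a finite graph with $|\Gamma_0|>1$ whose edges are two-element subsets of $\Gamma_0$, with a fixed valuation $\mathbf b$: nonnegative integers $b_{ij}$ ($i,j\in\Gamma_0$) with $b_{ii}=0$ for which there are positive integers $d_i$ with $d_ib_{ij}=d_jb_{ji}$ for all $i,j$; $\{i,j\}$ is an edge iff $b_{ij}\neq0$. $\Gamma$ is connected. An orientation $\Lambda$ turns each edge into an arrow by choosing its starting point and endpoint; all orientations considered are such that there are no oriented cycles. A modulation is fixed: division rings $\mathbf k_i$ ($i\in\Gamma_0$), and for each edge $\{i,j\}$ a $\mathbf k_i$-$\mathbf k_j$-bimodule ${}_iB_j$ and a $\mathbf k_j$-$\mathbf k_i$-bimodule ${}_jB_i$ with $\mathbf k_j$-$\mathbf k_i$-bimodule isomorphisms ${}_jB_i\cong\mathrm{Hom}_{\mathbf k_i}({}_iB_j,\mathbf k_i)\cong\mathrm{Hom}_{\mathbf k_j}({}_iB_j,\mathbf k_j)$ and $\dim_{\mathbf k_i}({}_iB_j)=b_{ij}$. The $\mathbf k_i$ are finite dimensional over a common central subfield $k$ acting centrally on all ${}_iB_j$. $(\Gamma,\Lambda)$ denotes the resulting valued quiver. Representations. A representation $(V,f)$ of $(\Gamma,\Lambda)$ consists of finite dimensional left $\mathbf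 k_i$-spaces $V_i$ and $\mathbf k_j$-linear maps $f_a:{}_jB_i\otimes_{\mathbf k_i}V_i\to V_j$ for all arrows $a:i\to j$; morphisms are the natural ones. With $\mathbf k=\prod_i\mathbf k_i$ and $B=\bigoplus_{i\to j}{}_jB_i$ (sum over arrows), $k(\Gamma,\Lambda)$ is the tensor ring of the $\mathbf k$-$\mathbf k$-bimodule $B$, a finite dimensional $k$-algebra; finite dimensional left $k(\Gamma,\Lambda)$-modules are identified with representations of $(\Gamma,\Lambda)$. Reflection functors. For a vertex $x$, $\sigma_x\Lambda$ is obtained from $\Lambda$ by reversing all arrows incident with $x$. If $x$ is a sink (no arrow starts at $x$) with arrows $a_i:y_i\to x$, $i=1,\dots,l$, ending at it, $F_x^+$ sends a representation $(V,f)$ of $(\Gamma,\Lambda)$ to the representation $(W,g)$ of $(\Gamma,\sigma_x\Lambda)$ with $W_y=V_y$ for $y\ne x$; $W_x=\mathrm{Ker}\,h$ where $h:\bigoplus_i{}_xB_{y_i}\otimes_{\mathbf k_{y_i}}V_{y_i}\to V_x$ is induced by the $f_{a_i}$; $g_b=f_b$ for arrows $b$ not starting at $x$; and for the reversed arrow $x\to y_i$ the map ${}_{y_i}B_x\otimes_{\mathbf k_x}W_x\to W_{y_i}$ corresponds to the component $W_x\to{}_xB_{y_i}\otimes W_{y_i}$ of the inclusion under the natural isomorphism $\mathrm{Hom}_{\mathbf k_x}(W_x,{}_xB_{y_i}\otimes W_{y_i})\cong\mathrm{Hom}_{\mathbf k_{y_i}}({}_{y_i}B_x\otimes W_x,W_{y_i})$;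 $F_x^+$ is defined on morphisms in the natural way. Admissible sequences. A sequence $S=x_1,\dots,x_s$ ($s\ge0$) of vertices is (+)-admissible on $(\Gamma,\Lambda)$ if it is empty or $x_1$ is a sink for $\Lambda$, $x_2$ is a sink for $\sigma_{x_1}\Lambda$, and so on. $\mathfrak S$ is the set of (+)-admissible sequences on $(\Gamma,\Lambda)$. Put $\Lambda^S=\sigma_{x_s}\cdots\sigma_{x_1}\Lambda$ and $F(S)=F_{x_s}^+\cdots F_{x_1}^+$ (the identity if $S=\emptyset$). $\mathrm{Supp}\,S$ is the set of vertices occurring in $S$. $\sim$ is the equivalence relation on $\mathfrak S$ generated by interchanging two consecutive vertices $x_i,x_{i+1}$ not connected by an edge. For $S,T\in\mathfrak S$, $S$ is a subsequence of $T$, written $S\preccurlyeq T$, if $T\sim SU$ (concatenation) for some (+)-admissible sequence $U$ on $(\Gamma,\Lambda^S)$; it is proper if $S\not\sim T$. $S$ annihilates $M$ if $F(S)M=0$; it is a shortest sequence annihilating $M$ if in addition no proper subsequence of $S$ annihilates $M$. $M$ is preprojective if some $S\in\mathfrak S$ annihilates it; then a shortest sequence annihilating $M$ exists and is unique up to $\sim$, and it is denoted $S_M$. Principal sequences. $(\Gamma_0,\Lambda)$ is the poset on $\Gamma_0$ with $x\le y$ iff there is a path (possibly of length $0$) from $x$ to $y$. A filter is a subset $F$ such that $x\in F$, $y\ge x$ imply $y\in F$; $\langle x\rangle=\{y: y\ge x\}$ is the principal filter generated by $x$. The hull $H_\Lambda(F)$ of a filter $F$ is the smallest filter containing $F$ and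 every vertex of $\Gamma_0\setminus F$ connected by an edge to a vertex in $F$. Every nonempty $S\in\mathfrak S$ has a canonical form $S\sim S_1S_2\cdots S_r$, unique up to equivalence of each $S_i$, where each $S_i$ is nonempty and consists of distinct vertices and $\mathrm{Supp}\,S_i=\mathrm{Supp}\,(S_iS_{i+1}\cdots S_r)$ for all $i$; $r$ is the size of $S$. $S$ is principal if it is nonempty, $\mathrm{Supp}\,S_i=H_\Lambda(\mathrm{Supp}\,S_{i+1})$ for $0<i<r$, and $\mathrm{Supp}\,S_r$ is a principal filter of $(\Gamma_0,\Lambda)$. *)

theory Defs
  imports
    "HOL-Algebra.Module"
    "HOL-Algebra.Embedded_Algebras"
    "HOL-Algebra.Free_Abelian_Groups"
begin

section \<open>Linear algebra over division rings\<close>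

locale skew_field = ring R for R (structure) +
  assumes skew_field_Units: "Units R = carrier R - {\<zero>}"

text \<open>
  Noncommutative counterpart of \<^locale>\<open>module\<close>. As there, the record type is \<^type>\<open>module\<close>,
  whose multiplicative fields play no role.
\<close>

locale left_module = R?: ring R + M?: abelian_group M
  for R :: "('r, 's) ring_scheme" (structure) and M :: "('r, 'm, 'z) module_scheme" (structure) +
  assumes smult_closed:
      "\<lbrakk>a \<in> carrier R; x \<in> carrier M\<rbrakk> \<Longrightarrow> a \<odot>\<^bsub>M\<^esub> x \<in> carrier M"
    and smult_l_distr:
      "\<lbrakk>a \<in> carrier R; b \<in> carrier R; x \<in> carrier M\<rbrakk> \<Longrightarrow>
        (a \<oplus>\<^bsub>R\<^esub> b) \<odot>\<^bsub>M\<^esub> x = a \<odot>\<^bsub>M\<^esub> x \<oplus>\<^bsub>M\<^esub> b \<odot>\<^bsub>M\<^esub> x"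
    and smult_r_distr:
      "\<lbrakk>a \<in> carrier R; x \<in> carrier M; y \<in> carrier M\<rbrakk> \<Longrightarrow>
        a \<odot>\<^bsub>M\<^esub> (x \<oplus>\<^bsub>M\<^esub> y) = a \<odot>\<^bsub>M\<^esub> x \<oplus>\<^bsub>M\<^esub> a \<odot>\<^bsub>M\<^esub> y"
    and smult_assoc:
      "\<lbrakk>a \<in> carrier R; b \<in> carrier R; x \<in> carrier M\<rbrakk> \<Longrightarrow>
        (a \<otimes>\<^bsub>R\<^esub> b) \<odot>\<^bsub>M\<^esub> x = a \<odot>\<^bsub>M\<^esub> (b \<odot>\<^bsub>M\<^esub> x)"
    and smult_one: "x \<in> carrier M \<Longrightarrow> \<one>\<^bsub>R\<^esub> \<odot>\<^bsub>M\<^esub> x = x"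

definition left_linear ::
  "('r, 's) ring_scheme \<Rightarrow> ('r, 'm, 'z) module_scheme \<Rightarrow> ('r, 'n, 'w) module_scheme \<Rightarrow> ('m \<Rightarrow> 'n) \<Rightarrow> bool"
  where "left_linear R M N f \<longleftrightarrow>
    f \<in> carrier M \<rightarrow> carrier N \<and>
    (\<forall>x\<in>carrier M. \<forall>y\<in>carrier M. f (x \<oplus>\<^bsub>M\<^esub> y) = f x \<oplus>\<^bsub>N\<^esub> f y) \<and>
    (\<forall>a\<in>carrier R. \<forall>x\<in>carrier M. f (a \<odot>\<^bsub>M\<^esub> x) = a \<odot>\<^bsub>N\<^esub> f x)"

definition is_basis :: "('r, 's) ring_scheme \<Rightarrow> ('r, 'm, 'z) module_scheme \<Rightarrow> 'm set \<Rightarrow> bool"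
  where "is_basis R M X \<longleftrightarrow> finite X \<and> X \<subseteq> carrier M \<and>
    (\<forall>m\<in>carrier M. \<exists>!c. c \<in> X \<rightarrow>\<^sub>E carrier R \<and> m = (\<Oplus>\<^bsub>M\<^esub>x\<in>X. c x \<odot>\<^bsub>M\<^esub> x))"

definition has_dim :: "('r, 's) ring_scheme \<Rightarrow> ('r, 'm, 'z) module_scheme \<Rightarrow> nat \<Rightarrow> bool"
  where "has_dim R M n \<longleftrightarrow> (\<exists>X. is_basis R M X \<and> card X = n)"

record ('l, 'r, 'b) bimodule = "('l, 'b) module" +
  rsmult :: "'b \<Rightarrow> 'r \<Rightarrow> 'b"  (infixl \<open>\<odot>\<^sub>r\<index>\<close> 70)

locale bimodule = left_module L B + S?: ring R
  for L :: "('l, 's) ring_scheme" and R :: "('r, 't) ring_scheme"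
    and B :: "('l, 'r, 'b, 'z) bimodule_scheme" (structure) +
  assumes rsmult_closed:
      "\<lbrakk>x \<in> carrier B; a \<in> carrier R\<rbrakk> \<Longrightarrow> x \<odot>\<^sub>r\<^bsub>B\<^esub> a \<in> carrier B"
    and rsmult_r_distr:
      "\<lbrakk>x \<in> carrier B; a \<in> carrier R; b \<in> carrier R\<rbrakk> \<Longrightarrow>
        x \<odot>\<^sub>r\<^bsub>B\<^esub> (a \<oplus>\<^bsub>R\<^esub> b) = x \<odot>\<^sub>r\<^bsub>B\<^esub> a \<oplus>\<^bsub>B\<^esub> x \<odot>\<^sub>r\<^bsub>B\<^esub> b"
    and rsmult_l_distr:
      "\<lbrakk>x \<in> carrier B; y \<in> carrier B; a \<in> carrier R\<rbrakk> \<Longrightarrow>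
        (x \<oplus>\<^bsub>B\<^esub> y) \<odot>\<^sub>r\<^bsub>B\<^esub> a = x \<odot>\<^sub>r\<^bsub>B\<^esub> a \<oplus>\<^bsub>B\<^esub> y \<odot>\<^sub>r\<^bsub>B\<^esub> a"
    and rsmult_assoc:
      "\<lbrakk>x \<in> carrier B; a \<in> carrier R; b \<in> carrier R\<rbrakk> \<Longrightarrow>
        x \<odot>\<^sub>r\<^bsub>B\<^esub> (a \<otimes>\<^bsub>R\<^esub> b) = (x \<odot>\<^sub>r\<^bsub>B\<^esub> a) \<odot>\<^sub>r\<^bsub>B\<^esub> b"
    and rsmult_one: "x \<in> carrier B \<Longrightarrow> x \<odot>\<^sub>r\<^bsub>B\<^esub> \<one>\<^bsub>R\<^esub> = x"
    and smult_rsmult: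
      "\<lbrakk>c \<in> carrier L; x \<in> carrier B; a \<in> carrier R\<rbrakk> \<Longrightarrow>
        (c \<odot>\<^bsub>B\<^esub> x) \<odot>\<^sub>r\<^bsub>B\<^esub> a = c \<odot>\<^bsub>B\<^esub> (x \<odot>\<^sub>r\<^bsub>B\<^esub> a)"

definition bimodule_iso ::
  "('l, 's) ring_scheme \<Rightarrow> ('r, 't) ring_scheme \<Rightarrow> ('l, 'r, 'b, 'z) bimodule_scheme \<Rightarrow>
   ('l, 'r, 'c, 'w) bimodule_scheme \<Rightarrow> ('b \<Rightarrow> 'c) \<Rightarrow> bool"
  where "bimodule_iso L R B C f \<longleftrightarrow>
    left_linear L B C f \<and> bij_betw f (carrier B) (carrier C) \<and>
    (\<forall>x\<in>carrier B. \<forall>a\<in>carrier R. f (x \<odot>\<^sub>r\<^bsub>B\<^esub> a) = f x \<odot>\<^sub>r\<^bsub>C\<^esub> a)"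

text \<open>
  For an \<open>L\<close>-\<open>R\<close>-bimodule \<open>B\<close>, the two \<open>R\<close>-\<open>L\<close>-bimodules of left \<open>L\<close>-linear, respectively right
  \<open>R\<close>-linear, maps from \<open>B\<close> to the respective ring.
\<close>

definition left_dual ::
  "('l, 's) ring_scheme \<Rightarrow> ('l, 'r, 'b, 'z) bimodule_scheme \<Rightarrow> ('r, 'l, 'b \<Rightarrow> 'l) bimodule"
  where "left_dual L B =
    \<lparr>carrier = {f \<in> carrier B \<rightarrow>\<^sub>E carrier L.
        (\<forall>x\<in>carrier B. \<forall>y\<in>carrier B. f (x \<oplus>\<^bsub>B\<^esub> y) = f x \<oplus>\<^bsub>L\<^esub> f y) \<and>
        (\<forall>a\<in>carrier L. \<forall>x\<in>carrier B. f (a \<odot>\<^bsub>B\<^esub> x) = a \<otimes>\<^bsub>L\<^esub> f x)},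
     mult = undefined, one = undefined,
     ring.zero = (\<lambda>x\<in>carrier B. \<zero>\<^bsub>L\<^esub>),
     add = (\<lambda>f g. \<lambda>x\<in>carrier B. f x \<oplus>\<^bsub>L\<^esub> g x),
     smult = (\<lambda>c f. \<lambda>x\<in>carrier B. f (x \<odot>\<^sub>r\<^bsub>B\<^esub> c)),
     rsmult = (\<lambda>f a. \<lambda>x\<in>carrier B. f x \<otimes>\<^bsub>L\<^esub> a)\<rparr>"

definition right_dual ::
  "('r, 's) ring_scheme \<Rightarrow> ('l, 'r, 'b, 'z) bimodule_scheme \<Rightarrow> ('r, 'l, 'b \<Rightarrow> 'r) bimodule"
  where "right_dual R B =
    \<lparr>carrier = {f \<in> carrier B \<rightarrow>\<^sub>E carrier R.
        (\<forall>x\<in>carrier B. \<forall>y\<in>carrier B. f (x \<oplus>\<^bsub>B\<^esub> y) = f x \<oplus>\<^bsub>R\<^esub> f y) \<and>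
        (\<forall>a\<in>carrier R. \<forall>x\<in>carrier B. f (x \<odot>\<^sub>r\<^bsub>B\<^esub> a) = f x \<otimes>\<^bsub>R\<^esub> a)},
     mult = undefined, one = undefined,
     ring.zero = (\<lambda>x\<in>carrier B. \<zero>\<^bsub>R\<^esub>),
     add = (\<lambda>f g. \<lambda>x\<in>carrier B. f x \<oplus>\<^bsub>R\<^esub> g x),
     smult = (\<lambda>c f. \<lambda>x\<in>carrier B. c \<otimes>\<^bsub>R\<^esub> f x),
     rsmult = (\<lambda>f a. \<lambda>x\<in>carrier B. f (a \<odot>\<^bsub>B\<^esub> x))\<rparr>"


section \<open>Tensor products\<close>

text \<open>
  \<open>B \<otimes>\<^sub>R V\<close> is the free abelian group on \<open>B \<times> V\<close> modulo the subgroup generated by the usual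
  relations; its elements are cosets.
\<close>

type_synonym ('b, 'v) tensor = "('b \<times> 'v \<Rightarrow>\<^sub>0 int) set"

definition tensor_relations ::
  "('r, 's) ring_scheme \<Rightarrow> ('l, 'r, 'b, 'z) bimodule_scheme \<Rightarrow> ('r, 'v, 'w) module_scheme \<Rightarrow>
   ('b \<times> 'v \<Rightarrow>\<^sub>0 int) set"
  where "tensor_relations R B V =
    {frag_of (b \<oplus>\<^bsub>B\<^esub> b', v) - frag_of (b, v) - frag_of (b', v) | b b' v.
        b \<in> carrier B \<and> b' \<in> carrier B \<and> v \<in> carrier V} \<union>
    {frag_of (b, v \<oplus>\<^bsub>V\<^esub> v') - frag_of (b, v) - frag_of (b, v') | b v v'.
        b \<in> carrier B \<and> v \<in> carrier V \<and> v' \<in> carrier V} \<union>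
    {frag_of (b \<odot>\<^sub>r\<^bsub>B\<^esub> a, v) - frag_of (b, a \<odot>\<^bsub>V\<^esub> v) | b a v.
        b \<in> carrier B \<and> a \<in> carrier R \<and> v \<in> carrier V}"

definition tensor_subgroup ::
  "('r, 's) ring_scheme \<Rightarrow> ('l, 'r, 'b, 'z) bimodule_scheme \<Rightarrow> ('r, 'v, 'w) module_scheme \<Rightarrow>
   ('b \<times> 'v \<Rightarrow>\<^sub>0 int) set"
  where "tensor_subgroup R B V =
    generate (free_Abelian_group (carrier B \<times> carrier V)) (tensor_relations R B V)"

definition tensor_product ::
  "('r, 's) ring_scheme \<Rightarrow> ('l, 'r, 'b, 'z) bimodule_scheme \<Rightarrow> ('r, 'v, 'w) module_scheme \<Rightarrow>
   ('l, ('b, 'v) tensor) module"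
  where "tensor_product R B V =
    (let F = free_Abelian_group (carrier B \<times> carrier V); H = tensor_subgroup R B V in
      \<lparr>carrier = carrier (F Mod H),
       mult = undefined, one = undefined,
       ring.zero = \<one>\<^bsub>F Mod H\<^esub>,
       add = (\<lambda>X Y. X \<otimes>\<^bsub>F Mod H\<^esub> Y),
       smult = (\<lambda>c X. H <#>\<^bsub>F\<^esub> frag_extend (\<lambda>(b, v). frag_of (c \<odot>\<^bsub>B\<^esub> b, v)) ` X)\<rparr>)"

definition pure_tensor ::
  "('r, 's) ring_scheme \<Rightarrow> ('l, 'r, 'b, 'z) bimodule_scheme \<Rightarrow> ('r, 'v, 'w) module_scheme \<Rightarrow>
   'b \<Rightarrow> 'v \<Rightarrow> ('b, 'v) tensor"
  where "pure_tensor R B V b v =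
    tensor_subgroup R B V #>\<^bsub>free_Abelian_group (carrier B \<times> carrier V)\<^esub> frag_of (b, v)"

text \<open>
  The map on a tensor product induced by a balanced biadditive map \<open>\<beta>\<close> into \<open>A\<close>, evaluated on an
  arbitrary representative of the coset.
\<close>

definition tensor_lift ::
  "('a, 's) ring_scheme \<Rightarrow> ('b \<Rightarrow> 'v \<Rightarrow> 'a) \<Rightarrow> ('b, 'v) tensor \<Rightarrow> 'a"
  where "tensor_lift A \<beta> T =
    (let z = (SOME z. z \<in> T) in
      \<Oplus>\<^bsub>A\<^esub>p\<in>Poly_Mapping.keys z. [Poly_Mapping.lookup z p] \<cdot>\<^bsub>A\<^esub> \<beta> (fst p) (snd p))"


section \<open>Modulated graphs and valued quivers\<close>

text \<open>
  \<open>scalar \<Gamma> i\<close> embeds the common subfield \<open>k\<close> (\<open>ground \<Gamma>\<close>) into the division ring \<open>dring \<Gamma> i\<close>,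
  \<open>bimod \<Gamma> i j\<close> is \<open>\<^sub>iB\<^sub>j\<close>, and \<open>pairing \<Gamma> i j\<close> is the chosen isomorphism from \<open>\<^sub>jB\<^sub>i\<close> to the right
  \<open>dring \<Gamma> j\<close>-linear maps from \<open>\<^sub>iB\<^sub>j\<close> to \<open>dring \<Gamma> j\<close>. It is part of the data because the reflection
  functors use it. Entries of \<open>bimod\<close> and \<open>pairing\<close> at non-edges are junk.
\<close>

record ('i, 'c, 'd, 'b) modulation =
  val :: "'i \<Rightarrow> 'i \<Rightarrow> nat"
  ground :: "'c ring"
  scalar :: "'i \<Rightarrow> 'c \<Rightarrow> 'd"
  dring :: "'i \<Rightarrow> 'd ring"
  bimod :: "'i \<Rightarrow> 'i \<Rightarrow> ('d, 'd, 'b) bimodule"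
  pairing :: "'i \<Rightarrow> 'i \<Rightarrow> 'b \<Rightarrow> 'b \<Rightarrow> 'd"

definition edge :: "('i, 'c, 'd, 'b) modulation \<Rightarrow> 'i \<Rightarrow> 'i \<Rightarrow> bool"
  where "edge \<Gamma> i j \<longleftrightarrow> val \<Gamma> i j \<noteq> 0"

definition valued_graph :: "('i :: finite, 'c, 'd, 'b) modulation \<Rightarrow> bool"
  where "valued_graph \<Gamma> \<longleftrightarrow>
    card (UNIV :: 'i set) > 1 \<and>
    (\<forall>i. val \<Gamma> i i = 0) \<and>
    (\<exists>d :: 'i \<Rightarrow> nat. (\<forall>i. d i > 0) \<and> (\<forall>i j. d i * val \<Gamma> i j = d j * val \<Gamma> j i)) \<and>
    (\<forall>i j. (edge \<Gamma>)\<^sup>*\<^sup>* i j)"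

definition modulated_graph :: "('i :: finite, 'c, 'd, 'b) modulation \<Rightarrow> bool"
  where "modulated_graph \<Gamma> \<longleftrightarrow>
    valued_graph \<Gamma> \<and>
    field (ground \<Gamma>) \<and>
    (\<forall>i. skew_field (dring \<Gamma> i) \<and>
      scalar \<Gamma> i \<in> ring_hom (ground \<Gamma>) (dring \<Gamma> i) \<and>
      (\<forall>c\<in>carrier (ground \<Gamma>). \<forall>a\<in>carrier (dring \<Gamma> i).
        scalar \<Gamma> i c \<otimes>\<^bsub>dring \<Gamma> i\<^esub> a = a \<otimes>\<^bsub>dring \<Gamma> i\<^esub> scalar \<Gamma> i c) \<and>
      ring.finite_dimension (dring \<Gamma> i) (scalar \<Gamma> i ` carrier (ground \<Gamma>)) (carrier (dring \<Gamma> i))) \<and>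
    (\<forall>i j. edge \<Gamma> i j \<longrightarrow>
      bimodule (dring \<Gamma> i) (dring \<Gamma> j) (bimod \<Gamma> i j) \<and>
      (\<forall>c\<in>carrier (ground \<Gamma>). \<forall>x\<in>carrier (bimod \<Gamma> i j).
        scalar \<Gamma> i c \<odot>\<^bsub>bimod \<Gamma> i j\<^esub> x = x \<odot>\<^sub>r\<^bsub>bimod \<Gamma> i j\<^esub> scalar \<Gamma> j c) \<and>
      has_dim (dring \<Gamma> i) (bimod \<Gamma> i j) (val \<Gamma> i j) \<and>
      (\<exists>\<phi>. bimodule_iso (dring \<Gamma> j) (dring \<Gamma> i) (bimod \<Gamma> j i)
              (left_dual (dring \<Gamma> i) (bimod \<Gamma> i j)) \<phi>) \<and>
      bimodule_iso (dring \<Gamma> j) (dring \<Gamma> i) (bimod \<Gamma> j i)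
        (right_dual (dring \<Gamma> j) (bimod \<Gamma> i j)) (pairing \<Gamma> i j))"

text \<open>An orientation is its set of arrows, \<open>(i, j)\<close> being an arrow \<open>i \<rightarrow> j\<close>.\<close>

definition orientation :: "('i, 'c, 'd, 'b) modulation \<Rightarrow> 'i rel \<Rightarrow> bool"
  where "orientation \<Gamma> \<Lambda> \<longleftrightarrow>
    (\<forall>i j. edge \<Gamma> i j \<longleftrightarrow> (i, j) \<in> \<Lambda> \<or> (j, i) \<in> \<Lambda>) \<and>
    (\<forall>i j. (i, j) \<in> \<Lambda> \<longrightarrow> (j, i) \<notin> \<Lambda>) \<and>
    acyclic \<Lambda>"

definition sink :: "'i rel \<Rightarrow> 'i \<Rightarrow> bool"
  where "sink \<Lambda> x \<longleftrightarrow> (\<forall>y. (x, y) \<notin> \<Lambda>)"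

definition reverse_at :: "'i \<Rightarrow> 'i rel \<Rightarrow> 'i rel"
  where "reverse_at x \<Lambda> =
    {(i, j) \<in> \<Lambda>. i \<noteq> x \<and> j \<noteq> x} \<union> {(j, i) | i j. (i, j) \<in> \<Lambda> \<and> (i = x \<or> j = x)}"


section \<open>Representations\<close>

record ('i, 'd, 'b, 'v) rep =
  space :: "'i \<Rightarrow> ('d, 'v) module"
  arr :: "'i \<Rightarrow> 'i \<Rightarrow> ('b, 'v) tensor \<Rightarrow> 'v"

text \<open>The left \<open>dring \<Gamma> j\<close>-space \<open>\<^sub>jB\<^sub>i \<otimes> V\<^sub>i\<close>.\<close>

definition twisted ::
  "('i, 'c, 'd, 'b) modulation \<Rightarrow> ('i, 'd, 'b, 'v) rep \<Rightarrow> 'i \<Rightarrow> 'i \<Rightarrow> ('d, ('b, 'v) tensor) module"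
  where "twisted \<Gamma> M j i = tensor_product (dring \<Gamma> i) (bimod \<Gamma> j i) (space M i)"

definition quiver_rep ::
  "('i, 'c, 'd, 'b) modulation \<Rightarrow> 'i rel \<Rightarrow> ('i, 'd, 'b, 'v) rep \<Rightarrow> bool"
  where "quiver_rep \<Gamma> \<Lambda> M \<longleftrightarrow>
    (\<forall>i. left_module (dring \<Gamma> i) (space M i) \<and> (\<exists>n. has_dim (dring \<Gamma> i) (space M i) n)) \<and>
    (\<forall>(i, j)\<in>\<Lambda>. left_linear (dring \<Gamma> j) (twisted \<Gamma> M j i) (space M j) (arr M i j))"

definition zero_rep :: "('i, 'd, 'b, 'v) rep \<Rightarrow> bool"
  where "zero_rep M \<longleftrightarrow> (\<forall>i. carrier (space M i) = {\<zero>\<^bsub>space M i\<^esub>})"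

definition subrepresentation ::
  "('i, 'c, 'd, 'b) modulation \<Rightarrow> 'i rel \<Rightarrow> ('i, 'd, 'b, 'v) rep \<Rightarrow> ('i \<Rightarrow> 'v set) \<Rightarrow> bool"
  where "subrepresentation \<Gamma> \<Lambda> M U \<longleftrightarrow>
    (\<forall>i. submodule (U i) (dring \<Gamma> i) (space M i)) \<and>
    (\<forall>(i, j)\<in>\<Lambda>. \<forall>b\<in>carrier (bimod \<Gamma> j i). \<forall>u\<in>U i.
      arr M i j (pure_tensor (dring \<Gamma> i) (bimod \<Gamma> j i) (space M i) b u) \<in> U j)"

definition indecomposable ::
  "('i, 'c, 'd, 'b) modulation \<Rightarrow> 'i rel \<Rightarrow> ('i, 'd, 'b, 'v) rep \<Rightarrow> bool"
  where "indecomposable \<Gamma> \<Lambda> M \<longleftrightarrow>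
    \<not> zero_rep M \<and>
    (\<forall>U U'. subrepresentation \<Gamma> \<Lambda> M U \<and> subrepresentation \<Gamma> \<Lambda> M U' \<and>
      (\<forall>i. U i <+>\<^bsub>space M i\<^esub> U' i = carrier (space M i) \<and> U i \<inter> U' i = {\<zero>\<^bsub>space M i\<^esub>}) \<longrightarrow>
      (\<forall>i. U i = {\<zero>\<^bsub>space M i\<^esub>}) \<or> (\<forall>i. U' i = {\<zero>\<^bsub>space M i\<^esub>}))"


section \<open>Reflection functors\<close>

text \<open>
  To iterate reflections inside HOL, the elements of \<open>Ker h\<close> (families of cosets) must be renamed
  back into the type of vectors of the given representation. Vectors therefore live in a type \<open>vec\<close>
  that provides, besides arbitrary vectors \<open>Vec v\<close>, names \<open>Formal l\<close> for families, indexed by the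
  vertices \<open>y\<close>, of tensors, where \<open>l y\<close> lists the terms \<open>n (b \<otimes> v)\<close> of a chosen representative.
  Every representation with vectors in \<open>'v\<close> has an isomorphic copy with vectors in
  \<open>('i, 'b, 'v) vec\<close> via \<open>Vec\<close>.
\<close>

datatype ('i, 'b, 'v) vec =
    Vec 'v
  | Formal "'i \<Rightarrow> (int \<times> 'b \<times> ('i, 'b, 'v) vec) list"

definition formal_sum :: "(int \<times> 'p) list \<Rightarrow> 'p \<Rightarrow>\<^sub>0 int"
  where "formal_sum l = (\<Sum>(n, p)\<leftarrow>l. frag_cmul n (frag_of p))"

definition tensor_name :: "('i \<Rightarrow> ('b, ('i, 'b, 'v) vec) tensor) \<Rightarrow> ('i, 'b, 'v) vec"
  where "tensor_name t = Formal (\<lambda>y. SOME l. formal_sum l \<in> t y)"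

definition rename_module :: "('m \<Rightarrow> 'n) \<Rightarrow> ('r, 'm) module \<Rightarrow> ('r, 'n) module"
  where "rename_module e M =
    (let d = inv_into (carrier M) e in
      \<lparr>carrier = e ` carrier M,
       mult = undefined, one = undefined,
       ring.zero = e \<zero>\<^bsub>M\<^esub>,
       add = (\<lambda>u v. e (d u \<oplus>\<^bsub>M\<^esub> d v)),
       smult = (\<lambda>a u. e (a \<odot>\<^bsub>M\<^esub> d u))\<rparr>)"

text \<open>The domain \<open>\<Oplus> \<^sub>xB\<^sub>y \<otimes> V\<^sub>y\<close> (over the arrows \<open>y \<rightarrow> x\<close>) of the map \<open>h\<close>.\<close>

definition incoming_sum ::
  "('i, 'c, 'd, 'b) modulation \<Rightarrow> 'i rel \<Rightarrow> 'i \<Rightarrow> ('i, 'd, 'b, 'v) rep \<Rightarrow>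
   ('d, 'i \<Rightarrow> ('b, 'v) tensor) module"
  where "incoming_sum \<Gamma> \<Lambda> x M =
    (let Y = {y. (y, x) \<in> \<Lambda>} in
      \<lparr>carrier = (\<Pi>\<^sub>E y\<in>Y. carrier (twisted \<Gamma> M x y)),
       mult = undefined, one = undefined,
       ring.zero = (\<lambda>y\<in>Y. \<zero>\<^bsub>twisted \<Gamma> M x y\<^esub>),
       add = (\<lambda>s t. \<lambda>y\<in>Y. s y \<oplus>\<^bsub>twisted \<Gamma> M x y\<^esub> t y),
       smult = (\<lambda>a t. \<lambda>y\<in>Y. a \<odot>\<^bsub>twisted \<Gamma> M x y\<^esub> t y)\<rparr>)"

definition incoming_map :: "'i rel \<Rightarrow> 'i \<Rightarrow> ('i, 'd, 'b, 'v) rep \<Rightarrow> ('i \<Rightarrow> ('b, 'v) tensor) \<Rightarrow> 'v"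
  where "incoming_map \<Lambda> x M t = (\<Oplus>\<^bsub>space M x\<^esub>y\<in>{y. (y, x) \<in> \<Lambda>}. arr M y x (t y))"

definition incoming_kernel ::
  "('i, 'c, 'd, 'b) modulation \<Rightarrow> 'i rel \<Rightarrow> 'i \<Rightarrow> ('i, 'd, 'b, 'v) rep \<Rightarrow>
   ('d, 'i \<Rightarrow> ('b, 'v) tensor) module"
  where "incoming_kernel \<Gamma> \<Lambda> x M = (incoming_sum \<Gamma> \<Lambda> x M)
    \<lparr>carrier := {t \<in> carrier (incoming_sum \<Gamma> \<Lambda> x M). incoming_map \<Lambda> x M t = \<zero>\<^bsub>space M x\<^esub>}\<rparr>"

text \<open>
  For a reversed arrow \<open>x \<rightarrow> y\<close>, the natural isomorphism turns \<open>W\<^sub>x \<rightarrow> \<^sub>xB\<^sub>y \<otimes> W\<^sub>y\<close>,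
  \<open>w \<mapsto> \<Sum> b \<otimes> v\<close>, into \<open>\<^sub>yB\<^sub>x \<otimes> W\<^sub>x \<rightarrow> W\<^sub>y\<close>, \<open>b' \<otimes> w \<mapsto> \<Sum> \<psi>(b')(b) v\<close>, where
  \<open>\<psi> = pairing \<Gamma> x y\<close>; that is, it is the composite of the isomorphisms
  \<open>\<^sub>xB\<^sub>y \<otimes> W\<^sub>y \<cong> Hom(Hom(\<^sub>xB\<^sub>y, k\<^sub>y), W\<^sub>y) \<cong> Hom(\<^sub>yB\<^sub>x, W\<^sub>y)\<close> of left \<open>k\<^sub>x\<close>-spaces with the
  tensor-hom adjunction.
\<close>

definition reflect ::
  "('i, 'c, 'd, 'b) modulation \<Rightarrow> 'i rel \<Rightarrow> 'i \<Rightarrow> ('i, 'd, 'b, ('i, 'b, 'v) vec) rep \<Rightarrow>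
   ('i, 'd, 'b, ('i, 'b, 'v) vec) rep"
  where "reflect \<Gamma> \<Lambda> x M =
    (let K = incoming_kernel \<Gamma> \<Lambda> x M; tensors = inv_into (carrier K) tensor_name in
      \<lparr>space = (space M)(x := rename_module tensor_name K),
       arr = (\<lambda>i j. if i = x
         then tensor_lift (space M j) (\<lambda>b' w.
           tensor_lift (space M j) (\<lambda>b v. pairing \<Gamma> x j b' b \<odot>\<^bsub>space M j\<^esub> v) (tensors w j))
         else arr M i j)\<rparr>)"


section \<open>Admissible sequences\<close>

fun admissible :: "'i rel \<Rightarrow> 'i list \<Rightarrow> bool" where
  "admissible \<Lambda> [] \<longleftrightarrow> True"
| "admissible \<Lambda> (x # S) \<longleftrightarrow> sink \<Lambda> x \<and> admissible (reverse_at x \<Lambda>) S"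

fun reverse_along :: "'i list \<Rightarrow> 'i rel \<Rightarrow> 'i rel" where
  "reverse_along [] \<Lambda> = \<Lambda>"
| "reverse_along (x # S) \<Lambda> = reverse_along S (reverse_at x \<Lambda>)"

fun reflect_along ::
  "('i, 'c, 'd, 'b) modulation \<Rightarrow> 'i rel \<Rightarrow> 'i list \<Rightarrow> ('i, 'd, 'b, ('i, 'b, 'v) vec) rep \<Rightarrow>
   ('i, 'd, 'b, ('i, 'b, 'v) vec) rep" where
  "reflect_along \<Gamma> \<Lambda> [] M = M"
| "reflect_along \<Gamma> \<Lambda> (x # S) M = reflect_along \<Gamma> (reverse_at x \<Lambda>) S (reflect \<Gamma> \<Lambda> x M)"

definition interchange ::
  "('i, 'c, 'd, 'b) modulation \<Rightarrow> 'i rel \<Rightarrow> 'i list \<Rightarrow> 'i list \<Rightarrow> bool"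
  where "interchange \<Gamma> \<Lambda> S T \<longleftrightarrow>
    admissible \<Lambda> S \<and> admissible \<Lambda> T \<and>
    (\<exists>P Q x y. S = P @ [x, y] @ Q \<and> T = P @ [y, x] @ Q \<and> \<not> edge \<Gamma> x y)"

definition seq_equiv ::
  "('i, 'c, 'd, 'b) modulation \<Rightarrow> 'i rel \<Rightarrow> 'i list \<Rightarrow> 'i list \<Rightarrow> bool"
  where "seq_equiv \<Gamma> \<Lambda> = equivclp (interchange \<Gamma> \<Lambda>)"

definition subsequence ::
  "('i, 'c, 'd, 'b) modulation \<Rightarrow> 'i rel \<Rightarrow> 'i list \<Rightarrow> 'i list \<Rightarrow> bool"
  where "subsequence \<Gamma> \<Lambda> S T \<longleftrightarrow>
    admissible \<Lambda> S \<and> admissible \<Lambda> T \<and>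
    (\<exists>U. admissible (reverse_along S \<Lambda>) U \<and> seq_equiv \<Gamma> \<Lambda> T (S @ U))"

definition annihilates ::
  "('i, 'c, 'd, 'b) modulation \<Rightarrow> 'i rel \<Rightarrow> 'i list \<Rightarrow> ('i, 'd, 'b, ('i, 'b, 'v) vec) rep \<Rightarrow> bool"
  where "annihilates \<Gamma> \<Lambda> S M \<longleftrightarrow> admissible \<Lambda> S \<and> zero_rep (reflect_along \<Gamma> \<Lambda> S M)"

definition shortest_annihilating ::
  "('i, 'c, 'd, 'b) modulation \<Rightarrow> 'i rel \<Rightarrow> 'i list \<Rightarrow> ('i, 'd, 'b, ('i, 'b, 'v) vec) rep \<Rightarrow> bool"
  where "shortest_annihilating \<Gamma> \<Lambda> S M \<longleftrightarrow>
    annihilates \<Gamma> \<Lambda> S M \<and>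
    (\<forall>T. subsequence \<Gamma> \<Lambda> T S \<and> \<not> seq_equiv \<Gamma> \<Lambda> T S \<longrightarrow> \<not> annihilates \<Gamma> \<Lambda> T M)"

definition preprojective ::
  "('i, 'c, 'd, 'b) modulation \<Rightarrow> 'i rel \<Rightarrow> ('i, 'd, 'b, ('i, 'b, 'v) vec) rep \<Rightarrow> bool"
  where "preprojective \<Gamma> \<Lambda> M \<longleftrightarrow> (\<exists>S. annihilates \<Gamma> \<Lambda> S M)"


section \<open>Principal sequences\<close>

definition is_filter :: "'i rel \<Rightarrow> 'i set \<Rightarrow> bool"
  where "is_filter \<Lambda> F \<longleftrightarrow> (\<forall>x y. x \<in> F \<and> (x, y) \<in> \<Lambda>\<^sup>* \<longrightarrow> y \<in> F)"

definition principal_filter :: "'i rel \<Rightarrow> 'i \<Rightarrow> 'i set"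
  where "principal_filter \<Lambda> x = {y. (x, y) \<in> \<Lambda>\<^sup>*}"

definition filter_hull :: "('i, 'c, 'd, 'b) modulation \<Rightarrow> 'i rel \<Rightarrow> 'i set \<Rightarrow> 'i set"
  where "filter_hull \<Gamma> \<Lambda> F =
    \<Inter>{G. is_filter \<Lambda> G \<and> F \<subseteq> G \<and> {y. y \<notin> F \<and> (\<exists>x\<in>F. edge \<Gamma> y x)} \<subseteq> G}"

definition canonical_form ::
  "('i, 'c, 'd, 'b) modulation \<Rightarrow> 'i rel \<Rightarrow> 'i list \<Rightarrow> 'i list list \<Rightarrow> bool"
  where "canonical_form \<Gamma> \<Lambda> S Ss \<longleftrightarrow>
    seq_equiv \<Gamma> \<Lambda> S (concat Ss) \<and>
    (\<forall>i<length Ss. Ss ! i \<noteq> [] \<and> distinct (Ss ! i) \<and> set (Ss ! i) = set (concat (drop i Ss)))"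

definition principal_seq :: "('i, 'c, 'd, 'b) modulation \<Rightarrow> 'i rel \<Rightarrow> 'i list \<Rightarrow> bool"
  where "principal_seq \<Gamma> \<Lambda> S \<longleftrightarrow>
    admissible \<Lambda> S \<and> S \<noteq> [] \<and>
    (\<exists>Ss. canonical_form \<Gamma> \<Lambda> S Ss \<and>
      (\<forall>i. Suc i < length Ss \<longrightarrow> set (Ss ! i) = filter_hull \<Gamma> \<Lambda> (set (Ss ! Suc i))) \<and>
      (\<exists>x. set (last Ss) = principal_filter \<Lambda> x))"

end

theory Submission
  imports Defs
begin

text \<open>
  Call a vertex in \<open>Supp S\<close> last if it is a source of \<open>\<Lambda>\<^sup>S\<close>, that is, if \<open>S\<close> is equivalent to a sequence
  ending in it. Two different last vertices \<open>u\<close>, \<open>v\<close> of a shortest annihilating sequence are not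
  adjacent, and \<open>S \<sim> U u v \<sim> U v u\<close>. Then \<open>F(U)M\<close> is killed by \<open>F\<^sub>v\<^sup>+F\<^sub>u\<^sup>+\<close> and hence supported at the
  sinks \<open>u\<close> and \<open>v\<close>, while neither \<open>F\<^sub>u\<^sup>+\<close> nor \<open>F\<^sub>v\<^sup>+\<close> kills it; so it is the direct sum of two nonzero
  subrepresentations. But a reflection of an indecomposable representation is zero or
  indecomposable: unless the map \<open>h\<close> defining \<open>F\<^sub>x\<^sup>+M = W\<close> is onto, a complement of its image splits
  off from \<open>M\<close>, and if it is onto then \<open>M\<^sub>x\<close> is the quotient of \<open>\<Oplus> \<^sub>xB\<^sub>y \<otimes> W\<^sub>y\<close> by \<open>W\<^sub>x\<close>, so that
  decompositions of \<open>W\<close> induce decompositions of \<open>M\<close>. Hence \<open>S\<close> has only one last vertex, and this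
  is what being principal amounts to.
\<close>


section \<open>Admissible sequences\<close>

text \<open>The combinatorial side runs on multiplicities: the two ends of an edge occur alternately
  in an admissible sequence, so the orientation after \<open>S\<close> can be read off from
  \<open>count_list S\<close>. Layers of the canonical form, filters and last vertices all become
  statements about one counting function, which grows by 0 or 1 along each arrow.

  On the algebraic side no inverse reflection functor is built. A decomposition of the reflected
  representation is pushed forward along \<open>h\<close>, and the delicate point is that the pushed
  parts meet only in zero at \<open>x\<close>. For this, the part \<open>W x\<close> of the kernel
  must consist of families with entries in the spans of the parts \<open>W y\<close>. Being a
  subrepresentation yields only closure under the reversed arrows, that is, under contractions with
  functionals; dual bases turn this into membership in the span. Here both duality isomorphisms of
  the modulation are used together.

  Kernel elements are stored under names that depend on the family alone. Hence reflections at two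
  nonadjacent sinks give literally equal spaces in either order, and invariance of annihilation
  under \<open>seq_equiv\<close> requires no isomorphisms of representations.\<close>

lemma admissible_append:
  "admissible \<Lambda> (S @ T) \<longleftrightarrow> admissible \<Lambda> S \<and> admissible (reverse_along S \<Lambda>) T"
  by (induction S arbitrary: \<Lambda>) auto

lemma reverse_along_append: "reverse_along (S @ T) \<Lambda> = reverse_along T (reverse_along S \<Lambda>)"
  by (induction S arbitrary: \<Lambda>) auto

lemma reverse_at_commute: "reverse_at x (reverse_at y \<Lambda>) = reverse_at y (reverse_at x \<Lambda>)"
  unfolding reverse_at_def by auto

lemma edge_iff:
  assumes "orientation \<Gamma> \<Lambda>"
  shows "edge \<Gamma> i j \<longleftrightarrow> (i, j) \<in> \<Lambda> \<or> (j, i) \<in> \<Lambda>"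
  using assms unfolding orientation_def by blast

lemma orientation_asym:
  assumes "orientation \<Gamma> \<Lambda>" "(i, j) \<in> \<Lambda>"
  shows "(j, i) \<notin> \<Lambda>"
  using assms unfolding orientation_def by blast

lemma orientation_irrefl:
  assumes "orientation \<Gamma> \<Lambda>"
  shows "(i, i) \<notin> \<Lambda>"
  using assms unfolding orientation_def by blast

lemma edge_sym:
  assumes "orientation \<Gamma> \<Lambda>" "edge \<Gamma> i j"
  shows "edge \<Gamma> j i"
  using assms edge_iff by metis

text \<open>After the reversal \<open>x\<close> is a source, so a path that starts elsewhere never
  enters \<open>x\<close> and is a path of \<open>\<Lambda>\<close>. A directed cycle would avoid
  \<open>x\<close> altogether and already be one of \<open>\<Lambda>\<close>.\<close>

lemma orientation_reverse_at:
  assumes "orientation \<Gamma> \<Lambda>" "sink \<Lambda> x"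
  shows "orientation \<Gamma> (reverse_at x \<Lambda>)"
proof -
  have nox: "(i, x) \<notin> reverse_at x \<Lambda>" for i
    using assms orientation_irrefl[OF assms(1)] by (auto simp: reverse_at_def sink_def)
  have path: "(i, j) \<in> \<Lambda>\<^sup>+" if "(i, j) \<in> (reverse_at x \<Lambda>)\<^sup>+" "i \<noteq> x" for i j
    using that
  proof (induction rule: trancl_induct)
    case (base j)
    then have "(i, j) \<in> \<Lambda>" using nox[of i] by (auto simp: reverse_at_def)
    then show ?case by blast
  next
    case (step j l)
    then have "j \<noteq> x" using nox by (meson trancl.cases)
    with step have "(j, l) \<in> \<Lambda>" using nox[of j] by (auto simp: reverse_at_def)
    then show ?case using step by (meson trancl.trancl_into_trancl)
  qed
  have "acyclic (reverse_at x \<Lambda>)"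
    unfolding acyclic_def
  proof (intro allI notI)
    fix i assume i: "(i, i) \<in> (reverse_at x \<Lambda>)\<^sup>+"
    then have "i \<noteq> x" using nox by (meson trancl.cases)
    with path[OF i] assms show False by (auto simp: orientation_def acyclic_def)
  qed
  moreover have "edge \<Gamma> i j \<longleftrightarrow> (i, j) \<in> reverse_at x \<Lambda> \<or> (j, i) \<in> reverse_at x \<Lambda>" for i j
    using edge_iff[OF assms(1), of i j] by (auto simp: reverse_at_def)
  moreover have "(j, i) \<notin> reverse_at x \<Lambda>" if "(i, j) \<in> reverse_at x \<Lambda>" for i j
    using that orientation_asym[OF assms(1)] by (auto simp: reverse_at_def)
  ultimately show ?thesis unfolding orientation_def by blast
qed

lemma orientation_reverse_along:
  assumes "orientation \<Gamma> \<Lambda>" "admissible \<Lambda> S"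
  shows "orientation \<Gamma> (reverse_along S \<Lambda>)"
  using assms by (induction S arbitrary: \<Lambda>) (auto simp: orientation_reverse_at)

text \<open>A vertex is used only while it is a sink, and using it turns the edge towards the other
  end. So \<open>i\<close> and \<open>j\<close> alternate in \<open>S\<close>, starting with
  \<open>j\<close>, and the difference of their counts is 0 or 1 according to the final direction of
  the edge.\<close>

lemma count_along_arrow:
  assumes "orientation \<Gamma> \<Lambda>" "admissible \<Lambda> S" "(i, j) \<in> \<Lambda>"
  shows "count_list S j = count_list S i \<and> (i, j) \<in> reverse_along S \<Lambda> \<or>
    count_list S j = Suc (count_list S i) \<and> (j, i) \<in> reverse_along S \<Lambda>"
  using assms
proof (induction S arbitrary: \<Lambda> i j)
  case (Cons x S)
  have x: "sink \<Lambda> x" "admissible (reverse_at x \<Lambda>) S" using Cons.prems by auto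
  have or: "orientation \<Gamma> (reverse_at x \<Lambda>)" by (rule orientation_reverse_at[OF Cons.prems(1) x(1)])
  have ix: "i \<noteq> x" using x Cons.prems(3) by (auto simp: sink_def)
  show ?case
  proof (cases "j = x")
    case True
    then have "(j, i) \<in> reverse_at x \<Lambda>" using Cons.prems(3) by (auto simp: reverse_at_def)
    from Cons.IH[OF or x(2) this] show ?thesis using True ix by auto
  next
    case False
    then have "(i, j) \<in> reverse_at x \<Lambda>" using Cons.prems(3) ix by (auto simp: reverse_at_def)
    from Cons.IH[OF or x(2) this] show ?thesis using False ix by auto
  qed
qed simp

section \<open>Equivalence of admissible sequences under interchanges\<close>

lemma seq_equiv_refl: "seq_equiv \<Gamma> \<Lambda> S S"
  by (simp add: seq_equiv_def)

lemma seq_equiv_sym: "seq_equiv \<Gamma> \<Lambda> S T \<Longrightarrow> seq_equiv \<Gamma> \<Lambda> T S"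
  by (simp add: seq_equiv_def equivclp_sym)

lemma seq_equiv_trans: "seq_equiv \<Gamma> \<Lambda> S T \<Longrightarrow> seq_equiv \<Gamma> \<Lambda> T U \<Longrightarrow> seq_equiv \<Gamma> \<Lambda> S U"
  unfolding seq_equiv_def by (rule equivclp_trans)

lemma interchange_imp_seq_equiv: "interchange \<Gamma> \<Lambda> S T \<Longrightarrow> seq_equiv \<Gamma> \<Lambda> S T"
  unfolding seq_equiv_def by blast

lemma interchange_sym:
  assumes "orientation \<Gamma> \<Lambda>" "interchange \<Gamma> \<Lambda> S T"
  shows "interchange \<Gamma> \<Lambda> T S"
  using assms edge_sym[OF assms(1)] unfolding interchange_def by blast

text \<open>Interchanges are symmetric because edges are, so the equivalence closure is reached by
  forward steps.\<close>

lemma seq_equiv_induct [consumes 2, case_names refl step]: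
  assumes "orientation \<Gamma> \<Lambda>" "seq_equiv \<Gamma> \<Lambda> S T"
    and "P S" and "\<And>T U. P T \<Longrightarrow> interchange \<Gamma> \<Lambda> T U \<Longrightarrow> P U"
  shows "P T"
  using assms(2) unfolding seq_equiv_def
proof (induction rule: equivclp_induct)
  case base
  then show ?case by (rule assms(3))
next
  case (step y z)
  then show ?case using assms(4) interchange_sym[OF assms(1)] by blast
qed

text \<open>Swapping letters changes no counts, and reversals at any two vertices commute.\<close>

lemma interchange_invariants:
  assumes "interchange \<Gamma> \<Lambda> S T"
  shows "count_list T = count_list S" "reverse_along T \<Lambda> = reverse_along S \<Lambda>"
  using assms by (auto simp: interchange_def reverse_along_append reverse_at_commute fun_eq_iff)

lemma seq_equiv_invariants:
  assumes "orientation \<Gamma> \<Lambda>" "seq_equiv \<Gamma> \<Lambda> S T" "admissible \<Lambda> S"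
  shows "admissible \<Lambda> T" "count_list T = count_list S" "reverse_along T \<Lambda> = reverse_along S \<Lambda>"
proof -
  have "admissible \<Lambda> T \<and> count_list T = count_list S \<and> reverse_along T \<Lambda> = reverse_along S \<Lambda>"
    using assms(1,2)
  proof (induction rule: seq_equiv_induct)
    case refl
    then show ?case using assms(3) by simp
  next
    case (step T U)
    then show ?case using interchange_invariants by (metis interchange_def)
  qed
  then show "admissible \<Lambda> T" "count_list T = count_list S" "reverse_along T \<Lambda> = reverse_along S \<Lambda>" by auto
qed

lemma seq_equiv_append:
  assumes "orientation \<Gamma> \<Lambda>" "seq_equiv \<Gamma> \<Lambda> S T" "admissible \<Lambda> (S @ U)"
  shows "seq_equiv \<Gamma> \<Lambda> (S @ U) (T @ U)"
proof -
  have "seq_equiv \<Gamma> \<Lambda> (S @ U) (T @ U) \<and> admissible \<Lambda> (T @ U)"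
    using assms(1,2)
  proof (induction rule: seq_equiv_induct)
    case refl
    then show ?case using assms(3) by (simp add: seq_equiv_refl)
  next
    case (step T T')
    have adm: "admissible \<Lambda> (T' @ U)"
      using step interchange_invariants[OF step(2)] unfolding admissible_append interchange_def by metis
    have "interchange \<Gamma> \<Lambda> (T @ U) (T' @ U)"
      using step adm unfolding interchange_def by (metis append.assoc)
    then show ?case using step adm seq_equiv_trans interchange_imp_seq_equiv by metis
  qed
  then show ?thesis ..
qed

lemma sink_reverse_at:
  assumes "orientation \<Gamma> \<Lambda>" "\<not> edge \<Gamma> x y" "x \<noteq> y"
  shows "sink (reverse_at x \<Lambda>) y \<longleftrightarrow> sink \<Lambda> y"
  using edge_iff[OF assms(1), of x y] assms(2,3) unfolding sink_def reverse_at_def by auto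


text \<open>Reversing at one of two nonadjacent vertices touches no edge at the other, so being a
  sink does not depend on the order in which they are used.\<close>

lemma admissible_swap:
  assumes "orientation \<Gamma> \<Lambda>" "\<not> edge \<Gamma> x y" "admissible \<Lambda> (P @ [x, y] @ Q)"
  shows "admissible \<Lambda> (P @ [y, x] @ Q)"
proof (cases "x = y")
  case False
  define \<Lambda>' where "\<Lambda>' = reverse_along P \<Lambda>"
  have or: "orientation \<Gamma> \<Lambda>'"
    using assms orientation_reverse_along unfolding \<Lambda>'_def admissible_append by blast
  have "\<not> edge \<Gamma> y x" using edge_sym assms by metis
  then show ?thesis
    using assms(2,3) sink_reverse_at[OF or, of x y] sink_reverse_at[OF or, of y x] False
      reverse_at_commute[of x y \<Lambda>']
    unfolding admissible_append by (auto simp: \<Lambda>'_def[symmetric])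
qed (use assms in simp)

lemma seq_equiv_move:
  assumes "orientation \<Gamma> \<Lambda>" "\<And>w. w \<in> set B \<Longrightarrow> \<not> edge \<Gamma> v w" "admissible \<Lambda> (A @ v # B @ C)"
  shows "seq_equiv \<Gamma> \<Lambda> (A @ v # B @ C) (A @ B @ v # C)"
  using assms(2,3)
proof (induction B arbitrary: A)
  case Nil
  then show ?case by (simp add: seq_equiv_refl)
next
  case (Cons b B)
  have "\<not> edge \<Gamma> v b" using Cons.prems by simp
  moreover from this have adm: "admissible \<Lambda> (A @ [b, v] @ B @ C)"
    by (rule admissible_swap[OF assms(1)]) (use Cons.prems in simp)
  ultimately have "interchange \<Gamma> \<Lambda> (A @ [v, b] @ B @ C) (A @ [b, v] @ B @ C)"
    using Cons.prems(2) unfolding interchange_def by (metis append_Cons append_Nil)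
  moreover have "seq_equiv \<Gamma> \<Lambda> ((A @ [b]) @ v # B @ C) ((A @ [b]) @ B @ v # C)"
    by (rule Cons.IH) (use Cons.prems adm in auto)
  ultimately show ?case using seq_equiv_trans interchange_imp_seq_equiv by fastforce
qed


section \<open>Last vertices of a sequence\<close>

definition last_vertex :: "('i, 'c, 'd, 'b) modulation \<Rightarrow> 'i rel \<Rightarrow> 'i list \<Rightarrow> 'i \<Rightarrow> bool"
  where "last_vertex \<Gamma> \<Lambda> S v \<longleftrightarrow>
    v \<in> set S \<and> (\<forall>w. edge \<Gamma> v w \<longrightarrow> (v, w) \<in> reverse_along S \<Lambda>)"

text \<open>Right after its final occurrence \<open>v\<close> is a source. A neighbour occurring
  later would turn an edge back towards \<open>v\<close>, and with no further occurrence of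
  \<open>v\<close> it could not be turned again. Hence all later vertices are nonneighbours and
  \<open>v\<close> can be moved past them.\<close>

lemma last_vertex_imp_seq_equiv:
  assumes or: "orientation \<Gamma> \<Lambda>" and adm: "admissible \<Lambda> S" and v: "last_vertex \<Gamma> \<Lambda> S v"
  shows "\<exists>U. seq_equiv \<Gamma> \<Lambda> S (U @ [v])"
proof -
  obtain A B where S: "S = A @ v # B" "v \<notin> set B"
    using v by (meson last_vertex_def split_list_last)
  define \<Lambda>1 where "\<Lambda>1 = reverse_along (A @ [v]) \<Lambda>"
  have or0: "orientation \<Gamma> (reverse_along A \<Lambda>)" and sink: "sink (reverse_along A \<Lambda>) v"
    and or1: "orientation \<Gamma> \<Lambda>1" and admB: "admissible \<Lambda>1 B"
    and or2: "orientation \<Gamma> (reverse_along S \<Lambda>)"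
    and last: "reverse_along S \<Lambda> = reverse_along B \<Lambda>1"
    using orientation_reverse_along[OF or, of A] orientation_reverse_along[OF or, of "A @ [v]"]
      orientation_reverse_along[OF or adm] adm
    by (auto simp: S admissible_append reverse_along_append \<Lambda>1_def)
  have "\<not> edge \<Gamma> v w" if "w \<in> set B" for w
  proof
    assume e: "edge \<Gamma> v w"
    then have "(w, v) \<in> reverse_along A \<Lambda>"
      using edge_iff[OF or0, of v w] sink by (auto simp: sink_def)
    then have "(v, w) \<in> \<Lambda>1" by (auto simp: \<Lambda>1_def reverse_along_append reverse_at_def)
    moreover have "(v, w) \<in> reverse_along S \<Lambda>" using v e by (simp add: last_vertex_def)
    ultimately have "count_list B w = count_list B v"
      using count_along_arrow[OF or1 admB, of v w] orientation_asym[OF or2, of v w] last by auto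
    then show False using S(2) that by (simp add: count_list_0_iff)
  qed
  then have "seq_equiv \<Gamma> \<Lambda> (A @ v # B @ []) (A @ B @ v # [])"
    using seq_equiv_move[OF or, of B v A "[]"] adm S by simp
  then show ?thesis using S by (metis append.assoc append_Nil2)
qed

text \<open>An edge cannot leave both its ends, so \<open>u\<close> and \<open>v\<close> are not
  adjacent. After \<open>v\<close> has been moved to the end and removed, undoing the reversal at
  \<open>v\<close> changes no edge at \<open>u\<close>; so \<open>u\<close> is last in the remaining
  sequence and can be moved to its end in turn.\<close>

lemma two_last_vertices:
  assumes or: "orientation \<Gamma> \<Lambda>" and adm: "admissible \<Lambda> S"
    and u: "last_vertex \<Gamma> \<Lambda> S u" and v: "last_vertex \<Gamma> \<Lambda> S v" and uv: "u \<noteq> v"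
  shows "\<not> edge \<Gamma> u v \<and> (\<exists>U. seq_equiv \<Gamma> \<Lambda> S (U @ [u, v]))"
proof -
  have ne: "\<not> edge \<Gamma> u v"
    using u v edge_sym[OF or] orientation_asym[OF orientation_reverse_along[OF or adm]]
    unfolding last_vertex_def by metis
  obtain V where V: "seq_equiv \<Gamma> \<Lambda> S (V @ [v])" using last_vertex_imp_seq_equiv[OF or adm v] ..
  note inv = seq_equiv_invariants[OF or V adm]
  have "set (V @ [v]) = set S"
    using inv(2) by (metis count_list_0_iff subsetI subset_antisym)
  then have "u \<in> set V" using u uv by (auto simp: last_vertex_def)
  moreover have "(u, w) \<in> reverse_along V \<Lambda>" if "edge \<Gamma> u w" for w
  proof -
    have "(u, w) \<in> reverse_at v (reverse_along V \<Lambda>)"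
      using u that inv(3) by (simp add: last_vertex_def reverse_along_append)
    moreover have "w \<noteq> v" using ne that by auto
    ultimately show ?thesis using uv by (auto simp: reverse_at_def)
  qed
  moreover have "admissible \<Lambda> V" using inv(1) by (simp add: admissible_append)
  ultimately obtain U where U: "seq_equiv \<Gamma> \<Lambda> V (U @ [u])"
    using last_vertex_imp_seq_equiv[OF or] by (meson last_vertex_def)
  have "seq_equiv \<Gamma> \<Lambda> (V @ [v]) ((U @ [u]) @ [v])"
    using seq_equiv_append[OF or U inv(1)] .
  then show ?thesis using ne V seq_equiv_trans by fastforce
qed

text \<open>Layer \<open>k\<close> collects the vertices with more than \<open>k\<close>
  occurrences. A new final letter \<open>z\<close> with \<open>c\<close> earlier occurrences belongs
  in layer \<open>c\<close>. Being a sink at that moment, it has only neighbours that occur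
  \<open>c\<close> or \<open>c + 1\<close> times, while the layers behind layer \<open>c\<close>
  contain vertices with more than \<open>c + 1\<close> occurrences; so \<open>z\<close> can be moved
  left past them.\<close>

lemma canonical_listing:
  assumes or: "orientation \<Gamma> \<Lambda>" and adm: "admissible \<Lambda> S"
  shows "\<exists>Ss. seq_equiv \<Gamma> \<Lambda> S (concat Ss) \<and> (\<forall>v. count_list S v \<le> length Ss) \<and>
    (\<forall>k<length Ss. Ss ! k \<noteq> [] \<and> distinct (Ss ! k) \<and> set (Ss ! k) = {v. k < count_list S v})"
  using adm
proof (induction S rule: rev_induct)
  case Nil
  then show ?case by (auto intro!: exI[of _ "[]"] simp: seq_equiv_refl)
next
  case (snoc z S)
  define c where "c = count_list S z"
  have admS: "admissible \<Lambda> S" and sink: "sink (reverse_along S \<Lambda>) z"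
    using snoc.prems by (auto simp: admissible_append)
  from snoc.IH[OF admS] obtain Ss where eq: "seq_equiv \<Gamma> \<Lambda> S (concat Ss)"
    and le: "\<And>v. count_list S v \<le> length Ss"
    and Ss: "\<And>k. k < length Ss \<Longrightarrow> Ss ! k \<noteq> [] \<and> distinct (Ss ! k) \<and>
      set (Ss ! k) = {v. k < count_list S v}" by blast
  have eq': "seq_equiv \<Gamma> \<Lambda> (S @ [z]) (concat Ss @ [z])"
    using seq_equiv_append[OF or eq snoc.prems] .
  have count: "count_list (S @ [z]) v = (if v = z then Suc c else count_list S v)" for v
    by (simp add: c_def)
  show ?case
  proof (cases "c < length Ss")
    \<comment> \<open>Here \<open>z\<close> already lies in all layers and opens a new one.\<close>
    case False
    then have c: "c = length Ss" using le[of z] by (simp add: c_def)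
    have "count_list (S @ [z]) v \<le> length (Ss @ [[z]])" for v
      using le[of v] c by (simp add: count)
    moreover have "(Ss @ [[z]]) ! k \<noteq> [] \<and> distinct ((Ss @ [[z]]) ! k) \<and>
      set ((Ss @ [[z]]) ! k) = {v. k < count_list (S @ [z]) v}" if "k < length (Ss @ [[z]])" for k
    proof (cases "k < length Ss")
      case True
      then show ?thesis using Ss[OF True] c by (auto simp: nth_append count c_def)
    next
      case F: False
      then have "k = c" using that c by simp
      moreover have "\<not> c < count_list S v" for v using le[of v] c by simp
      moreover have "c < count_list (S @ [z]) z" unfolding count by simp
      ultimately show ?thesis using c \<open>k = c\<close> by (auto simp: nth_append count)
    qed
    ultimately show ?thesis using eq' by (intro exI[of _ "Ss @ [[z]]"]) auto
  next
    case True
    define Ss' where "Ss' = Ss[c := Ss ! c @ [z]]"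
    have nb: "\<not> edge \<Gamma> z w" if w: "w \<in> set (concat (drop (Suc c) Ss))" for w
    proof
      assume e: "edge \<Gamma> z w"
      obtain j where j: "j < length (drop (Suc c) Ss)" "w \<in> set (drop (Suc c) Ss ! j)"
        using w unfolding set_concat by (metis UN_E in_set_conv_nth)
      then have "w \<in> set (Ss ! (Suc c + j))" "Suc c + j < length Ss" by auto
      with Ss have "Suc c < count_list S w" by fastforce
      moreover have "(z, w) \<in> \<Lambda> \<or> (w, z) \<in> \<Lambda>" using e edge_iff[OF or] by metis
      ultimately show False
        using count_along_arrow[OF or admS] sink unfolding sink_def c_def by fastforce
    qed
    have split: "concat Ss = concat (take c Ss) @ Ss ! c @ concat (drop (Suc c) Ss)"
      using True by (metis concat.simps(2) concat_append id_take_nth_drop)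
    have split': "concat Ss' = concat (take c Ss) @ (Ss ! c @ [z]) @ concat (drop (Suc c) Ss)"
      using True by (simp add: Ss'_def upd_conv_take_nth_drop)
    have swap: "seq_equiv \<Gamma> \<Lambda> (concat Ss') (concat Ss @ [z])"
    proof -
      have adm': "admissible \<Lambda> (concat Ss @ [z])"
        using seq_equiv_invariants(1)[OF or eq' snoc.prems] .
      \<comment> \<open>\<open>seq_equiv_move\<close> starts from the sequence with \<open>z\<close>
        in front of the block, so admissibility is first carried there by swapping \<open>z\<close>
        leftwards.\<close>
      have "admissible \<Lambda> ((concat (take c Ss) @ Ss ! c) @ B @ z # C) \<Longrightarrow>
        \<forall>w\<in>set B. \<not> edge \<Gamma> z w \<Longrightarrow>
        admissible \<Lambda> ((concat (take c Ss) @ Ss ! c) @ z # B @ C)" for B C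
      proof (induction B arbitrary: C rule: rev_induct)
        case (snoc b B)
        have "\<not> edge \<Gamma> b z" using snoc.prems(2) edge_sym[OF or] by auto
        then have "admissible \<Lambda> (((concat (take c Ss) @ Ss ! c) @ B) @ [z, b] @ C)"
          by (rule admissible_swap[OF or]) (use snoc.prems in simp)
        then show ?case using snoc.IH[of "b # C"] snoc.prems(2) by simp
      qed simp
      from this[of "concat (drop (Suc c) Ss)" "[]"] adm' nb
      have "admissible \<Lambda> ((concat (take c Ss) @ Ss ! c) @ z # concat (drop (Suc c) Ss) @ [])"
        unfolding split by auto
      from seq_equiv_move[OF or _ this] nb show ?thesis unfolding split split' by simp
    qed
    have "seq_equiv \<Gamma> \<Lambda> (S @ [z]) (concat Ss')"
      using eq' swap seq_equiv_sym seq_equiv_trans by metis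
    moreover have "count_list (S @ [z]) v \<le> length Ss'" for v
      unfolding count using le[of v] True by (simp add: Ss'_def)
    moreover have "Ss' ! k \<noteq> [] \<and> distinct (Ss' ! k) \<and> set (Ss' ! k) = {v. k < count_list (S @ [z]) v}"
      if k: "k < length Ss'" for k
    proof (cases "k = c")
      case kc: True
      then show ?thesis using Ss[OF True] True by (auto simp: Ss'_def count c_def)
    next
      case kc: False
      then show ?thesis using Ss[of k] k by (auto simp: Ss'_def count c_def)
    qed
    ultimately show ?thesis by blast
  qed
qed

text \<open>Among the vertices outside \<open>G\<close> with at least \<open>k\<close> occurrences,
  one that is minimal along arrows is last: a predecessor is outside \<open>G\<close> since
  \<open>G\<close> is a filter, hence occurs less than \<open>k\<close> times and its arrow has been
  reversed; a successor occurs equally often and its arrow has kept its direction. It is applied to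
  filters \<open>G\<close> in which a layer of the canonical form should be contained.\<close>

lemma last_vertex_outside_filter:
  fixes \<Lambda> :: "'i :: finite rel"
  assumes or: "orientation \<Gamma> \<Lambda>" and adm: "admissible \<Lambda> S" and G: "is_filter \<Lambda> G" and k: "k > 0"
    and v0: "v0 \<notin> G" "k \<le> count_list S v0"
    and const: "\<And>v w. v \<notin> G \<Longrightarrow> k \<le> count_list S v \<Longrightarrow> count_list S v = k \<and>
      ((v, w) \<in> \<Lambda> \<longrightarrow> count_list S w = k)"
  shows "\<exists>v. last_vertex \<Gamma> \<Lambda> S v \<and> v \<notin> G \<and> count_list S v = k"
proof -
  define D where "D = {v. v \<notin> G \<and> k \<le> count_list S v}"
  have "wf \<Lambda>" using or finite_acyclic_wf[of \<Lambda>] by (simp add: orientation_def)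
  then obtain v where v: "v \<in> D" and min: "\<And>w. (w, v) \<in> \<Lambda> \<Longrightarrow> w \<notin> D"
    using v0 wfE_min[of \<Lambda> v0 D] by (auto simp: D_def)
  have cv: "v \<notin> G" "count_list S v = k" using v const by (auto simp: D_def)
  have "(v, w) \<in> reverse_along S \<Lambda>" if e: "edge \<Gamma> v w" for w
  proof (cases "(v, w) \<in> \<Lambda>")
    case True
    then have "count_list S w = count_list S v" using const[of v w] cv by simp
    then show ?thesis using count_along_arrow[OF or adm True] by simp
  next
    case False
    then have wv: "(w, v) \<in> \<Lambda>" using e edge_iff[OF or] by metis
    have "w \<notin> G"
    proof
      assume "w \<in> G"
      then have "v \<in> G" using G wv unfolding is_filter_def by blast
      then show False using cv by simp
    qed
    then have "count_list S w < k" using min[OF wv] by (simp add: D_def)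
    then show ?thesis using count_along_arrow[OF or adm wv] cv by auto
  qed
  moreover have "v \<in> set S" using cv k by (metis count_list_0_iff less_irrefl)
  ultimately show ?thesis using cv unfolding last_vertex_def by blast
qed

text \<open>The target of an arrow occurs at least as often as its source.\<close>

lemma is_filter_levels:
  assumes or: "orientation \<Gamma> \<Lambda>" and adm: "admissible \<Lambda> S"
  shows "is_filter \<Lambda> {v. k < count_list S v}"
  unfolding is_filter_def
proof (intro allI impI)
  fix x y assume "x \<in> {v. k < count_list S v} \<and> (x, y) \<in> \<Lambda>\<^sup>*"
  then have "(x, y) \<in> \<Lambda>\<^sup>*" "k < count_list S x" by auto
  then show "y \<in> {v. k < count_list S v}"
  proof (induction rule: rtrancl_induct)
    case (step y z)
    then show ?case using count_along_arrow[OF or adm step(2)] by auto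
  qed simp
qed

lemma is_filter_principal: "is_filter \<Lambda> (principal_filter \<Lambda> x)"
  unfolding is_filter_def principal_filter_def by auto

text \<open>
  The \<open>k\<close>-th part of the canonical form consists of the vertices occurring at least \<open>k\<close> times in \<open>S\<close>.
  A vertex violating one of the conditions on principal sequences can be chosen minimal among those
  doing so; then none of its neighbours occurs after its last occurrence.
\<close>

lemma principal_seq_if_unique_last_vertex:
  fixes \<Lambda> :: "'i :: finite rel"
  assumes or: "orientation \<Gamma> \<Lambda>" and adm: "admissible \<Lambda> S" and ne: "S \<noteq> []"
    and uniq: "\<And>u v. last_vertex \<Gamma> \<Lambda> S u \<Longrightarrow> last_vertex \<Gamma> \<Lambda> S v \<Longrightarrow> u = v"
  shows "principal_seq \<Gamma> \<Lambda> S"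
proof -
  obtain Ss where eq: "seq_equiv \<Gamma> \<Lambda> S (concat Ss)"
    and le: "\<And>v. count_list S v \<le> length Ss"
    and Ss: "\<And>k. k < length Ss \<Longrightarrow> Ss ! k \<noteq> [] \<and> distinct (Ss ! k)"
    and lev: "\<And>k. k < length Ss \<Longrightarrow> set (Ss ! k) = {v. k < count_list S v}"
    using canonical_listing[OF or adm] by blast
  define r where "r = length Ss"
  have "set S \<noteq> {}" using ne by simp
  then have "concat Ss \<noteq> []"
    using seq_equiv_invariants(2)[OF or eq adm]
    by (metis count_list.simps(1) count_list_0_iff ex_in_conv)
  then have r: "r > 0" by (auto simp: r_def)
  \<comment> \<open>On the highest level \<open>r\<close> the counts cannot grow along arrows, so
    the condition on successors in \<open>last_vertex_outside_filter\<close> holds for every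
    filter.\<close>
  have top: "\<exists>u. last_vertex \<Gamma> \<Lambda> S u \<and> u \<notin> G \<and> count_list S u = r"
    if "is_filter \<Lambda> G" "v \<notin> G" "r \<le> count_list S v" for G v
  proof (rule last_vertex_outside_filter[OF or adm that(1) r that(2,3)])
    fix v w assume "r \<le> count_list S v"
    then show "count_list S v = r \<and> ((v, w) \<in> \<Lambda> \<longrightarrow> count_list S w = r)"
      using le[of v] le[of w] count_along_arrow[OF or adm, of v w] by (auto simp: r_def)
  qed
  have last: "set (last Ss) = {v. r \<le> count_list S v}"
  proof -
    have "last Ss = Ss ! (r - 1)" using r by (simp add: last_conv_nth r_def)
    moreover have "r - 1 < length Ss" using r by (simp add: r_def)
    ultimately have "set (last Ss) = {v. r - 1 < count_list S v}" using lev by metis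
    moreover have "r - 1 < n \<longleftrightarrow> r \<le> n" for n using r by linarith
    ultimately show ?thesis by simp
  qed
  have "set (last Ss) \<noteq> {}" using Ss[of "r - 1"] r by (auto simp: last_conv_nth r_def)
  then obtain v0 where v0: "r \<le> count_list S v0" unfolding last by auto
  \<comment> \<open>The empty filter yields a reference last vertex \<open>x\<close> on the top
    level, with which every last vertex found later must coincide.\<close>
  have "is_filter \<Lambda> {}" by (simp add: is_filter_def)
  from top[OF this _ v0] obtain x where x: "last_vertex \<Gamma> \<Lambda> S x" "count_list S x = r"
    by auto
  have "canonical_form \<Gamma> \<Lambda> S Ss"
    unfolding canonical_form_def
  proof (intro conjI eq allI impI)
    fix i assume i: "i < length Ss"
    show "Ss ! i \<noteq> []" "distinct (Ss ! i)" using Ss[OF i] by auto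
    have "set (Ss ! j) \<subseteq> set (Ss ! i)" if "i \<le> j" "j < length Ss" for j
      using lev[OF i] lev[OF that(2)] that(1) by auto
    then have "set (drop i Ss ! j) \<subseteq> set (Ss ! i)" if "j < length (drop i Ss)" for j
      using that by simp
    then have "set (concat (drop i Ss)) \<subseteq> set (Ss ! i)"
      unfolding set_concat by (metis UN_least in_set_conv_nth)
    moreover have "set (Ss ! i) \<subseteq> set (concat (drop i Ss))"
      using i by (auto simp: Cons_nth_drop_Suc[symmetric])
    ultimately show "set (Ss ! i) = set (concat (drop i Ss))" by blast
  qed
  moreover have "set (Ss ! i) = filter_hull \<Gamma> \<Lambda> (set (Ss ! Suc i))" if i: "Suc i < length Ss" for i
  proof
    let ?F = "set (Ss ! Suc i)"
    have F: "?F = {v. Suc i < count_list S v}" and L: "set (Ss ! i) = {v. i < count_list S v}"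
      using lev i by auto
    \<comment> \<open>Counts at the two ends of an edge differ by at most one, so a neighbour of
      layer \<open>Suc i\<close> belongs to layer \<open>i\<close>.\<close>
    have nb: "count_list S x \<le> Suc (count_list S y)" if "edge \<Gamma> y x" for x y
      using that edge_iff[OF or, of y x] count_along_arrow[OF or adm, of x y]
        count_along_arrow[OF or adm, of y x] by auto
    have "{y. y \<notin> ?F \<and> (\<exists>x\<in>?F. edge \<Gamma> y x)} \<subseteq> set (Ss ! i)"
      using nb by (fastforce simp: F L)
    moreover have "?F \<subseteq> set (Ss ! i)" by (auto simp: F L)
    ultimately show "filter_hull \<Gamma> \<Lambda> ?F \<subseteq> set (Ss ! i)"
      using is_filter_levels[OF or adm, of i] unfolding filter_hull_def L by blast
    show "set (Ss ! i) \<subseteq> filter_hull \<Gamma> \<Lambda> ?F"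
      unfolding filter_hull_def
    proof (intro subsetI InterI)
      fix v0 G
      assume v0: "v0 \<in> set (Ss ! i)"
        and "G \<in> {G. is_filter \<Lambda> G \<and> ?F \<subseteq> G \<and> {y. y \<notin> ?F \<and> (\<exists>x\<in>?F. edge \<Gamma> y x)} \<subseteq> G}"
      then have G: "is_filter \<Lambda> G" "?F \<subseteq> G" and nG: "\<And>y x. x \<in> ?F \<Longrightarrow> edge \<Gamma> y x \<Longrightarrow> y \<in> G"
        by auto
      show "v0 \<in> G"
      proof (rule ccontr)
        assume nv0: "v0 \<notin> G"
        \<comment> \<open>An arrow from \<open>v\<close> into the next layer would make
          \<open>v\<close> a neighbour of that layer, and \<open>G\<close> contains these
          neighbours.\<close>
        have const: "count_list S v = Suc i \<and> ((v, w) \<in> \<Lambda> \<longrightarrow> count_list S w = Suc i)"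
          if "v \<notin> G" "Suc i \<le> count_list S v" for v w
        proof -
          have v: "count_list S v = Suc i" using that G(2) F by fastforce
          moreover have "count_list S w = Suc i" if "(v, w) \<in> \<Lambda>"
          proof -
            have "edge \<Gamma> v w" using edge_iff[OF or] that by blast
            then have "w \<notin> ?F" using nG \<open>v \<notin> G\<close> by blast
            then show ?thesis using count_along_arrow[OF or adm that] v F by auto
          qed
          ultimately show ?thesis by blast
        qed
        have "Suc i \<le> count_list S v0" using v0 L by auto
        \<comment> \<open>The vertex obtained here has count \<open>Suc i\<close>, whereas
          \<open>x\<close> has the larger count \<open>r\<close>; so they are two different last
          vertices.\<close>
        from last_vertex_outside_filter[OF or adm G(1) _ nv0 this const]
        obtain v where "last_vertex \<Gamma> \<Lambda> S v" "count_list S v = Suc i" by auto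
        then show False using uniq[OF x(1)] x(2) i by (auto simp: r_def)
      qed
    qed
  qed
  moreover have "set (last Ss) = principal_filter \<Lambda> x"
  proof
    show "principal_filter \<Lambda> x \<subseteq> set (last Ss)"
    proof -
      have "is_filter \<Lambda> (set (last Ss))"
      proof -
        have "r - 1 < n \<longleftrightarrow> r \<le> n" for n using r by linarith
        then show ?thesis using is_filter_levels[OF or adm, of "r - 1"] by (simp add: last)
      qed
      then show ?thesis
        using x(2) unfolding is_filter_def principal_filter_def last by auto
    qed
    show "set (last Ss) \<subseteq> principal_filter \<Lambda> x"
    proof (rule ccontr)
      assume "\<not> ?thesis"
      then obtain v where "v \<notin> principal_filter \<Lambda> x" "r \<le> count_list S v" using last by auto
      from top[OF is_filter_principal this] obtain u
        where "last_vertex \<Gamma> \<Lambda> S u" "u \<notin> principal_filter \<Lambda> x" by blast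
      then show False using uniq[OF x(1)] by (auto simp: principal_filter_def)
    qed
  qed
  ultimately show ?thesis using adm ne unfolding principal_seq_def by blast
qed


section \<open>Modules\<close>

lemma (in left_module) smult_zero_right: "a \<in> carrier R \<Longrightarrow> a \<odot>\<^bsub>M\<^esub> \<zero>\<^bsub>M\<^esub> = \<zero>\<^bsub>M\<^esub>"
  using smult_r_distr[of a "\<zero>\<^bsub>M\<^esub>" "\<zero>\<^bsub>M\<^esub>"] smult_closed[of a "\<zero>\<^bsub>M\<^esub>"]
  by (metis M.add.l_cancel_one' M.l_zero M.zero_closed)

lemma (in left_module) smult_zero_left: "x \<in> carrier M \<Longrightarrow> \<zero>\<^bsub>R\<^esub> \<odot>\<^bsub>M\<^esub> x = \<zero>\<^bsub>M\<^esub>"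
  using smult_l_distr[of "\<zero>\<^bsub>R\<^esub>" "\<zero>\<^bsub>R\<^esub>" x] smult_closed[of "\<zero>\<^bsub>R\<^esub>" x]
  by (metis M.add.l_cancel_one' R.l_zero R.zero_closed)

lemma (in left_module) smult_minus_one: "x \<in> carrier M \<Longrightarrow> (\<ominus>\<^bsub>R\<^esub> \<one>\<^bsub>R\<^esub>) \<odot>\<^bsub>M\<^esub> x = \<ominus>\<^bsub>M\<^esub> x"
  using smult_l_distr[of "\<ominus>\<^bsub>R\<^esub> \<one>\<^bsub>R\<^esub>" "\<one>\<^bsub>R\<^esub>" x] smult_closed[of "\<ominus>\<^bsub>R\<^esub> \<one>\<^bsub>R\<^esub>" x]
  by (metis M.minus_equality R.a_inv_closed R.l_neg R.one_closed smult_one smult_zero_left)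

text \<open>Negatives come from the scalar -1.\<close>

lemma (in left_module) submoduleI:
  assumes "H \<subseteq> carrier M" "\<zero>\<^bsub>M\<^esub> \<in> H"
    and "\<And>x y. x \<in> H \<Longrightarrow> y \<in> H \<Longrightarrow> x \<oplus>\<^bsub>M\<^esub> y \<in> H"
    and smult: "\<And>a x. a \<in> carrier R \<Longrightarrow> x \<in> H \<Longrightarrow> a \<odot>\<^bsub>M\<^esub> x \<in> H"
  shows "submodule H R M"
proof -
  have "\<ominus>\<^bsub>M\<^esub> x \<in> H" if "x \<in> H" for x
    using smult[of "\<ominus>\<^bsub>R\<^esub> \<one>\<^bsub>R\<^esub>" x] that assms(1) smult_minus_one[of x] by auto
  then show ?thesis
    using assms by (intro submodule.intro subgroup.intro submodule_axioms.intro) (auto simp: a_inv_def)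
qed

lemma (in left_module) submoduleD:
  assumes "submodule H R M"
  shows "H \<subseteq> carrier M" "\<zero>\<^bsub>M\<^esub> \<in> H" "\<And>x y. x \<in> H \<Longrightarrow> y \<in> H \<Longrightarrow> x \<oplus>\<^bsub>M\<^esub> y \<in> H"
    "\<And>a x. a \<in> carrier R \<Longrightarrow> x \<in> H \<Longrightarrow> a \<odot>\<^bsub>M\<^esub> x \<in> H"
    "\<And>x. x \<in> H \<Longrightarrow> \<ominus>\<^bsub>M\<^esub> x \<in> H"
proof -
  interpret H: submodule H R M by fact
  show "H \<subseteq> carrier M" "\<zero>\<^bsub>M\<^esub> \<in> H" "\<And>x y. x \<in> H \<Longrightarrow> y \<in> H \<Longrightarrow> x \<oplus>\<^bsub>M\<^esub> y \<in> H"
    "\<And>a x. a \<in> carrier R \<Longrightarrow> x \<in> H \<Longrightarrow> a \<odot>\<^bsub>M\<^esub> x \<in> H"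
    using H.subset H.one_closed H.m_closed H.smult_closed by auto
  show "\<And>x. x \<in> H \<Longrightarrow> \<ominus>\<^bsub>M\<^esub> x \<in> H"
    using H.m_inv_closed by (simp add: a_inv_def)
qed

lemma (in left_module) submodule_carrier: "submodule (carrier M) R M"
  by (rule submoduleI) (auto simp: smult_closed)

lemma (in left_module) submodule_zero: "submodule {\<zero>\<^bsub>M\<^esub>} R M"
  by (rule submoduleI) (auto simp: smult_zero_right)


section \<open>Tensor products\<close>

definition balanced ::
  "('r, 's) ring_scheme \<Rightarrow> ('l, 'r, 'b, 'z) bimodule_scheme \<Rightarrow> ('r, 'v, 'w) module_scheme \<Rightarrow>
   ('a, 't) ring_scheme \<Rightarrow> ('b \<Rightarrow> 'v \<Rightarrow> 'a) \<Rightarrow> bool"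
  where "balanced R B V A \<beta> \<longleftrightarrow>
    (\<forall>b\<in>carrier B. \<forall>v\<in>carrier V. \<beta> b v \<in> carrier A) \<and>
    (\<forall>b\<in>carrier B. \<forall>b'\<in>carrier B. \<forall>v\<in>carrier V. \<beta> (b \<oplus>\<^bsub>B\<^esub> b') v = \<beta> b v \<oplus>\<^bsub>A\<^esub> \<beta> b' v) \<and>
    (\<forall>b\<in>carrier B. \<forall>v\<in>carrier V. \<forall>v'\<in>carrier V. \<beta> b (v \<oplus>\<^bsub>V\<^esub> v') = \<beta> b v \<oplus>\<^bsub>A\<^esub> \<beta> b v') \<and>
    (\<forall>b\<in>carrier B. \<forall>a\<in>carrier R. \<forall>v\<in>carrier V. \<beta> (b \<odot>\<^sub>r\<^bsub>B\<^esub> a) v = \<beta> b (a \<odot>\<^bsub>V\<^esub> v))"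

locale tensor = B: bimodule L R B + V: left_module R V
  for L :: "('l, 's) ring_scheme" and R :: "('r, 't) ring_scheme"
    and B :: "('l, 'r, 'b, 'z) bimodule_scheme" and V :: "('r, 'v, 'w) module_scheme"
begin

abbreviation "T \<equiv> tensor_product R B V"
abbreviation "F \<equiv> free_Abelian_group (carrier B \<times> carrier V)"
abbreviation "H \<equiv> tensor_subgroup R B V"
abbreviation pt (infixl "\<otimes>\<otimes>" 75) where "b \<otimes>\<otimes> v \<equiv> pure_tensor R B V b v"

definition coset where "coset z = H #>\<^bsub>F\<^esub> z"

lemma relations_in_free: "tensor_relations R B V \<subseteq> carrier F"
proof
  have keys3: "Poly_Mapping.keys (frag_of p - frag_of p' - frag_of p'') \<subseteq> {p, p', p''}"
    and keys2: "Poly_Mapping.keys (frag_of p - frag_of p') \<subseteq> {p, p'}" for p p' p'' :: "'b \<times> 'v"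
    using keys_diff[of "frag_of p - frag_of p'" "frag_of p''"] keys_diff[of "frag_of p" "frag_of p'"]
    by auto
  fix z assume "z \<in> tensor_relations R B V"
  then show "z \<in> carrier F"
    unfolding tensor_relations_def carrier_free_Abelian_group_iff
    by (elim UnE CollectE exE conjE; simp only:; intro order_trans[OF keys3] order_trans[OF keys2])
      (simp_all add: V.smult_closed B.rsmult_closed)
qed

lemma H_subgroup: "subgroup H F"
  unfolding tensor_subgroup_def
  by (rule group.generate_is_subgroup) (use relations_in_free in auto)

lemma H_normal: "H \<lhd> F"
  using comm_group.subgroup_imp_normal[OF abelian_free_Abelian_group H_subgroup] .

lemma H_in_free: "h \<in> H \<Longrightarrow> h \<in> carrier F"
  using subgroup.subset[OF H_subgroup] by blast

lemma H_zero: "0 \<in> H"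
  using subgroup.one_closed[OF H_subgroup] by simp

lemma H_add: "h \<in> H \<Longrightarrow> h' \<in> H \<Longrightarrow> h + h' \<in> H"
  using subgroup.m_closed[OF H_subgroup] by simp

lemma H_minus: "h \<in> H \<Longrightarrow> - h \<in> H"
  using subgroup.m_inv_closed[OF H_subgroup] H_in_free[of h] by fastforce

lemma H_relation: "z \<in> tensor_relations R B V \<Longrightarrow> z \<in> H"
  unfolding tensor_subgroup_def by (rule generate.incl)

lemma H_induct [consumes 1, case_names relation zero add minus]:
  assumes "h \<in> H" and "\<And>r. r \<in> tensor_relations R B V \<Longrightarrow> P r" and "P 0"
    and "\<And>z w. z \<in> carrier F \<Longrightarrow> w \<in> carrier F \<Longrightarrow> P z \<Longrightarrow> P w \<Longrightarrow> P (z + w)"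
    and "\<And>z. z \<in> carrier F \<Longrightarrow> P z \<Longrightarrow> P (- z)"
  shows "P h"
  using assms(1) unfolding tensor_subgroup_def
proof (induction rule: generate.induct)
  case one
  then show ?case using assms(3) by simp
next
  case (incl h)
  then show ?case using assms(2) by simp
next
  case (inv h)
  then have "h \<in> carrier F" using relations_in_free by blast
  then show ?case using assms(2,5)[of h] inv by simp
next
  case (eng h1 h2)
  then show ?case
    using assms(4)[of h1 h2] H_in_free[of h1] H_in_free[of h2] by (simp add: tensor_subgroup_def)
qed

lemma coset_iff: "y \<in> coset z \<longleftrightarrow> (\<exists>h\<in>H. y = h + z)"
  by (auto simp: coset_def r_coset_def)

lemma coset_self: "z \<in> coset z"
  using H_zero by (auto simp: coset_iff intro!: bexI[of _ 0])

lemma coset_eqI: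
  assumes "z - w \<in> H"
  shows "coset z = coset w"
proof -
  have "y - w \<in> H \<longleftrightarrow> y - z \<in> H" for y
  proof
    assume "y - z \<in> H" then have "(y - z) + (z - w) \<in> H" using assms by (rule H_add)
    then show "y - w \<in> H" by simp
  next
    assume "y - w \<in> H" then have "(y - w) + - (z - w) \<in> H" using H_minus[OF assms] by (rule H_add)
    then show "y - z \<in> H" by simp
  qed
  moreover have "y \<in> coset z \<longleftrightarrow> y - z \<in> H" for y z
    unfolding coset_iff by (metis add_diff_cancel_right' diff_add_cancel)
  ultimately show ?thesis by blast
qed

lemma free_add: "z \<in> carrier F \<Longrightarrow> w \<in> carrier F \<Longrightarrow> z + w \<in> carrier F"
  using group.is_monoid[OF group_free_Abelian_group, THEN monoid.m_closed, of z "carrier B \<times> carrier V" w]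
  by simp

lemma free_zero: "0 \<in> carrier F"
  by simp

lemma free_minus: "z \<in> carrier F \<Longrightarrow> - z \<in> carrier F"
  by simp

lemma carrier_T: "carrier T = coset ` carrier F"
  by (simp add: tensor_product_def Let_def carrier_FactGroup coset_def image_def)

lemma zero_T: "\<zero>\<^bsub>T\<^esub> = coset 0"
proof -
  have "coset 0 = H" by (auto simp: coset_iff)
  then show ?thesis by (simp add: tensor_product_def Let_def)
qed

lemma add_T:
  "z \<in> carrier F \<Longrightarrow> w \<in> carrier F \<Longrightarrow> coset z \<oplus>\<^bsub>T\<^esub> coset w = coset (z + w)"
  using normal.rcos_sum[OF H_normal, of z w] by (simp add: tensor_product_def Let_def coset_def)

lemma abelian_group_T: "abelian_group T"
proof (rule abelian_groupI)
  show "\<exists>y\<in>carrier T. y \<oplus>\<^bsub>T\<^esub> x = \<zero>\<^bsub>T\<^esub>" if x: "x \<in> carrier T" for x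
  proof -
    obtain z where z: "x = coset z" "z \<in> carrier F"
      using x by (auto simp: carrier_T simp del: carrier_free_Abelian_group_iff)
    then have "coset (- z) \<oplus>\<^bsub>T\<^esub> x = \<zero>\<^bsub>T\<^esub>" using add_T[OF free_minus[OF z(2)] z(2)] by (simp add: zero_T)
    then show ?thesis using free_minus[OF z(2)] unfolding carrier_T by blast
  qed
qed (auto simp: carrier_T zero_T add_T free_add free_zero ac_simps
    simp del: carrier_free_Abelian_group_iff)

sublocale T: abelian_group T by (rule abelian_group_T)

section \<open>Pure tensors and induction over their sums\<close>

lemma pure_def: "b \<otimes>\<otimes> v = coset (frag_of (b, v))"
  by (simp add: pure_tensor_def coset_def)

lemma pure_closed [simp, intro]:
  "b \<in> carrier B \<Longrightarrow> v \<in> carrier V \<Longrightarrow> b \<otimes>\<otimes> v \<in> carrier T"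
  unfolding pure_def carrier_T by (rule imageI) simp

lemma pure_add_left:
  assumes "b \<in> carrier B" "b' \<in> carrier B" "v \<in> carrier V"
  shows "(b \<oplus>\<^bsub>B\<^esub> b') \<otimes>\<otimes> v = b \<otimes>\<otimes> v \<oplus>\<^bsub>T\<^esub> b' \<otimes>\<otimes> v"
proof -
  have "frag_of (b \<oplus>\<^bsub>B\<^esub> b', v) - frag_of (b, v) - frag_of (b', v) \<in> H"
    by (rule H_relation) (use assms in \<open>unfold tensor_relations_def, blast\<close>)
  then show ?thesis using assms
    by (simp add: pure_def add_T coset_eqI diff_diff_eq)
qed

lemma pure_add_right:
  assumes "b \<in> carrier B" "v \<in> carrier V" "v' \<in> carrier V"
  shows "b \<otimes>\<otimes> (v \<oplus>\<^bsub>V\<^esub> v') = b \<otimes>\<otimes> v \<oplus>\<^bsub>T\<^esub> b \<otimes>\<otimes> v'"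
proof -
  have "frag_of (b, v \<oplus>\<^bsub>V\<^esub> v') - frag_of (b, v) - frag_of (b, v') \<in> H"
    by (rule H_relation) (use assms in \<open>unfold tensor_relations_def, blast\<close>)
  then show ?thesis using assms
    by (simp add: pure_def add_T coset_eqI diff_diff_eq)
qed

lemma pure_balanced:
  assumes "b \<in> carrier B" "a \<in> carrier R" "v \<in> carrier V"
  shows "(b \<odot>\<^sub>r\<^bsub>B\<^esub> a) \<otimes>\<otimes> v = b \<otimes>\<otimes> (a \<odot>\<^bsub>V\<^esub> v)"
proof -
  have "frag_of (b \<odot>\<^sub>r\<^bsub>B\<^esub> a, v) - frag_of (b, a \<odot>\<^bsub>V\<^esub> v) \<in> H"
    by (rule H_relation) (use assms in \<open>unfold tensor_relations_def, blast\<close>)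
  then show ?thesis by (simp add: pure_def coset_eqI)
qed

lemma pure_zero_left:
  assumes v: "v \<in> carrier V"
  shows "\<zero>\<^bsub>B\<^esub> \<otimes>\<otimes> v = \<zero>\<^bsub>T\<^esub>"
  using pure_add_left[of "\<zero>\<^bsub>B\<^esub>" "\<zero>\<^bsub>B\<^esub>" v] pure_closed[of "\<zero>\<^bsub>B\<^esub>" v] v
  by (metis B.M.l_zero B.M.zero_closed T.add.l_cancel_one')

lemma pure_zero_right:
  assumes b: "b \<in> carrier B"
  shows "b \<otimes>\<otimes> \<zero>\<^bsub>V\<^esub> = \<zero>\<^bsub>T\<^esub>"
  using pure_add_right[of b "\<zero>\<^bsub>V\<^esub>" "\<zero>\<^bsub>V\<^esub>"] pure_closed[of b "\<zero>\<^bsub>V\<^esub>"] b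
  by (metis V.M.l_zero V.M.zero_closed T.add.l_cancel_one')

lemma coset_minus_pure:
  assumes "b \<in> carrier B" "v \<in> carrier V"
  shows "coset (- frag_of (b, v)) = (\<ominus>\<^bsub>B\<^esub> b) \<otimes>\<otimes> v"
proof -
  have "(\<ominus>\<^bsub>B\<^esub> b) \<otimes>\<otimes> v \<oplus>\<^bsub>T\<^esub> b \<otimes>\<otimes> v = \<zero>\<^bsub>T\<^esub>"
    using pure_add_left[of "\<ominus>\<^bsub>B\<^esub> b" b v] assms by (simp add: B.M.l_neg pure_zero_left)
  moreover have "coset (- frag_of (b, v)) \<oplus>\<^bsub>T\<^esub> b \<otimes>\<otimes> v = \<zero>\<^bsub>T\<^esub>"
    using assms by (simp add: pure_def add_T zero_T)
  moreover have "coset (- frag_of (b, v)) \<in> carrier T"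
    unfolding carrier_T by (rule imageI) (use assms in simp)
  ultimately show ?thesis using assms by (metis B.M.a_inv_closed T.minus_equality pure_closed)
qed

text \<open>There is no case for negatives because the negative of
  \<open>b \<otimes>\<otimes> v\<close> is the pure tensor of the negative of \<open>b\<close> with
  \<open>v\<close>. Induction in the free group proceeds by differences, which is why the property
  is proved for \<open>z\<close> and \<open>- z\<close> together.\<close>

lemma T_induct [consumes 1, case_names zero pure add]:
  assumes "t \<in> carrier T" and "P \<zero>\<^bsub>T\<^esub>"
    and "\<And>b v. b \<in> carrier B \<Longrightarrow> v \<in> carrier V \<Longrightarrow> P (b \<otimes>\<otimes> v)"
    and "\<And>s t. s \<in> carrier T \<Longrightarrow> t \<in> carrier T \<Longrightarrow> P s \<Longrightarrow> P t \<Longrightarrow> P (s \<oplus>\<^bsub>T\<^esub> t)"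
  shows "P t"
proof -
  obtain z where z: "t = coset z" "Poly_Mapping.keys z \<subseteq> carrier B \<times> carrier V"
    using assms(1) by (auto simp: carrier_T)
  have "P (coset z) \<and> P (coset (- z))"
  proof (rule free_Abelian_group_induct[OF z(2)])
    show "P (coset 0) \<and> P (coset (- 0))" using assms(2) by (simp add: zero_T)
  next
    fix x y :: "'b \<times> 'v \<Rightarrow>\<^sub>0 int"
    assume xy: "Poly_Mapping.keys x \<subseteq> carrier B \<times> carrier V" "Poly_Mapping.keys y \<subseteq> carrier B \<times> carrier V"
      "P (coset x) \<and> P (coset (- x))" "P (coset y) \<and> P (coset (- y))"
    have F: "x \<in> carrier F" "y \<in> carrier F" "- x \<in> carrier F" "- y \<in> carrier F" using xy by auto
    have "coset (x - y) = coset x \<oplus>\<^bsub>T\<^esub> coset (- y)" "coset (- (x - y)) = coset (- x) \<oplus>\<^bsub>T\<^esub> coset y"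
      using F by (simp_all add: add_T)
    then show "P (coset (x - y)) \<and> P (coset (- (x - y)))"
      using xy F assms(4) by (auto simp: carrier_T simp del: carrier_free_Abelian_group_iff)
  next
    fix p assume "p \<in> carrier B \<times> carrier V"
    then obtain b v where p: "p = (b, v)" "b \<in> carrier B" "v \<in> carrier V" by auto
    then show "P (coset (frag_of p)) \<and> P (coset (- frag_of p))"
      using assms(3)[of b v] assms(3)[of "\<ominus>\<^bsub>B\<^esub> b" v]
      by (simp add: coset_minus_pure pure_def[symmetric])
  qed
  then show ?thesis using z by simp
qed

definition act where "act c = frag_extend (\<lambda>(b, v). frag_of (c \<odot>\<^bsub>B\<^esub> b, v))"

lemma act_in_free:
  assumes "c \<in> carrier L" "z \<in> carrier F"
  shows "act c z \<in> carrier F"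
proof -
  have "Poly_Mapping.keys (act c z) \<subseteq> (\<Union>x\<in>Poly_Mapping.keys z. Poly_Mapping.keys ((\<lambda>(b, v). frag_of (c \<odot>\<^bsub>B\<^esub> b, v)) x))"
    unfolding act_def by (rule keys_frag_extend)
  also have "\<dots> \<subseteq> carrier B \<times> carrier V"
    using assms by (fastforce simp: B.smult_closed)
  finally show ?thesis by simp
qed

text \<open>Each of the three kinds of relations is mapped to one of the same kind; for the third
  this is the commutation of the left and right actions on \<open>B\<close>. So the left action
  passes to the quotient.\<close>

lemma act_relation:
  assumes c: "c \<in> carrier L" and r: "r \<in> tensor_relations R B V"
  shows "act c r \<in> tensor_relations R B V"
  using r[unfolded tensor_relations_def]
proof (elim UnE CollectE exE conjE)
  fix b b' v assume r: "r = frag_of (b \<oplus>\<^bsub>B\<^esub> b', v) - frag_of (b, v) - frag_of (b', v)"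
    and bv: "b \<in> carrier B" "b' \<in> carrier B" "v \<in> carrier V"
  then have "act c r = frag_of (c \<odot>\<^bsub>B\<^esub> b \<oplus>\<^bsub>B\<^esub> c \<odot>\<^bsub>B\<^esub> b', v) - frag_of (c \<odot>\<^bsub>B\<^esub> b, v) - frag_of (c \<odot>\<^bsub>B\<^esub> b', v)"
    using c by (simp add: act_def frag_extend_diff B.smult_r_distr)
  then show ?thesis using bv c B.smult_closed unfolding tensor_relations_def by blast
next
  fix b v v' assume r: "r = frag_of (b, v \<oplus>\<^bsub>V\<^esub> v') - frag_of (b, v) - frag_of (b, v')"
    and bv: "b \<in> carrier B" "v \<in> carrier V" "v' \<in> carrier V"
  then have "act c r = frag_of (c \<odot>\<^bsub>B\<^esub> b, v \<oplus>\<^bsub>V\<^esub> v') - frag_of (c \<odot>\<^bsub>B\<^esub> b, v) - frag_of (c \<odot>\<^bsub>B\<^esub> b, v')"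
    using c by (simp add: act_def frag_extend_diff)
  then show ?thesis using bv c B.smult_closed unfolding tensor_relations_def by blast
next
  fix b a v assume r: "r = frag_of (b \<odot>\<^sub>r\<^bsub>B\<^esub> a, v) - frag_of (b, a \<odot>\<^bsub>V\<^esub> v)"
    and bv: "b \<in> carrier B" "a \<in> carrier R" "v \<in> carrier V"
  then have "act c r = frag_of ((c \<odot>\<^bsub>B\<^esub> b) \<odot>\<^sub>r\<^bsub>B\<^esub> a, v) - frag_of (c \<odot>\<^bsub>B\<^esub> b, a \<odot>\<^bsub>V\<^esub> v)"
    using c by (simp add: act_def frag_extend_diff B.smult_rsmult)
  then show ?thesis using bv c B.smult_closed unfolding tensor_relations_def by blast
qed

lemma act_H:
  assumes c: "c \<in> carrier L" and h: "h \<in> H"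
  shows "act c h \<in> H"
  using h
proof (induction rule: H_induct)
  case (relation r)
  then show ?case using act_relation[OF c] H_relation by blast
qed (auto simp: act_def frag_extend_add frag_extend_minus H_zero H_add H_minus)

text \<open>\<open>tensor_product\<close> applies \<open>c\<close> to all elements of a coset and
  then adds \<open>H\<close> again. Since \<open>act c\<close> preserves \<open>H\<close>, the
  result is a single coset and any representative \<open>z\<close> determines it.\<close>

lemma smult_T:
  assumes "c \<in> carrier L" "z \<in> carrier F"
  shows "c \<odot>\<^bsub>T\<^esub> coset z = coset (act c z)"
proof -
  have "c \<odot>\<^bsub>T\<^esub> coset z = {h + act c y | h y. h \<in> H \<and> y \<in> coset z}"
    by (auto simp: tensor_product_def Let_def set_mult_def act_def)
  also have "\<dots> = coset (act c z)"
  proof (rule Set.set_eqI, rule iffI)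
    fix y assume "y \<in> {h + act c y | h y. h \<in> H \<and> y \<in> coset z}"
    then obtain h h' where "h \<in> H" "h' \<in> H" "y = h + act c (h' + z)" by (auto simp: coset_iff)
    then have "y = (h + act c h') + act c z" "h + act c h' \<in> H"
      using act_H[OF assms(1)] H_add by (auto simp: act_def frag_extend_add add.assoc)
    then show "y \<in> coset (act c z)" unfolding coset_iff by blast
  next
    fix y assume "y \<in> coset (act c z)"
    then show "y \<in> {h + act c y | h y. h \<in> H \<and> y \<in> coset z}"
      using coset_self[of z] unfolding coset_iff[of y] by blast
  qed
  finally show ?thesis .
qed

lemma smult_pure:
  assumes "c \<in> carrier L" "b \<in> carrier B" "v \<in> carrier V"
  shows "c \<odot>\<^bsub>T\<^esub> (b \<otimes>\<otimes> v) = (c \<odot>\<^bsub>B\<^esub> b) \<otimes>\<otimes> v"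
proof -
  have "act c (frag_of (b, v)) = frag_of (c \<odot>\<^bsub>B\<^esub> b, v)" by (simp add: act_def)
  then show ?thesis using smult_T[OF assms(1), of "frag_of (b, v)"] assms by (simp add: pure_def)
qed

text \<open>Additivity in the tensor is settled on representatives, where \<open>act c\<close> is
  additive. With it the remaining laws are inherited from \<open>B\<close> by induction over pure
  tensors.\<close>

lemma left_module_T: "left_module L T"
proof -
  have closed: "c \<odot>\<^bsub>T\<^esub> t \<in> carrier T" if "c \<in> carrier L" "t \<in> carrier T" for c t
    using that act_in_free by (auto simp: carrier_T smult_T simp del: carrier_free_Abelian_group_iff)
  have distr: "c \<odot>\<^bsub>T\<^esub> (s \<oplus>\<^bsub>T\<^esub> t) = c \<odot>\<^bsub>T\<^esub> s \<oplus>\<^bsub>T\<^esub> c \<odot>\<^bsub>T\<^esub> t"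
    if c: "c \<in> carrier L" and st: "s \<in> carrier T" "t \<in> carrier T" for c s t
  proof -
    obtain z w where zw: "s = coset z" "t = coset w" "z \<in> carrier F" "w \<in> carrier F"
      using st by (auto simp: carrier_T simp del: carrier_free_Abelian_group_iff)
    have "act c (z + w) = act c z + act c w" by (simp add: act_def frag_extend_add)
    then show ?thesis
      using zw c act_in_free[OF c zw(3)] act_in_free[OF c zw(4)] free_add[OF zw(3,4)]
      by (simp only: zw add_T smult_T)
  qed
  have zero: "c \<odot>\<^bsub>T\<^esub> \<zero>\<^bsub>T\<^esub> = \<zero>\<^bsub>T\<^esub>" if "c \<in> carrier L" for c
    using distr[OF that, of "\<zero>\<^bsub>T\<^esub>" "\<zero>\<^bsub>T\<^esub>"] closed[OF that, of "\<zero>\<^bsub>T\<^esub>"]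
    by (metis T.add.l_cancel_one' T.l_zero T.zero_closed)
  have "(a \<oplus>\<^bsub>L\<^esub> c) \<odot>\<^bsub>T\<^esub> t = a \<odot>\<^bsub>T\<^esub> t \<oplus>\<^bsub>T\<^esub> c \<odot>\<^bsub>T\<^esub> t"
    if "a \<in> carrier L" "c \<in> carrier L" "t \<in> carrier T" for a c t
    using that(3)
  proof (induction rule: T_induct)
    case (pure b v)
    then show ?case
      using that(1,2) by (simp add: smult_pure B.smult_l_distr pure_add_left B.smult_closed)
  next
    case (add s t)
    then show ?case using that(1,2) by (simp add: distr closed T.a_ac)
  qed (use that in \<open>simp add: zero\<close>)
  moreover have "(a \<otimes>\<^bsub>L\<^esub> c) \<odot>\<^bsub>T\<^esub> t = a \<odot>\<^bsub>T\<^esub> (c \<odot>\<^bsub>T\<^esub> t)"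
    if "a \<in> carrier L" "c \<in> carrier L" "t \<in> carrier T" for a c t
    using that(3)
  proof (induction rule: T_induct)
    case (pure b v)
    then show ?case
      using that(1,2) by (simp add: smult_pure B.smult_assoc B.smult_closed)
  next
    case (add s t)
    then show ?case using that(1,2) by (simp add: distr closed)
  qed (use that in \<open>simp add: zero\<close>)
  moreover have "\<one>\<^bsub>L\<^esub> \<odot>\<^bsub>T\<^esub> t = t" if "t \<in> carrier T" for t
    using that by (induction rule: T_induct) (simp_all add: zero smult_pure B.smult_one distr)
  ultimately show ?thesis
    using closed distr
    by (intro left_module.intro left_module_axioms.intro B.R.ring_axioms abelian_group_T) auto
qed

sublocale T: left_module L T by (rule left_module_T)

lemma coset_eqD:
  assumes "t \<in> carrier T" "s \<in> carrier T" "z \<in> t" "z \<in> s"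
  shows "t = s"
proof -
  have "t = coset z" if t: "t \<in> carrier T" "z \<in> t" for t
  proof -
    obtain w where w: "t = coset w" using t(1) by (auto simp: carrier_T)
    then obtain h where "h \<in> H" "z = h + w" using t(2) coset_iff by blast
    then show ?thesis using w coset_eqI[of z w] by simp
  qed
  then show ?thesis using assms by metis
qed

lemma T_nonempty: "t \<in> carrier T \<Longrightarrow> \<exists>z. z \<in> t"
  using coset_self by (auto simp: carrier_T)

text \<open>\<open>tensor_lift\<close> evaluates a representative picked by choice. The result does
  not depend on the choice: the evaluation \<open>ev\<close> is additive on the free group and kills
  every relation because \<open>\<beta>\<close> is balanced and biadditive, hence it vanishes on
  \<open>H\<close>.\<close>

lemma
  assumes A: "abelian_group A" and \<beta>: "balanced R B V A \<beta>"
  shows lift_pure: "b \<in> carrier B \<Longrightarrow> v \<in> carrier V \<Longrightarrow> tensor_lift A \<beta> (b \<otimes>\<otimes> v) = \<beta> b v"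
    and lift_closed: "t \<in> carrier T \<Longrightarrow> tensor_lift A \<beta> t \<in> carrier A"
    and lift_add: "s \<in> carrier T \<Longrightarrow> t \<in> carrier T \<Longrightarrow>
      tensor_lift A \<beta> (s \<oplus>\<^bsub>T\<^esub> t) = tensor_lift A \<beta> s \<oplus>\<^bsub>A\<^esub> tensor_lift A \<beta> t"
proof -
  interpret A: abelian_group A by fact
  define ev where "ev z = (\<Oplus>\<^bsub>A\<^esub>p\<in>Poly_Mapping.keys z.
    [Poly_Mapping.lookup z p] \<cdot>\<^bsub>A\<^esub> \<beta> (fst p) (snd p))" for z :: "'b \<times> 'v \<Rightarrow>\<^sub>0 int"
  have \<beta>_closed: "\<beta> b v \<in> carrier A" if "b \<in> carrier B" "v \<in> carrier V" for b v
    using \<beta> that by (simp add: balanced_def)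
  \<comment> \<open>Terms may cancel in \<open>z + w\<close>, so sums over supports are first
    extended by zero to a common finite set.\<close>
  have ev_superset: "ev z = (\<Oplus>\<^bsub>A\<^esub>p\<in>K. [Poly_Mapping.lookup z p] \<cdot>\<^bsub>A\<^esub> \<beta> (fst p) (snd p))"
    if "finite K" "Poly_Mapping.keys z \<subseteq> K" "K \<subseteq> carrier B \<times> carrier V" for z K
    unfolding ev_def
  proof (rule A.add.finprod_mono_neutral_cong_left[OF that(1,2)])
    have cl: "\<beta> (fst p) (snd p) \<in> carrier A" if "p \<in> K" for p
      using that \<open>K \<subseteq> _\<close> \<beta>_closed by auto
    then show "(\<lambda>p. [Poly_Mapping.lookup z p] \<cdot>\<^bsub>A\<^esub> \<beta> (fst p) (snd p)) \<in> K \<rightarrow> carrier A"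
      by (intro Pi_I A.add.int_pow_closed) auto
    show "[Poly_Mapping.lookup z p] \<cdot>\<^bsub>A\<^esub> \<beta> (fst p) (snd p) = \<zero>\<^bsub>A\<^esub>"
      if "p \<in> K - Poly_Mapping.keys z" for p
      using that by (simp add: in_keys_iff add_pow_def)
  qed simp
  have ev_closed: "ev z \<in> carrier A" if "z \<in> carrier F" for z
    unfolding ev_def by (rule A.finsum_closed) (use that \<beta>_closed in \<open>auto intro!: A.add.int_pow_closed\<close>)
  have ev_add: "ev (z + w) = ev z \<oplus>\<^bsub>A\<^esub> ev w" if zw: "z \<in> carrier F" "w \<in> carrier F" for z w
  proof -
    let ?K = "Poly_Mapping.keys z \<union> Poly_Mapping.keys w"
    have K: "finite ?K" "?K \<subseteq> carrier B \<times> carrier V" using zw by auto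
    have cl: "\<beta> (fst p) (snd p) \<in> carrier A" if "p \<in> ?K" for p
      using that K \<beta>_closed by auto
    have "ev (z + w) = (\<Oplus>\<^bsub>A\<^esub>p\<in>?K. [Poly_Mapping.lookup (z + w) p] \<cdot>\<^bsub>A\<^esub> \<beta> (fst p) (snd p))"
      using ev_superset[OF K(1) _ K(2), of "z + w"] keys_add[of z w] by blast
    also have "\<dots> = (\<Oplus>\<^bsub>A\<^esub>p\<in>?K. [Poly_Mapping.lookup z p] \<cdot>\<^bsub>A\<^esub> \<beta> (fst p) (snd p) \<oplus>\<^bsub>A\<^esub>
        [Poly_Mapping.lookup w p] \<cdot>\<^bsub>A\<^esub> \<beta> (fst p) (snd p))"
      by (rule A.finsum_cong') (use cl in \<open>auto simp: lookup_add A.add.int_pow_mult\<close>)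
    also have "\<dots> = (\<Oplus>\<^bsub>A\<^esub>p\<in>?K. [Poly_Mapping.lookup z p] \<cdot>\<^bsub>A\<^esub> \<beta> (fst p) (snd p)) \<oplus>\<^bsub>A\<^esub>
      (\<Oplus>\<^bsub>A\<^esub>p\<in>?K. [Poly_Mapping.lookup w p] \<cdot>\<^bsub>A\<^esub> \<beta> (fst p) (snd p))"
      by (rule A.finsum_addf) (use cl in auto)
    also have "\<dots> = ev z \<oplus>\<^bsub>A\<^esub> ev w"
      using ev_superset[OF K(1) _ K(2), of z] ev_superset[OF K(1) _ K(2), of w] by simp
    finally show ?thesis .
  qed
  have ev_0: "ev 0 = \<zero>\<^bsub>A\<^esub>" by (simp add: ev_def)
  have ev_minus: "ev (- z) = \<ominus>\<^bsub>A\<^esub> ev z" if z: "z \<in> carrier F" for z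
  proof -
    have "ev (- z) \<oplus>\<^bsub>A\<^esub> ev z = \<zero>\<^bsub>A\<^esub>"
      using ev_add[OF free_minus[OF z] z] ev_0 by simp
    then show ?thesis using ev_closed z free_minus[OF z] by (metis A.minus_equality)
  qed
  have ev_of: "ev (frag_of (b, v)) = \<beta> b v" if "b \<in> carrier B" "v \<in> carrier V" for b v
    using \<beta>_closed[OF that] by (simp add: ev_def)
  have ev_H: "ev h = \<zero>\<^bsub>A\<^esub>" if "h \<in> H" for h
    using that
  proof (induction rule: H_induct)
    case (relation r)
    have ev_diff: "ev (z - w) = ev z \<ominus>\<^bsub>A\<^esub> ev w" if "z \<in> carrier F" "w \<in> carrier F" for z w
      using ev_add[OF that(1) free_minus[OF that(2)]] ev_minus[OF that(2)] by (simp add: a_minus_def)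
    have fd: "z - w \<in> carrier F" if "z \<in> carrier F" "w \<in> carrier F" for z w
      using free_add[OF that(1) free_minus[OF that(2)]] by simp
    have fo: "frag_of (b, v) \<in> carrier F" if "b \<in> carrier B" "v \<in> carrier V" for b v
      using that by simp
    from relation[unfolded tensor_relations_def] show ?case
    proof (elim UnE CollectE exE conjE, goal_cases)
      case (1 b b' v)
      then have "\<beta> (b \<oplus>\<^bsub>B\<^esub> b') v = \<beta> b v \<oplus>\<^bsub>A\<^esub> \<beta> b' v" using \<beta> by (simp add: balanced_def)
      with 1 show ?case
        by (simp add: ev_diff ev_of fd fo \<beta>_closed del: carrier_free_Abelian_group_iff)
          (simp add: a_minus_def A.a_ac \<beta>_closed A.r_neg A.r_neg1 A.r_neg2)
    next
      case (2 b v v')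
      then have "\<beta> b (v \<oplus>\<^bsub>V\<^esub> v') = \<beta> b v \<oplus>\<^bsub>A\<^esub> \<beta> b v'" using \<beta> by (simp add: balanced_def)
      with 2 show ?case
        by (simp add: ev_diff ev_of fd fo \<beta>_closed del: carrier_free_Abelian_group_iff)
          (simp add: a_minus_def A.a_ac \<beta>_closed A.r_neg A.r_neg1 A.r_neg2)
    next
      case (3 b a v)
      then have "\<beta> (b \<odot>\<^sub>r\<^bsub>B\<^esub> a) v = \<beta> b (a \<odot>\<^bsub>V\<^esub> v)" using \<beta> by (simp add: balanced_def)
      with 3 show ?case
        by (simp add: ev_diff ev_of fo \<beta>_closed B.rsmult_closed V.smult_closed a_minus_def A.r_neg
            del: carrier_free_Abelian_group_iff)
    qed
  qed (simp_all add: ev_0 ev_add ev_minus del: carrier_free_Abelian_group_iff)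
  have lift: "tensor_lift A \<beta> (coset z) = ev z" if z: "z \<in> carrier F" for z
  proof -
    have "(SOME y. y \<in> coset z) \<in> coset z" using coset_self by (rule someI)
    then obtain h where h: "h \<in> H" "(SOME y. y \<in> coset z) = h + z" by (auto simp: coset_iff)
    have "tensor_lift A \<beta> (coset z) = ev (h + z)"
      unfolding tensor_lift_def Let_def h(2)[symmetric] ev_def ..
    then show ?thesis using ev_add[OF H_in_free[OF h(1)] z] ev_H[OF h(1)] ev_closed[OF z] by simp
  qed
  show "tensor_lift A \<beta> (b \<otimes>\<otimes> v) = \<beta> b v" if "b \<in> carrier B" "v \<in> carrier V"
    using that lift[of "frag_of (b, v)"] ev_of by (simp add: pure_def)
  show "tensor_lift A \<beta> t \<in> carrier A" if "t \<in> carrier T"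
    using that lift ev_closed by (auto simp: carrier_T simp del: carrier_free_Abelian_group_iff)
  show "tensor_lift A \<beta> (s \<oplus>\<^bsub>T\<^esub> t) = tensor_lift A \<beta> s \<oplus>\<^bsub>A\<^esub> tensor_lift A \<beta> t"
    if st: "s \<in> carrier T" "t \<in> carrier T"
  proof -
    obtain z w where "s = coset z" "t = coset w" "z \<in> carrier F" "w \<in> carrier F"
      using st by (auto simp: carrier_T simp del: carrier_free_Abelian_group_iff)
    then show ?thesis using lift ev_add free_add by (simp only: add_T)
  qed
qed

end


section \<open>Additive maps and finite sums\<close>

lemma additive_zero:
  assumes "abelian_group A" "abelian_group A'"
    and "f \<in> carrier A \<rightarrow> carrier A'"
    and "\<And>x y. x \<in> carrier A \<Longrightarrow> y \<in> carrier A \<Longrightarrow> f (x \<oplus>\<^bsub>A\<^esub> y) = f x \<oplus>\<^bsub>A'\<^esub> f y"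
  shows "f \<zero>\<^bsub>A\<^esub> = \<zero>\<^bsub>A'\<^esub>"
proof -
  interpret A: abelian_group A by fact
  interpret A': abelian_group A' by fact
  have "f \<zero>\<^bsub>A\<^esub> \<in> carrier A'" using assms(3) by auto
  moreover have "f \<zero>\<^bsub>A\<^esub> = f \<zero>\<^bsub>A\<^esub> \<oplus>\<^bsub>A'\<^esub> f \<zero>\<^bsub>A\<^esub>" using assms(4)[of "\<zero>\<^bsub>A\<^esub>" "\<zero>\<^bsub>A\<^esub>"] by simp
  ultimately show ?thesis by (metis A'.add.l_cancel_one')
qed

lemma additive_minus:
  assumes "abelian_group A" "abelian_group A'"
    and "f \<in> carrier A \<rightarrow> carrier A'"
    and "\<And>x y. x \<in> carrier A \<Longrightarrow> y \<in> carrier A \<Longrightarrow> f (x \<oplus>\<^bsub>A\<^esub> y) = f x \<oplus>\<^bsub>A'\<^esub> f y"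
    and x: "x \<in> carrier A"
  shows "f (\<ominus>\<^bsub>A\<^esub> x) = \<ominus>\<^bsub>A'\<^esub> f x"
proof -
  interpret A: abelian_group A by fact
  interpret A': abelian_group A' by fact
  have "f (\<ominus>\<^bsub>A\<^esub> x) \<oplus>\<^bsub>A'\<^esub> f x = \<zero>\<^bsub>A'\<^esub>"
    using additive_zero[OF assms(1-4)] assms(4)[of "\<ominus>\<^bsub>A\<^esub> x" x] x by (simp add: A.l_neg)
  moreover have "f x \<in> carrier A'" "f (\<ominus>\<^bsub>A\<^esub> x) \<in> carrier A'" using x assms(3) by auto
  ultimately show ?thesis by (metis A'.minus_equality)
qed

lemma additive_finsum:
  assumes "abelian_group A" "abelian_group A'"
    and "f \<in> carrier A \<rightarrow> carrier A'"
    and "\<And>x y. x \<in> carrier A \<Longrightarrow> y \<in> carrier A \<Longrightarrow> f (x \<oplus>\<^bsub>A\<^esub> y) = f x \<oplus>\<^bsub>A'\<^esub> f y"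
    and "finite I" "g \<in> I \<rightarrow> carrier A"
  shows "f (\<Oplus>\<^bsub>A\<^esub>i\<in>I. g i) = (\<Oplus>\<^bsub>A'\<^esub>i\<in>I. f (g i))"
proof -
  interpret A: abelian_group A by fact
  interpret A': abelian_group A' by fact
  show ?thesis
    using assms(5,6)
  proof (induction I rule: finite_induct)
    case empty
    then show ?case using additive_zero[OF assms(1-4)] by simp
  next
    case (insert i I)
    then have g: "g i \<in> carrier A" "g \<in> I \<rightarrow> carrier A" by auto
    then have "f (g i) \<in> carrier A'" "(\<lambda>i. f (g i)) \<in> I \<rightarrow> carrier A'" using assms(3) by auto
    then show ?case using insert g A.finsum_closed[OF g(2)] by (simp add: assms(4))
  qed
qed

lemma (in left_module) finsum_in_submodule:
  assumes "submodule H R M" "finite I" "\<And>i. i \<in> I \<Longrightarrow> g i \<in> H"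
  shows "(\<Oplus>\<^bsub>M\<^esub>i\<in>I. g i) \<in> H"
  using assms(2,3)
proof (induction I rule: finite_induct)
  case empty
  then show ?case using submoduleD[OF assms(1)] by simp
next
  case (insert i I)
  then have "g i \<in> carrier M" "g \<in> I \<rightarrow> carrier M" using submoduleD(1)[OF assms(1)] by auto
  then show ?case using insert submoduleD(3)[OF assms(1)] by simp
qed

lemma (in left_module) smult_finsum:
  assumes "a \<in> carrier R" "finite I" "g \<in> I \<rightarrow> carrier M"
  shows "a \<odot>\<^bsub>M\<^esub> (\<Oplus>\<^bsub>M\<^esub>i\<in>I. g i) = (\<Oplus>\<^bsub>M\<^esub>i\<in>I. a \<odot>\<^bsub>M\<^esub> g i)"
  using additive_finsum[OF M.abelian_group_axioms M.abelian_group_axioms, of "\<lambda>x. a \<odot>\<^bsub>M\<^esub> x" I g]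
    assms by (auto simp: smult_closed smult_r_distr)

section \<open>Internal direct sums and complements\<close>

definition internal_direct_sum ::
  "('r, 's) ring_scheme \<Rightarrow> ('r, 'm, 'z) module_scheme \<Rightarrow> 'm set \<Rightarrow> 'm set \<Rightarrow> bool"
  where "internal_direct_sum R M U U' \<longleftrightarrow> submodule U R M \<and> submodule U' R M \<and>
    U <+>\<^bsub>M\<^esub> U' = carrier M \<and> U \<inter> U' = {\<zero>\<^bsub>M\<^esub>}"

lemma set_add_iff: "x \<in> U <+>\<^bsub>M\<^esub> U' \<longleftrightarrow> (\<exists>u\<in>U. \<exists>u'\<in>U'. x = u \<oplus>\<^bsub>M\<^esub> u')"
  by (auto simp: set_add_def set_mult_def)

lemma (in left_module) direct_sum_unique:
  assumes sub: "submodule U R M" "submodule U' R M" and disj: "U \<inter> U' = {\<zero>\<^bsub>M\<^esub>}"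
    and u: "u \<in> U" "u' \<in> U'" "w \<in> U" "w' \<in> U'" and eq: "u \<oplus>\<^bsub>M\<^esub> u' = w \<oplus>\<^bsub>M\<^esub> w'"
  shows "u = w" "u' = w'"
proof -
  note U = submoduleD[OF sub(1)] and U' = submoduleD[OF sub(2)]
  have c: "u \<in> carrier M" "w \<in> carrier M" "u' \<in> carrier M" "w' \<in> carrier M" using u U(1) U'(1) by auto
  have "u \<ominus>\<^bsub>M\<^esub> w = w' \<ominus>\<^bsub>M\<^esub> u'"
  proof -
    have "u \<ominus>\<^bsub>M\<^esub> w = (u \<oplus>\<^bsub>M\<^esub> u') \<oplus>\<^bsub>M\<^esub> (\<ominus>\<^bsub>M\<^esub> u' \<oplus>\<^bsub>M\<^esub> \<ominus>\<^bsub>M\<^esub> w)"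
      using c by (simp add: M.minus_eq M.a_assoc M.r_neg2)
    also have "\<dots> = (w' \<oplus>\<^bsub>M\<^esub> w) \<oplus>\<^bsub>M\<^esub> (\<ominus>\<^bsub>M\<^esub> w \<oplus>\<^bsub>M\<^esub> \<ominus>\<^bsub>M\<^esub> u')"
      using c eq by (simp add: M.a_comm)
    also have "\<dots> = w' \<ominus>\<^bsub>M\<^esub> u'"
      using c by (simp add: M.minus_eq M.a_assoc M.r_neg2)
    finally show ?thesis .
  qed
  moreover have "u \<ominus>\<^bsub>M\<^esub> w \<in> U" "w' \<ominus>\<^bsub>M\<^esub> u' \<in> U'"
    using u U(3,5) U'(3,5) by (auto simp: M.minus_eq)
  ultimately have "u \<ominus>\<^bsub>M\<^esub> w \<in> U \<inter> U'" "w' \<ominus>\<^bsub>M\<^esub> u' \<in> U \<inter> U'" by auto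
  then have "u \<ominus>\<^bsub>M\<^esub> w = \<zero>\<^bsub>M\<^esub>" "w' \<ominus>\<^bsub>M\<^esub> u' = \<zero>\<^bsub>M\<^esub>" using disj by auto
  then show "u = w" "u' = w'" using c by (auto simp: M.minus_eq dest!: M.minus_equality)
qed

text \<open>Zorn's lemma gives a submodule \<open>C\<close> maximal among those meeting
  \<open>U\<close> only in zero. A vector \<open>x\<close> outside \<open>U + C\<close> could be
  added to \<open>C\<close>: an element of \<open>U\<close> in \<open>C + R x\<close> with nonzero
  coefficient at \<open>x\<close> would, after division by this coefficient, put \<open>x\<close>
  into \<open>U + C\<close>.\<close>

lemma complement_exists:
  assumes R: "skew_field R" and M: "left_module R M" and U: "submodule U R M"
  shows "\<exists>C. internal_direct_sum R M U C"
proof -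
  interpret R: skew_field R by fact
  interpret left_module R M by fact
  note DU = submoduleD[OF U]
  define \<C> where "\<C> = {C. submodule C R M \<and> U \<inter> C = {\<zero>\<^bsub>M\<^esub>}}"
  have "\<exists>C\<in>\<C>. \<forall>X\<in>\<C>. C \<subseteq> X \<longrightarrow> X = C"
  proof (rule subset_Zorn_nonempty)
    show "\<C> \<noteq> {}" using submodule_zero DU(2) unfolding \<C>_def by blast
    fix \<K> assume ne: "\<K> \<noteq> {}" and chain: "subset.chain \<C> \<K>"
    have K: "submodule C R M" "U \<inter> C = {\<zero>\<^bsub>M\<^esub>}" if "C \<in> \<K>" for C
      using chain that by (auto simp: subset.chain_def \<C>_def)
    have "submodule (\<Union>\<K>) R M"
    proof (rule submoduleI)
      show "\<Union>\<K> \<subseteq> carrier M" using submoduleD(1)[OF K(1)] by blast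
      show "\<zero>\<^bsub>M\<^esub> \<in> \<Union>\<K>" using ne submoduleD(2)[OF K(1)] by blast
      show "a \<odot>\<^bsub>M\<^esub> z \<in> \<Union>\<K>" if "a \<in> carrier R" "z \<in> \<Union>\<K>" for a z
        using that submoduleD(4)[OF K(1)] by blast
      show "z \<oplus>\<^bsub>M\<^esub> w \<in> \<Union>\<K>" if zw: "z \<in> \<Union>\<K>" "w \<in> \<Union>\<K>" for z w
      proof -
        obtain C D where CD: "C \<in> \<K>" "z \<in> C" "D \<in> \<K>" "w \<in> D" using zw by blast
        then have "C \<subseteq> D \<or> D \<subseteq> C" using chain by (auto simp: subset.chain_def)
        then show ?thesis using CD submoduleD(3)[OF K(1)] by blast
      qed
    qed
    moreover have "U \<inter> \<Union>\<K> = {\<zero>\<^bsub>M\<^esub>}" using K(2) ne by blast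
    ultimately show "\<Union>\<K> \<in> \<C>" by (simp add: \<C>_def)
  qed
  then obtain C where C: "submodule C R M" "U \<inter> C = {\<zero>\<^bsub>M\<^esub>}"
    and max: "\<And>X. submodule X R M \<Longrightarrow> U \<inter> X = {\<zero>\<^bsub>M\<^esub>} \<Longrightarrow> C \<subseteq> X \<Longrightarrow> X = C"
    by (auto simp: \<C>_def)
  note DC = submoduleD[OF C(1)]
  have "x \<in> U <+>\<^bsub>M\<^esub> C" if x: "x \<in> carrier M" for x
  proof (rule ccontr)
    assume nx: "x \<notin> U <+>\<^bsub>M\<^esub> C"
    define X where "X = {c \<oplus>\<^bsub>M\<^esub> a \<odot>\<^bsub>M\<^esub> x | c a. c \<in> C \<and> a \<in> carrier R}"
    have XI: "c \<oplus>\<^bsub>M\<^esub> a \<odot>\<^bsub>M\<^esub> x \<in> X" if "c \<in> C" "a \<in> carrier R" for c a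
      using that by (auto simp: X_def)
    have cC: "c \<in> carrier M" if "c \<in> C" for c using that DC(1) by auto
    have "submodule X R M"
    proof (rule submoduleI)
      show "X \<subseteq> carrier M" using cC x by (auto simp: X_def smult_closed)
      show "\<zero>\<^bsub>M\<^esub> \<in> X" using XI[OF DC(2), of "\<zero>\<^bsub>R\<^esub>"] x by (simp add: smult_zero_left)
      show "b \<odot>\<^bsub>M\<^esub> z \<in> X" if b: "b \<in> carrier R" and z: "z \<in> X" for b z
      proof -
        obtain c a where ca: "z = c \<oplus>\<^bsub>M\<^esub> a \<odot>\<^bsub>M\<^esub> x" "c \<in> C" "a \<in> carrier R" using z by (auto simp: X_def)
        then have "b \<odot>\<^bsub>M\<^esub> z = b \<odot>\<^bsub>M\<^esub> c \<oplus>\<^bsub>M\<^esub> (b \<otimes>\<^bsub>R\<^esub> a) \<odot>\<^bsub>M\<^esub> x"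
          using b x cC by (simp add: smult_r_distr smult_assoc smult_closed)
        then show ?thesis using XI[of "b \<odot>\<^bsub>M\<^esub> c" "b \<otimes>\<^bsub>R\<^esub> a"] DC(4) b ca by simp
      qed
      show "z \<oplus>\<^bsub>M\<^esub> w \<in> X" if zw: "z \<in> X" "w \<in> X" for z w
      proof -
        obtain c a c' a' where ca: "z = c \<oplus>\<^bsub>M\<^esub> a \<odot>\<^bsub>M\<^esub> x" "c \<in> C" "a \<in> carrier R"
          "w = c' \<oplus>\<^bsub>M\<^esub> a' \<odot>\<^bsub>M\<^esub> x" "c' \<in> C" "a' \<in> carrier R" using zw unfolding X_def by blast
        then have "z \<oplus>\<^bsub>M\<^esub> w = (c \<oplus>\<^bsub>M\<^esub> c') \<oplus>\<^bsub>M\<^esub> (a \<oplus>\<^bsub>R\<^esub> a') \<odot>\<^bsub>M\<^esub> x"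
          using x cC by (simp add: smult_l_distr smult_closed M.a_ac)
        then show ?thesis using XI[of "c \<oplus>\<^bsub>M\<^esub> c'" "a \<oplus>\<^bsub>R\<^esub> a'"] DC(3) ca by simp
      qed
    qed
    moreover have "U \<inter> X = {\<zero>\<^bsub>M\<^esub>}"
    proof -
      have "z = \<zero>\<^bsub>M\<^esub>" if z: "z \<in> U" "z \<in> X" for z
      proof -
        obtain c a where ca: "z = c \<oplus>\<^bsub>M\<^esub> a \<odot>\<^bsub>M\<^esub> x" "c \<in> C" "a \<in> carrier R" using z by (auto simp: X_def)
        have "a = \<zero>\<^bsub>R\<^esub>"
        proof (rule ccontr)
          assume "a \<noteq> \<zero>\<^bsub>R\<^esub>"
          then have "a \<in> Units R" using ca(3) R.skew_field_Units by auto
          then obtain b where b: "b \<in> carrier R" "b \<otimes>\<^bsub>R\<^esub> a = \<one>\<^bsub>R\<^esub>" by (auto simp: Units_def)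
          have "a \<odot>\<^bsub>M\<^esub> x = z \<oplus>\<^bsub>M\<^esub> \<ominus>\<^bsub>M\<^esub> c"
            using ca x cC by (simp add: M.a_ac M.r_neg1 M.r_neg2 smult_closed)
          then have "x = b \<odot>\<^bsub>M\<^esub> z \<oplus>\<^bsub>M\<^esub> b \<odot>\<^bsub>M\<^esub> (\<ominus>\<^bsub>M\<^esub> c)"
            using b ca x cC z(1) DU(1) smult_assoc[of b a x]
            by (metis M.a_inv_closed smult_one smult_r_distr subsetD)
          moreover have "b \<odot>\<^bsub>M\<^esub> z \<in> U" "b \<odot>\<^bsub>M\<^esub> (\<ominus>\<^bsub>M\<^esub> c) \<in> C"
            using b ca z DU(4) DC(4,5) by auto
          ultimately show False using nx by (auto simp: set_add_iff)
        qed
        then have "z = c" using ca x cC by (simp add: smult_zero_left)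
        then show ?thesis using ca z C(2) by auto
      qed
      moreover have "\<zero>\<^bsub>M\<^esub> \<in> X" using XI[OF DC(2), of "\<zero>\<^bsub>R\<^esub>"] x by (simp add: smult_zero_left)
      ultimately show ?thesis using DU(2) by blast
    qed
    moreover have "C \<subseteq> X"
    proof
      fix c assume "c \<in> C"
      then show "c \<in> X" using XI[of c "\<zero>\<^bsub>R\<^esub>"] x cC by (simp add: smult_zero_left)
    qed
    ultimately have "X = C" by (rule max)
    moreover have "x \<in> X" using XI[OF DC(2), of "\<one>\<^bsub>R\<^esub>"] x by (simp add: smult_one)
    ultimately have "\<zero>\<^bsub>M\<^esub> \<oplus>\<^bsub>M\<^esub> x \<in> U <+>\<^bsub>M\<^esub> C" using DU(2) unfolding set_add_iff by blast
    then show False using nx x by simp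
  qed
  moreover have "U <+>\<^bsub>M\<^esub> C \<subseteq> carrier M" using DU(1) DC(1) by (fastforce simp: set_add_iff)
  ultimately show ?thesis using U C unfolding internal_direct_sum_def by blast
qed


section \<open>Subspaces of tensor products\<close>

context tensor
begin

text \<open>The image of the tensor product of \<open>B\<close> and \<open>U\<close> in that of
  \<open>B\<close> and \<open>V\<close>. Generating it inside the large tensor product avoids a
  comparison map between two quotients. Scalars, and with them negatives, are absorbed by the left
  factors.\<close>

inductive_set tspan :: "'v set \<Rightarrow> ('b, 'v) tensor set" for U where
  zero: "\<zero>\<^bsub>T\<^esub> \<in> tspan U"
| pure: "b \<in> carrier B \<Longrightarrow> u \<in> U \<Longrightarrow> b \<otimes>\<otimes> u \<in> tspan U"
| add: "s \<in> tspan U \<Longrightarrow> t \<in> tspan U \<Longrightarrow> s \<oplus>\<^bsub>T\<^esub> t \<in> tspan U"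

lemma span_closed:
  assumes "U \<subseteq> carrier V" "t \<in> tspan U"
  shows "t \<in> carrier T"
  using assms(2) by induction (use assms(1) in auto)

lemma submodule_span:
  assumes U: "U \<subseteq> carrier V"
  shows "submodule (tspan U) L T"
proof (rule T.submoduleI)
  show "a \<odot>\<^bsub>T\<^esub> t \<in> tspan U" if a: "a \<in> carrier L" and "t \<in> tspan U" for a t
    using that(2)
  proof induction
    case zero
    then show ?case using a T.smult_zero_right tspan.zero by simp
  next
    case (pure b u)
    then show ?case using a U B.smult_closed smult_pure[of a b u] tspan.pure[of "a \<odot>\<^bsub>B\<^esub> b" u U] by auto
  next
    case (add s t)
    then show ?case using a span_closed[OF U] T.smult_r_distr tspan.add by simp
  qed
qed (use U span_closed tspan.zero tspan.add in auto)

lemma span_zero: "tspan {\<zero>\<^bsub>V\<^esub>} = {\<zero>\<^bsub>T\<^esub>}"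
proof -
  have "t = \<zero>\<^bsub>T\<^esub>" if "t \<in> tspan {\<zero>\<^bsub>V\<^esub>}" for t
    using that by induction (auto simp: pure_zero_right)
  then show ?thesis using tspan.zero by blast
qed

text \<open>The projection \<open>p\<close> of \<open>V\<close> onto \<open>U\<close> along
  \<open>U'\<close> induces an endomorphism \<open>q\<close> of the tensor product that is the
  identity on the first span and zero on the second, so the spans meet trivially. That they add up
  to everything is seen on pure tensors.\<close>

lemma span_direct_sum:
  assumes "internal_direct_sum R V U U'"
  shows "internal_direct_sum L T (tspan U) (tspan U')"
proof -
  have sub: "submodule U R V" "submodule U' R V" and sum: "U <+>\<^bsub>V\<^esub> U' = carrier V"
    and disj: "U \<inter> U' = {\<zero>\<^bsub>V\<^esub>}" using assms by (auto simp: internal_direct_sum_def)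
  note DU = V.submoduleD[OF sub(1)] and DU' = V.submoduleD[OF sub(2)]
  define p where "p v = (THE u. u \<in> U \<and> (\<exists>u'\<in>U'. v = u \<oplus>\<^bsub>V\<^esub> u'))" for v
  have pI: "p (u \<oplus>\<^bsub>V\<^esub> u') = u" if "u \<in> U" "u' \<in> U'" for u u'
    unfolding p_def by (rule the_equality) (use that V.direct_sum_unique[OF sub disj] in blast)+
  have dec: "\<exists>u\<in>U. \<exists>u'\<in>U'. v = u \<oplus>\<^bsub>V\<^esub> u'" if "v \<in> carrier V" for v
    using that sum set_add_iff[of v V U U'] by blast
  have c: "u \<in> U \<Longrightarrow> u \<in> carrier V" "u \<in> U' \<Longrightarrow> u \<in> carrier V" for u using DU(1) DU'(1) by auto
  have p_closed: "p v \<in> U" if "v \<in> carrier V" for v using dec[OF that] pI by auto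
  have p_add: "p (v \<oplus>\<^bsub>V\<^esub> v') = p v \<oplus>\<^bsub>V\<^esub> p v'" if v: "v \<in> carrier V" "v' \<in> carrier V" for v v'
  proof -
    obtain u u' w w' where uw: "u \<in> U" "u' \<in> U'" "v = u \<oplus>\<^bsub>V\<^esub> u'" "w \<in> U" "w' \<in> U'" "v' = w \<oplus>\<^bsub>V\<^esub> w'"
      using dec v by metis
    then have "v \<oplus>\<^bsub>V\<^esub> v' = (u \<oplus>\<^bsub>V\<^esub> w) \<oplus>\<^bsub>V\<^esub> (u' \<oplus>\<^bsub>V\<^esub> w')" using c by (simp add: V.M.a_ac)
    then show ?thesis using pI[of u u'] pI[of w w'] pI[of "u \<oplus>\<^bsub>V\<^esub> w" "u' \<oplus>\<^bsub>V\<^esub> w'"] uw DU(3) DU'(3) by simp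
  qed
  have p_smult: "p (a \<odot>\<^bsub>V\<^esub> v) = a \<odot>\<^bsub>V\<^esub> p v" if a: "a \<in> carrier R" and v: "v \<in> carrier V" for a v
  proof -
    obtain u u' where uw: "u \<in> U" "u' \<in> U'" "v = u \<oplus>\<^bsub>V\<^esub> u'" using dec v by metis
    then have "a \<odot>\<^bsub>V\<^esub> v = a \<odot>\<^bsub>V\<^esub> u \<oplus>\<^bsub>V\<^esub> a \<odot>\<^bsub>V\<^esub> u'" using c a by (simp add: V.smult_r_distr)
    then show ?thesis using pI[of u u'] pI[of "a \<odot>\<^bsub>V\<^esub> u" "a \<odot>\<^bsub>V\<^esub> u'"] uw a DU(4) DU'(4) by simp
  qed
  have bal: "balanced R B V T (\<lambda>b v. b \<otimes>\<otimes> p v)"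
    unfolding balanced_def
    using p_closed c p_add p_smult pure_balanced pure_add_left pure_add_right by auto
  define q where "q = tensor_lift T (\<lambda>b v. b \<otimes>\<otimes> p v)"
  have q: "q (b \<otimes>\<otimes> v) = b \<otimes>\<otimes> p v" if "b \<in> carrier B" "v \<in> carrier V" for b v
    unfolding q_def using lift_pure[OF abelian_group_T bal that] .
  have q_add: "q (s \<oplus>\<^bsub>T\<^esub> t) = q s \<oplus>\<^bsub>T\<^esub> q t" if "s \<in> carrier T" "t \<in> carrier T" for s t
    unfolding q_def using lift_add[OF abelian_group_T bal that] .
  have q_zero: "q \<zero>\<^bsub>T\<^esub> = \<zero>\<^bsub>T\<^esub>"
    using additive_zero[OF abelian_group_T abelian_group_T, of q] q_add
      lift_closed[OF abelian_group_T bal] by (auto simp: q_def)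
  have "q t = t" if "t \<in> tspan U" for t
    using that
  proof induction
    case (pure b u)
    have "p u = u" using pI[OF pure(2) DU'(2)] c(1)[OF pure(2)] by simp
    then show ?case using q[OF pure(1) c(1)[OF pure(2)]] by simp
  qed (auto simp: q_zero q_add span_closed[OF DU(1)])
  moreover have "q t = \<zero>\<^bsub>T\<^esub>" if "t \<in> tspan U'" for t
    using that
  proof induction
    case (pure b u)
    have "p u = \<zero>\<^bsub>V\<^esub>" using pI[OF DU(2) pure(2)] c(2)[OF pure(2)] by simp
    then show ?case using q[OF pure(1) c(2)[OF pure(2)]] pure by (simp add: pure_zero_right)
  qed (auto simp: q_zero q_add span_closed[OF DU'(1)])
  ultimately have "tspan U \<inter> tspan U' = {\<zero>\<^bsub>T\<^esub>}" using tspan.zero by blast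
  moreover have "t \<in> tspan U <+>\<^bsub>T\<^esub> tspan U'" if "t \<in> carrier T" for t
    using that
  proof (induction rule: T_induct)
    case zero
    have "\<zero>\<^bsub>T\<^esub> = \<zero>\<^bsub>T\<^esub> \<oplus>\<^bsub>T\<^esub> \<zero>\<^bsub>T\<^esub>" by simp
    then show ?case unfolding set_add_iff using tspan.zero by blast
  next
    case (pure b v)
    then obtain u u' where "u \<in> U" "u' \<in> U'" "v = u \<oplus>\<^bsub>V\<^esub> u'" using dec by metis
    moreover from this have "b \<otimes>\<otimes> v = b \<otimes>\<otimes> u \<oplus>\<^bsub>T\<^esub> b \<otimes>\<otimes> u'" using pure_add_right pure(1) c by simp
    ultimately show ?case unfolding set_add_iff using tspan.pure pure(1) by blast
  next
    case (add s t)
    then obtain s1 s2 t1 t2 where st: "s1 \<in> tspan U" "s2 \<in> tspan U'" "s = s1 \<oplus>\<^bsub>T\<^esub> s2"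
      "t1 \<in> tspan U" "t2 \<in> tspan U'" "t = t1 \<oplus>\<^bsub>T\<^esub> t2" unfolding set_add_iff by metis
    then have "s \<oplus>\<^bsub>T\<^esub> t = (s1 \<oplus>\<^bsub>T\<^esub> t1) \<oplus>\<^bsub>T\<^esub> (s2 \<oplus>\<^bsub>T\<^esub> t2)"
      using span_closed[OF DU(1)] span_closed[OF DU'(1)] by (simp add: T.a_ac)
    then show ?case unfolding set_add_iff using tspan.add st by blast
  qed
  moreover have "tspan U <+>\<^bsub>T\<^esub> tspan U' \<subseteq> carrier T"
    using span_closed[OF DU(1)] span_closed[OF DU'(1)] by (auto simp: set_add_iff)
  ultimately show ?thesis
    unfolding internal_direct_sum_def using submodule_span[OF DU(1)] submodule_span[OF DU'(1)] by blast
qed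

text \<open>Pairs the left factor with a functional. The maps at the reversed arrows have this form,
  with one contraction for each element of \<open>\<^sub>yB\<^sub>x\<close>.\<close>

definition contract :: "('b \<Rightarrow> 'r) \<Rightarrow> ('b, 'v) tensor \<Rightarrow> 'v"
  where "contract f = tensor_lift V (\<lambda>b v. f b \<odot>\<^bsub>V\<^esub> v)"

lemma right_dualD:
  assumes "f \<in> carrier (right_dual R B)"
  shows "b \<in> carrier B \<Longrightarrow> f b \<in> carrier R"
    "b \<in> carrier B \<Longrightarrow> b' \<in> carrier B \<Longrightarrow> f (b \<oplus>\<^bsub>B\<^esub> b') = f b \<oplus>\<^bsub>R\<^esub> f b'"
    "b \<in> carrier B \<Longrightarrow> a \<in> carrier R \<Longrightarrow> f (b \<odot>\<^sub>r\<^bsub>B\<^esub> a) = f b \<otimes>\<^bsub>R\<^esub> a"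
  using assms by (auto simp: right_dual_def)

lemma balanced_contract:
  assumes "f \<in> carrier (right_dual R B)"
  shows "balanced R B V V (\<lambda>b v. f b \<odot>\<^bsub>V\<^esub> v)"
  using right_dualD[OF assms]
  by (simp add: balanced_def V.smult_closed V.smult_l_distr V.smult_r_distr V.smult_assoc)

lemma
  assumes f: "f \<in> carrier (right_dual R B)"
  shows contract_pure: "b \<in> carrier B \<Longrightarrow> v \<in> carrier V \<Longrightarrow> contract f (b \<otimes>\<otimes> v) = f b \<odot>\<^bsub>V\<^esub> v"
    and contract_closed: "t \<in> carrier T \<Longrightarrow> contract f t \<in> carrier V"
    and contract_add: "s \<in> carrier T \<Longrightarrow> t \<in> carrier T \<Longrightarrow>
      contract f (s \<oplus>\<^bsub>T\<^esub> t) = contract f s \<oplus>\<^bsub>V\<^esub> contract f t"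
    and contract_zero: "contract f \<zero>\<^bsub>T\<^esub> = \<zero>\<^bsub>V\<^esub>"
proof -
  note lift = lift_pure lift_closed lift_add
  note l = lift[OF V.M.abelian_group_axioms balanced_contract[OF f]]
  show "b \<in> carrier B \<Longrightarrow> v \<in> carrier V \<Longrightarrow> contract f (b \<otimes>\<otimes> v) = f b \<odot>\<^bsub>V\<^esub> v"
    "t \<in> carrier T \<Longrightarrow> contract f t \<in> carrier V"
    "s \<in> carrier T \<Longrightarrow> t \<in> carrier T \<Longrightarrow> contract f (s \<oplus>\<^bsub>T\<^esub> t) = contract f s \<oplus>\<^bsub>V\<^esub> contract f t"
    unfolding contract_def by (rule l; assumption)+
  then show "contract f \<zero>\<^bsub>T\<^esub> = \<zero>\<^bsub>V\<^esub>"
    using additive_zero[OF abelian_group_T V.M.abelian_group_axioms, of "contract f"]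
      l(2,3) unfolding contract_def by auto
qed

text \<open>This and the next two lemmas express that contraction respects the bimodule structure of
  \<open>right_dual\<close>; balancedness and linearity of the reversed arrows rest on them. The
  functional \<open>k\<close> is described by its values on \<open>B\<close>, the form in which the
  facts about \<open>pairing\<close> are available.\<close>

lemma contract_functional_add:
  assumes f: "f \<in> carrier (right_dual R B)" and g: "g \<in> carrier (right_dual R B)"
    and k: "k \<in> carrier (right_dual R B)" and kfg: "\<And>b. b \<in> carrier B \<Longrightarrow> k b = f b \<oplus>\<^bsub>R\<^esub> g b"
    and t: "t \<in> carrier T"
  shows "contract k t = contract f t \<oplus>\<^bsub>V\<^esub> contract g t"
  using t
proof (induction rule: T_induct)
  case (add s t)
  then show ?case
    using contract_closed[OF f] contract_closed[OF g] by (simp add: contract_add[OF f] contract_add[OF g] contract_add[OF k] V.M.a_ac)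
qed (simp_all add: contract_zero contract_pure f g k kfg right_dualD[OF f] right_dualD[OF g] V.smult_l_distr)

lemma contract_functional_smult:
  assumes f: "f \<in> carrier (right_dual R B)" and c: "c \<in> carrier R"
    and k: "k \<in> carrier (right_dual R B)" and kf: "\<And>b. b \<in> carrier B \<Longrightarrow> k b = c \<otimes>\<^bsub>R\<^esub> f b"
    and t: "t \<in> carrier T"
  shows "contract k t = c \<odot>\<^bsub>V\<^esub> contract f t"
  using t
proof (induction rule: T_induct)
  case (add s t)
  then show ?case
    using contract_closed[OF f] c by (simp add: contract_add[OF f] contract_add[OF k] V.smult_r_distr)
qed (simp_all add: contract_zero contract_pure f k kf c right_dualD[OF f] V.smult_assoc V.smult_zero_right)

lemma contract_functional_rsmult:
  assumes f: "f \<in> carrier (right_dual R B)" and a: "a \<in> carrier L"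
    and k: "k \<in> carrier (right_dual R B)" and kf: "\<And>b. b \<in> carrier B \<Longrightarrow> k b = f (a \<odot>\<^bsub>B\<^esub> b)"
    and t: "t \<in> carrier T"
  shows "contract k t = contract f (a \<odot>\<^bsub>T\<^esub> t)"
  using t
proof (induction rule: T_induct)
  case (add s t)
  then show ?case
    using a by (simp add: contract_add[OF f] contract_add[OF k] T.smult_r_distr T.smult_closed)
qed (use a in \<open>simp_all add: contract_zero contract_pure f k kf smult_pure T.smult_zero_right B.smult_closed\<close>)

text \<open>A dual basis expands \<open>t\<close> as the sum of the tensors
  \<open>e m \<otimes>\<otimes> contract (\<theta> m) t\<close>: for a pure tensor, expand
  \<open>b\<close> and move the scalars \<open>\<theta> m b\<close> across. All right factors of
  this sum lie in \<open>U\<close>.\<close>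

lemma in_span_if_contractions:
  assumes fin: "finite I" and e: "\<And>m. m \<in> I \<Longrightarrow> e m \<in> carrier B"
    and \<theta>: "\<And>m. m \<in> I \<Longrightarrow> \<theta> m \<in> carrier (right_dual R B)"
    and dual: "\<And>b. b \<in> carrier B \<Longrightarrow> b = (\<Oplus>\<^bsub>B\<^esub>m\<in>I. e m \<odot>\<^sub>r\<^bsub>B\<^esub> \<theta> m b)"
    and U: "submodule U R V" and t: "t \<in> carrier T"
    and con: "\<And>m. m \<in> I \<Longrightarrow> contract (\<theta> m) t \<in> U"
  shows "t \<in> tspan U"
proof -
  have tm: "e m \<otimes>\<otimes> contract (\<theta> m) t \<in> carrier T" if "m \<in> I" "t \<in> carrier T" for m t
    using that e contract_closed[OF \<theta>] by auto
  have "t = (\<Oplus>\<^bsub>T\<^esub>m\<in>I. e m \<otimes>\<otimes> contract (\<theta> m) t)"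
    using t
  proof (induction rule: T_induct)
    case zero
    have "(\<Oplus>\<^bsub>T\<^esub>m\<in>I. e m \<otimes>\<otimes> contract (\<theta> m) \<zero>\<^bsub>T\<^esub>) = (\<Oplus>\<^bsub>T\<^esub>m\<in>I. \<zero>\<^bsub>T\<^esub>)"
      by (rule T.finsum_cong') (use e contract_zero[OF \<theta>] in \<open>auto simp: pure_zero_right\<close>)
    then show ?case by (simp add: T.finsum_zero)
  next
    case (pure b v)
    have "b \<otimes>\<otimes> v = (\<Oplus>\<^bsub>B\<^esub>m\<in>I. e m \<odot>\<^sub>r\<^bsub>B\<^esub> \<theta> m b) \<otimes>\<otimes> v" using dual[OF pure(1)] by simp
    also have "\<dots> = (\<Oplus>\<^bsub>T\<^esub>m\<in>I. (e m \<odot>\<^sub>r\<^bsub>B\<^esub> \<theta> m b) \<otimes>\<otimes> v)"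
      by (rule additive_finsum[OF B.M.abelian_group_axioms abelian_group_T])
        (use pure fin e right_dualD(1)[OF \<theta>] in \<open>auto simp: pure_add_left B.rsmult_closed\<close>)
    also have "\<dots> = (\<Oplus>\<^bsub>T\<^esub>m\<in>I. e m \<otimes>\<otimes> contract (\<theta> m) (b \<otimes>\<otimes> v))"
    proof (rule T.finsum_cong')
      show "(\<lambda>m. e m \<otimes>\<otimes> contract (\<theta> m) (b \<otimes>\<otimes> v)) \<in> I \<rightarrow> carrier T" using tm pure by auto
      show "(e m \<odot>\<^sub>r\<^bsub>B\<^esub> \<theta> m b) \<otimes>\<otimes> v = e m \<otimes>\<otimes> contract (\<theta> m) (b \<otimes>\<otimes> v)" if "m \<in> I" for m
        using pure e[OF that] right_dualD(1)[OF \<theta>[OF that]] contract_pure[OF \<theta>[OF that]]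
        by (simp add: pure_balanced)
    qed simp
    finally show ?case .
  next
    case (add s t)
    have "(\<Oplus>\<^bsub>T\<^esub>m\<in>I. e m \<otimes>\<otimes> contract (\<theta> m) (s \<oplus>\<^bsub>T\<^esub> t)) =
      (\<Oplus>\<^bsub>T\<^esub>m\<in>I. e m \<otimes>\<otimes> contract (\<theta> m) s \<oplus>\<^bsub>T\<^esub> e m \<otimes>\<otimes> contract (\<theta> m) t)"
    proof (rule T.finsum_cong')
      show "(\<lambda>m. e m \<otimes>\<otimes> contract (\<theta> m) s \<oplus>\<^bsub>T\<^esub> e m \<otimes>\<otimes> contract (\<theta> m) t) \<in> I \<rightarrow> carrier T"
        using tm add by auto
      show "e m \<otimes>\<otimes> contract (\<theta> m) (s \<oplus>\<^bsub>T\<^esub> t) =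
        e m \<otimes>\<otimes> contract (\<theta> m) s \<oplus>\<^bsub>T\<^esub> e m \<otimes>\<otimes> contract (\<theta> m) t" if "m \<in> I" for m
        using add e[OF that] contract_closed[OF \<theta>[OF that]]
        by (simp add: contract_add[OF \<theta>[OF that]] pure_add_right)
    qed simp
    also have "\<dots> = (\<Oplus>\<^bsub>T\<^esub>m\<in>I. e m \<otimes>\<otimes> contract (\<theta> m) s) \<oplus>\<^bsub>T\<^esub> (\<Oplus>\<^bsub>T\<^esub>m\<in>I. e m \<otimes>\<otimes> contract (\<theta> m) t)"
      by (rule T.finsum_addf) (use tm add in auto)
    also have "\<dots> = s \<oplus>\<^bsub>T\<^esub> t"
      by (rule arg_cong2[where f = "(\<oplus>\<^bsub>T\<^esub>)", OF add(3,4)[symmetric]])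
    finally show ?case by (rule sym)
  qed
  also have "(\<Oplus>\<^bsub>T\<^esub>m\<in>I. e m \<otimes>\<otimes> contract (\<theta> m) t) \<in> tspan U"
    by (rule T.finsum_in_submodule[OF submodule_span[OF V.submoduleD(1)[OF U]] fin])
      (use e con in \<open>auto intro: tspan.pure\<close>)
  finally show ?thesis .
qed

end


text \<open>
  The right dual basis of \<open>\<^sub>xB\<^sub>y\<close> comes from the left basis of \<open>\<^sub>yB\<^sub>x\<close>, because \<open>\<^sub>xB\<^sub>y\<close> is the left dual
  of \<open>\<^sub>yB\<^sub>x\<close>.
\<close>

lemma right_dual_basis:
  assumes B: "bimodule L R B" and B': "bimodule R L B'"
    and X: "is_basis R B' X" and \<phi>: "bimodule_iso L R B (left_dual R B') \<phi>"
  shows "\<exists>e \<theta>. (\<forall>m\<in>X. e m \<in> carrier B \<and> \<theta> m \<in> carrier (right_dual R B)) \<and>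
    (\<forall>b\<in>carrier B. b = (\<Oplus>\<^bsub>B\<^esub>m\<in>X. e m \<odot>\<^sub>r\<^bsub>B\<^esub> \<theta> m b))"
proof -
  interpret B: bimodule L R B by fact
  interpret B': bimodule R L B' by fact
  have fin: "finite X" and XB: "X \<subseteq> carrier B'"
    and bas: "\<And>x. x \<in> carrier B' \<Longrightarrow> \<exists>!c. c \<in> X \<rightarrow>\<^sub>E carrier R \<and> x = (\<Oplus>\<^bsub>B'\<^esub>m\<in>X. c m \<odot>\<^bsub>B'\<^esub> m)"
    using X by (auto simp: is_basis_def)
  define c where "c x = (THE c. c \<in> X \<rightarrow>\<^sub>E carrier R \<and> x = (\<Oplus>\<^bsub>B'\<^esub>m\<in>X. c m \<odot>\<^bsub>B'\<^esub> m))" for x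
  have c: "c x \<in> X \<rightarrow>\<^sub>E carrier R" "x = (\<Oplus>\<^bsub>B'\<^esub>m\<in>X. c x m \<odot>\<^bsub>B'\<^esub> m)" if "x \<in> carrier B'" for x
    using theI'[OF bas[OF that]] by (auto simp: c_def)
  \<comment> \<open>Coefficients are restricted to \<open>X\<close> because the uniqueness in
    \<open>is_basis\<close> speaks of extensional families. Additivity and homogeneity of the
    coordinates follow from this step.\<close>
  have c_eq: "c x m = d m" if "x \<in> carrier B'" "d \<in> X \<rightarrow> carrier R" "x = (\<Oplus>\<^bsub>B'\<^esub>m\<in>X. d m \<odot>\<^bsub>B'\<^esub> m)" "m \<in> X"
    for x d m
  proof -
    have "(\<Oplus>\<^bsub>B'\<^esub>m\<in>X. restrict d X m \<odot>\<^bsub>B'\<^esub> m) = (\<Oplus>\<^bsub>B'\<^esub>m\<in>X. d m \<odot>\<^bsub>B'\<^esub> m)"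
      by (rule B'.finsum_cong') (use that XB B'.smult_closed in auto)
    moreover have "restrict d X \<in> X \<rightarrow>\<^sub>E carrier R" using that by auto
    ultimately have "c x = restrict d X"
      unfolding c_def using bas[OF that(1)] that(3) by (intro the1_equality) auto
    then show ?thesis using that by simp
  qed
  have cR: "c x m \<in> carrier R" if "x \<in> carrier B'" "m \<in> X" for x m using c(1)[OF that(1)] that by auto
  have c_add: "c (x \<oplus>\<^bsub>B'\<^esub> y) m = c x m \<oplus>\<^bsub>R\<^esub> c y m" if xy: "x \<in> carrier B'" "y \<in> carrier B'" and m: "m \<in> X" for x y m
  proof (rule c_eq[OF _ _ _ m])
    have cl: "c x m \<odot>\<^bsub>B'\<^esub> m \<in> carrier B'" "c y m \<odot>\<^bsub>B'\<^esub> m \<in> carrier B'" if "m \<in> X" for m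
      using that cR xy XB B'.smult_closed by auto
    have "x \<oplus>\<^bsub>B'\<^esub> y = (\<Oplus>\<^bsub>B'\<^esub>m\<in>X. c x m \<odot>\<^bsub>B'\<^esub> m) \<oplus>\<^bsub>B'\<^esub> (\<Oplus>\<^bsub>B'\<^esub>m\<in>X. c y m \<odot>\<^bsub>B'\<^esub> m)"
      using c(2) xy by simp
    also have "\<dots> = (\<Oplus>\<^bsub>B'\<^esub>m\<in>X. c x m \<odot>\<^bsub>B'\<^esub> m \<oplus>\<^bsub>B'\<^esub> c y m \<odot>\<^bsub>B'\<^esub> m)"
      by (rule B'.finsum_addf[symmetric]) (use cl in auto)
    also have "\<dots> = (\<Oplus>\<^bsub>B'\<^esub>m\<in>X. (c x m \<oplus>\<^bsub>R\<^esub> c y m) \<odot>\<^bsub>B'\<^esub> m)"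
      by (rule B'.finsum_cong') (use cR xy XB B'.smult_l_distr B'.smult_closed in auto)
    finally show "x \<oplus>\<^bsub>B'\<^esub> y = (\<Oplus>\<^bsub>B'\<^esub>m\<in>X. (c x m \<oplus>\<^bsub>R\<^esub> c y m) \<odot>\<^bsub>B'\<^esub> m)" .
  qed (use xy cR in auto)
  have c_smult: "c (a \<odot>\<^bsub>B'\<^esub> x) m = a \<otimes>\<^bsub>R\<^esub> c x m" if a: "a \<in> carrier R" and x: "x \<in> carrier B'" and m: "m \<in> X" for a x m
  proof (rule c_eq[OF _ _ _ m])
    have cl: "c x m \<odot>\<^bsub>B'\<^esub> m \<in> carrier B'" if "m \<in> X" for m
      using that cR x XB B'.smult_closed by auto
    have "a \<odot>\<^bsub>B'\<^esub> x = a \<odot>\<^bsub>B'\<^esub> (\<Oplus>\<^bsub>B'\<^esub>m\<in>X. c x m \<odot>\<^bsub>B'\<^esub> m)" using c(2) x by simp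
    also have "\<dots> = (\<Oplus>\<^bsub>B'\<^esub>m\<in>X. a \<odot>\<^bsub>B'\<^esub> (c x m \<odot>\<^bsub>B'\<^esub> m))"
      by (rule B'.smult_finsum) (use a fin cl in auto)
    also have "\<dots> = (\<Oplus>\<^bsub>B'\<^esub>m\<in>X. (a \<otimes>\<^bsub>R\<^esub> c x m) \<odot>\<^bsub>B'\<^esub> m)"
      by (rule B'.finsum_cong') (use a cR x XB B'.smult_assoc B'.smult_closed in auto)
    finally show "a \<odot>\<^bsub>B'\<^esub> x = (\<Oplus>\<^bsub>B'\<^esub>m\<in>X. (a \<otimes>\<^bsub>R\<^esub> c x m) \<odot>\<^bsub>B'\<^esub> m)" .
  qed (use a x cR B'.smult_closed in auto)
  have \<phi>_bij: "bij_betw \<phi> (carrier B) (carrier (left_dual R B'))"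
    and \<phi>_add: "\<And>b b'. b \<in> carrier B \<Longrightarrow> b' \<in> carrier B \<Longrightarrow>
      \<phi> (b \<oplus>\<^bsub>B\<^esub> b') = \<phi> b \<oplus>\<^bsub>left_dual R B'\<^esub> \<phi> b'"
    and \<phi>_rsmult: "\<And>b a. b \<in> carrier B \<Longrightarrow> a \<in> carrier R \<Longrightarrow>
      \<phi> (b \<odot>\<^sub>r\<^bsub>B\<^esub> a) = \<phi> b \<odot>\<^sub>r\<^bsub>left_dual R B'\<^esub> a"
    using \<phi> by (auto simp: bimodule_iso_def left_linear_def)
  have \<phi>_dual: "\<phi> b \<in> carrier (left_dual R B')" if "b \<in> carrier B" for b
    using \<phi>_bij that by (auto simp: bij_betw_def)
  have \<phi>_closed: "\<phi> b x \<in> carrier R" if "b \<in> carrier B" "x \<in> carrier B'" for b x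
    using \<phi>_dual[OF that(1)] that(2) by (auto simp: left_dual_def)
  have \<phi>_add': "\<phi> (b \<oplus>\<^bsub>B\<^esub> b') x = \<phi> b x \<oplus>\<^bsub>R\<^esub> \<phi> b' x"
    if "b \<in> carrier B" "b' \<in> carrier B" "x \<in> carrier B'" for b b' x
    using that \<phi>_add[OF that(1,2)] by (simp add: left_dual_def)
  have \<phi>_rsmult': "\<phi> (b \<odot>\<^sub>r\<^bsub>B\<^esub> a) x = \<phi> b x \<otimes>\<^bsub>R\<^esub> a"
    if "b \<in> carrier B" "a \<in> carrier R" "x \<in> carrier B'" for b a x
    using that \<phi>_rsmult[OF that(1,2)] by (simp add: left_dual_def)
  \<comment> \<open>The coordinate functionals are left linear, so \<open>\<phi>\<close> realizes
    them by elements \<open>e m\<close> of \<open>B\<close>. The functionals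
    \<open>\<theta> m\<close> will be the evaluations at the basis elements.\<close>
  have "(\<lambda>x\<in>carrier B'. c x m) \<in> carrier (left_dual R B')" if "m \<in> X" for m
    using that cR c_add c_smult B'.smult_closed by (auto simp: left_dual_def)
  then have "\<exists>b\<in>carrier B. \<phi> b = (\<lambda>x\<in>carrier B'. c x m)" if "m \<in> X" for m
    using \<phi>_bij that unfolding bij_betw_def by (metis imageE)
  then obtain e where e: "\<And>m. m \<in> X \<Longrightarrow> e m \<in> carrier B"
    and \<phi>e: "\<And>m. m \<in> X \<Longrightarrow> \<phi> (e m) = (\<lambda>x\<in>carrier B'. c x m)" by metis
  define \<theta> where "\<theta> m = (\<lambda>b\<in>carrier B. \<phi> b m)" for m
  have \<theta>: "\<theta> m \<in> carrier (right_dual R B)" if "m \<in> X" for m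
    using that XB \<phi>_closed \<phi>_add' \<phi>_rsmult' B.rsmult_closed by (auto simp: \<theta>_def right_dual_def)
  have "b = (\<Oplus>\<^bsub>B\<^esub>m\<in>X. e m \<odot>\<^sub>r\<^bsub>B\<^esub> \<theta> m b)" if b: "b \<in> carrier B" for b
  proof -
    have \<theta>R: "\<theta> m b \<in> carrier R" if "m \<in> X" for m using that XB b \<phi>_closed by (auto simp: \<theta>_def)
    let ?s = "\<Oplus>\<^bsub>B\<^esub>m\<in>X. e m \<odot>\<^sub>r\<^bsub>B\<^esub> \<theta> m b"
    have terms: "(\<lambda>m. e m \<odot>\<^sub>r\<^bsub>B\<^esub> \<theta> m b) \<in> X \<rightarrow> carrier B" using e \<theta>R B.rsmult_closed by auto
    have s: "?s \<in> carrier B" by (rule B.M.finsum_closed[OF terms])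
    \<comment> \<open>As \<open>\<phi>\<close> is injective, the expansion of \<open>b\<close> may
      be tested at each \<open>x\<close>, where it says that the linear map \<open>\<phi> b\<close>
      is determined by its values on the basis.\<close>
    have "\<phi> b x = \<phi> ?s x" if x: "x \<in> carrier B'" for x
    proof -
      have "\<phi> ?s x = (\<Oplus>\<^bsub>R\<^esub>m\<in>X. \<phi> (e m \<odot>\<^sub>r\<^bsub>B\<^esub> \<theta> m b) x)"
        by (rule additive_finsum[OF B.M.abelian_group_axioms B.S.abelian_group_axioms _ _ fin terms])
          (use x \<phi>_closed \<phi>_add' in auto)
      also have "\<dots> = (\<Oplus>\<^bsub>R\<^esub>m\<in>X. \<phi> b (c x m \<odot>\<^bsub>B'\<^esub> m))"
      proof (rule B.S.finsum_cong')
        show "(\<lambda>m. \<phi> b (c x m \<odot>\<^bsub>B'\<^esub> m)) \<in> X \<rightarrow> carrier R"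
          using b x cR XB \<phi>_closed B'.smult_closed by auto
        show "\<phi> (e m \<odot>\<^sub>r\<^bsub>B\<^esub> \<theta> m b) x = \<phi> b (c x m \<odot>\<^bsub>B'\<^esub> m)" if m: "m \<in> X" for m
        proof -
          have "\<phi> b (c x m \<odot>\<^bsub>B'\<^esub> m) = c x m \<otimes>\<^bsub>R\<^esub> \<phi> b m"
            using \<phi>_dual[OF b] cR[OF x m] m XB by (auto simp: left_dual_def)
          then show ?thesis using \<phi>_rsmult'[OF e[OF m] \<theta>R[OF m] x] m x b by (simp add: \<phi>e \<theta>_def)
        qed
      qed simp
      also have "\<dots> = \<phi> b (\<Oplus>\<^bsub>B'\<^esub>m\<in>X. c x m \<odot>\<^bsub>B'\<^esub> m)"
        by (rule additive_finsum[symmetric, OF B'.M.abelian_group_axioms B.S.abelian_group_axioms _ _ fin])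
          (use b x cR XB \<phi>_closed \<phi>_dual[OF b] B'.smult_closed in \<open>auto simp: left_dual_def\<close>)
      finally show ?thesis using c(2)[OF x] by simp
    qed
    moreover have "\<phi> b \<in> extensional (carrier B')" "\<phi> ?s \<in> extensional (carrier B')"
      using \<phi>_dual[OF b] \<phi>_dual[OF s] by (auto simp: left_dual_def PiE_def)
    ultimately have "\<phi> b = \<phi> ?s" by (intro extensionalityI[of _ "carrier B'"]) auto
    then show ?thesis using \<phi>_bij b s by (auto simp: bij_betw_def inj_on_def)
  qed
  then show ?thesis using e \<theta> by blast
qed


section \<open>Restricted and renamed modules, images of submodules\<close>

lemma left_moduleI:
  assumes "ring R" "\<zero>\<^bsub>M\<^esub> \<in> carrier M"
    and "\<And>x y. x \<in> carrier M \<Longrightarrow> y \<in> carrier M \<Longrightarrow> x \<oplus>\<^bsub>M\<^esub> y \<in> carrier M"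
    and "\<And>x y z. x \<in> carrier M \<Longrightarrow> y \<in> carrier M \<Longrightarrow> z \<in> carrier M \<Longrightarrow>
      (x \<oplus>\<^bsub>M\<^esub> y) \<oplus>\<^bsub>M\<^esub> z = x \<oplus>\<^bsub>M\<^esub> (y \<oplus>\<^bsub>M\<^esub> z)"
    and "\<And>x y. x \<in> carrier M \<Longrightarrow> y \<in> carrier M \<Longrightarrow> x \<oplus>\<^bsub>M\<^esub> y = y \<oplus>\<^bsub>M\<^esub> x"
    and "\<And>x. x \<in> carrier M \<Longrightarrow> \<zero>\<^bsub>M\<^esub> \<oplus>\<^bsub>M\<^esub> x = x"
    and "\<And>x. x \<in> carrier M \<Longrightarrow> \<exists>y\<in>carrier M. y \<oplus>\<^bsub>M\<^esub> x = \<zero>\<^bsub>M\<^esub>"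
    and "\<And>a x. a \<in> carrier R \<Longrightarrow> x \<in> carrier M \<Longrightarrow> a \<odot>\<^bsub>M\<^esub> x \<in> carrier M"
    and "\<And>a b x. a \<in> carrier R \<Longrightarrow> b \<in> carrier R \<Longrightarrow> x \<in> carrier M \<Longrightarrow>
      (a \<oplus>\<^bsub>R\<^esub> b) \<odot>\<^bsub>M\<^esub> x = a \<odot>\<^bsub>M\<^esub> x \<oplus>\<^bsub>M\<^esub> b \<odot>\<^bsub>M\<^esub> x"
    and "\<And>a x y. a \<in> carrier R \<Longrightarrow> x \<in> carrier M \<Longrightarrow> y \<in> carrier M \<Longrightarrow>
      a \<odot>\<^bsub>M\<^esub> (x \<oplus>\<^bsub>M\<^esub> y) = a \<odot>\<^bsub>M\<^esub> x \<oplus>\<^bsub>M\<^esub> a \<odot>\<^bsub>M\<^esub> y"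
    and "\<And>a b x. a \<in> carrier R \<Longrightarrow> b \<in> carrier R \<Longrightarrow> x \<in> carrier M \<Longrightarrow>
      (a \<otimes>\<^bsub>R\<^esub> b) \<odot>\<^bsub>M\<^esub> x = a \<odot>\<^bsub>M\<^esub> (b \<odot>\<^bsub>M\<^esub> x)"
    and "\<And>x. x \<in> carrier M \<Longrightarrow> \<one>\<^bsub>R\<^esub> \<odot>\<^bsub>M\<^esub> x = x"
  shows "left_module R M"
proof (intro left_module.intro left_module_axioms.intro)
  show "abelian_group M" by (rule abelian_groupI) (use assms in blast)+
qed (use assms in auto)

lemma (in left_module) left_module_submodule:
  assumes "submodule H R M"
  shows "left_module R (M\<lparr>carrier := H\<rparr>)"
proof -
  note D = submoduleD[OF assms]
  have c: "x \<in> carrier M" if "x \<in> H" for x using D(1) that by auto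
  show ?thesis
  proof (rule left_moduleI)
    show "\<exists>y\<in>carrier (M\<lparr>carrier := H\<rparr>). y \<oplus>\<^bsub>M\<lparr>carrier := H\<rparr>\<^esub> x = \<zero>\<^bsub>M\<lparr>carrier := H\<rparr>\<^esub>"
      if "x \<in> carrier (M\<lparr>carrier := H\<rparr>)" for x
      using that D(5)[of x] c M.l_neg by auto
  qed (use c D R.ring_axioms in \<open>auto simp: M.a_ac smult_l_distr smult_r_distr smult_assoc smult_one\<close>)
qed

lemma rename_module_simps:
  assumes "inj_on e (carrier M)"
  shows "carrier (rename_module e M) = e ` carrier M"
    and "\<zero>\<^bsub>rename_module e M\<^esub> = e \<zero>\<^bsub>M\<^esub>"
    and "s \<in> carrier M \<Longrightarrow> t \<in> carrier M \<Longrightarrow> e s \<oplus>\<^bsub>rename_module e M\<^esub> e t = e (s \<oplus>\<^bsub>M\<^esub> t)"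
    and "s \<in> carrier M \<Longrightarrow> a \<odot>\<^bsub>rename_module e M\<^esub> e s = e (a \<odot>\<^bsub>M\<^esub> s)"
  using assms by (simp_all add: rename_module_def Let_def)

lemma left_module_rename:
  assumes "left_module R M" and inj: "inj_on e (carrier M)"
  shows "left_module R (rename_module e M)"
proof -
  interpret left_module R M by fact
  note [simp] = rename_module_simps[OF inj] and [intro] = smult_closed
  show ?thesis
  proof (rule left_moduleI)
    show "\<exists>y\<in>carrier (rename_module e M). y \<oplus>\<^bsub>rename_module e M\<^esub> x = \<zero>\<^bsub>rename_module e M\<^esub>"
      if "x \<in> carrier (rename_module e M)" for x
    proof -
      obtain t where t: "x = e t" "t \<in> carrier M" using \<open>x \<in> _\<close> by auto
      then have "e (\<ominus>\<^bsub>M\<^esub> t) \<oplus>\<^bsub>rename_module e M\<^esub> x = \<zero>\<^bsub>rename_module e M\<^esub>" by (simp add: M.l_neg)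
      then show ?thesis using t by auto
    qed
  qed (use R.ring_axioms in \<open>auto simp: M.a_ac smult_closed smult_l_distr smult_r_distr smult_assoc smult_one\<close>)
qed

text \<open>Guarantees that the choice of a list in \<open>tensor_name\<close> succeeds for every
  nonempty coset.\<close>

lemma formal_sum_surj: "\<exists>l. formal_sum l = z"
proof -
  obtain ks where ks: "set ks = Poly_Mapping.keys z" "distinct ks"
    using finite_distinct_list[OF finite_keys[of z]] by metis
  have "formal_sum (map (\<lambda>k. (Poly_Mapping.lookup z k, k)) ks) =
    (\<Sum>k\<leftarrow>ks. frag_cmul (Poly_Mapping.lookup z k) (frag_of k))"
    by (simp add: formal_sum_def comp_def)
  also have "\<dots> = (\<Sum>k\<in>Poly_Mapping.keys z. frag_cmul (Poly_Mapping.lookup z k) (frag_of k))"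
    unfolding ks(1)[symmetric] by (rule sum_list_distinct_conv_sum_set[OF ks(2)])
  also have "\<dots> = z" unfolding frag_extend_def[symmetric] by (rule frag_expansion[symmetric])
  finally show ?thesis ..
qed

lemma left_linearD:
  assumes "left_linear R M N f"
  shows "x \<in> carrier M \<Longrightarrow> f x \<in> carrier N"
    "x \<in> carrier M \<Longrightarrow> y \<in> carrier M \<Longrightarrow> f (x \<oplus>\<^bsub>M\<^esub> y) = f x \<oplus>\<^bsub>N\<^esub> f y"
    "a \<in> carrier R \<Longrightarrow> x \<in> carrier M \<Longrightarrow> f (a \<odot>\<^bsub>M\<^esub> x) = a \<odot>\<^bsub>N\<^esub> f x"
  using assms by (auto simp: left_linear_def)

lemma left_linear_zero:
  assumes "left_module R M" "left_module R N" "left_linear R M N f"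
  shows "f \<zero>\<^bsub>M\<^esub> = \<zero>\<^bsub>N\<^esub>"
proof -
  interpret M: left_module R M by fact
  interpret N: left_module R N by fact
  show ?thesis
    using additive_zero[OF M.M.abelian_group_axioms N.M.abelian_group_axioms, of f]
      left_linearD[OF assms(3)] by auto
qed

lemma submodule_image:
  assumes "left_module R M" "left_module R N" and f: "left_linear R M N f" and H: "submodule H R M"
  shows "submodule (f ` H) R N"
proof -
  interpret M: left_module R M by fact
  interpret N: left_module R N by fact
  note D = M.submoduleD[OF H] and f' = left_linearD[OF f]
  have c: "t \<in> carrier M" if "t \<in> H" for t using D(1) that by auto
  show ?thesis
  proof (rule N.submoduleI)
    show "f ` H \<subseteq> carrier N" using c f'(1) by auto
    show "\<zero>\<^bsub>N\<^esub> \<in> f ` H" using left_linear_zero[OF assms(1-3)] D(2) by (metis imageI)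
    show "u \<oplus>\<^bsub>N\<^esub> v \<in> f ` H" if "u \<in> f ` H" "v \<in> f ` H" for u v
      using that c D(3) f'(2) by (auto simp: image_iff) (metis f'(2) c D(3))
    show "a \<odot>\<^bsub>N\<^esub> u \<in> f ` H" if "a \<in> carrier R" "u \<in> f ` H" for a u
      using that c D(4) by (auto simp: image_iff) (metis f'(3) c D(4))
  qed
qed


section \<open>Reflections of representations\<close>

text \<open>The invariant that inductions along admissible sequences carry from one reflection to
  the next; \<open>module_rep_N\<close> restores it after each step.\<close>

definition module_rep ::
  "('i, 'c, 'd, 'b) modulation \<Rightarrow> 'i rel \<Rightarrow> ('i, 'd, 'b, 'v) rep \<Rightarrow> bool"
  where "module_rep \<Gamma> \<Lambda> M \<longleftrightarrow>
    (\<forall>i. left_module (dring \<Gamma> i) (space M i)) \<and>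
    (\<forall>(i, j)\<in>\<Lambda>. left_linear (dring \<Gamma> j) (twisted \<Gamma> M j i) (space M j) (arr M i j))"

locale reflection =
  fixes \<Gamma> :: "('i :: finite, 'c, 'd, 'b) modulation" and \<Lambda> :: "'i rel" and x :: 'i
    and M :: "('i, 'd, 'b, ('i, 'b, 'v) vec) rep"
  assumes modulated: "modulated_graph \<Gamma>" and oriented: "orientation \<Gamma> \<Lambda>"
    and sink: "sink \<Lambda> x" and rep: "module_rep \<Gamma> \<Lambda> M"
begin

abbreviation "Y \<equiv> {y. (y, x) \<in> \<Lambda>}"
abbreviation "k \<equiv> dring \<Gamma>"
abbreviation "V \<equiv> space M"
abbreviation "T \<equiv> twisted \<Gamma> M x"
abbreviation "P \<equiv> incoming_sum \<Gamma> \<Lambda> x M"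
abbreviation "h \<equiv> incoming_map \<Lambda> x M"
abbreviation "K \<equiv> incoming_kernel \<Gamma> \<Lambda> x M"
abbreviation "N \<equiv> reflect \<Gamma> \<Lambda> x M"
abbreviation "\<Lambda>' \<equiv> reverse_at x \<Lambda>"
abbreviation "tsp y \<equiv> tensor.tspan (k y) (bimod \<Gamma> x y) (V y)"

lemma edge_bimodule: "edge \<Gamma> i j \<Longrightarrow> bimodule (k i) (k j) (bimod \<Gamma> i j)"
  using modulated by (simp add: modulated_graph_def)

lemma left_module_V: "left_module (k i) (V i)"
  using rep by (simp add: module_rep_def)

lemma arrow_linear: "(i, j) \<in> \<Lambda> \<Longrightarrow> left_linear (k j) (twisted \<Gamma> M j i) (V j) (arr M i j)"
  using rep by (auto simp: module_rep_def)

lemma arrow_edge: "(i, j) \<in> \<Lambda> \<Longrightarrow> edge \<Gamma> i j" "(i, j) \<in> \<Lambda> \<Longrightarrow> edge \<Gamma> j i"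
  using oriented by (auto simp: orientation_def)

lemma Y_neq: "y \<in> Y \<Longrightarrow> y \<noteq> x"
  using sink by (auto simp: sink_def)

lemma tensor_Y: "y \<in> Y \<Longrightarrow> tensor (k x) (k y) (bimod \<Gamma> x y) (V y)"
  by (intro tensor.intro edge_bimodule left_module_V) (auto dest: arrow_edge)

lemma left_module_twisted:
  assumes "(i, j) \<in> \<Lambda>"
  shows "left_module (k j) (twisted \<Gamma> M j i)"
proof -
  interpret t: tensor "k j" "k i" "bimod \<Gamma> j i" "V i"
    by (intro tensor.intro edge_bimodule left_module_V) (use assms in \<open>auto dest: arrow_edge\<close>)
  show ?thesis using t.left_module_T by (simp add: twisted_def)
qed

lemma left_module_TY: "y \<in> Y \<Longrightarrow> left_module (k x) (T y)"
  using left_module_twisted by simp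

lemma ring_k: "ring (k i)"
  using left_module_V[of i] by (simp add: left_module_def)

section \<open>The direct sum of the incoming tensor products and the map \<open>h\<close>\<close>

lemma P_simps:
  "carrier P = (\<Pi>\<^sub>E y\<in>Y. carrier (T y))" "\<zero>\<^bsub>P\<^esub> = (\<lambda>y\<in>Y. \<zero>\<^bsub>T y\<^esub>)"
  "s \<oplus>\<^bsub>P\<^esub> t = (\<lambda>y\<in>Y. s y \<oplus>\<^bsub>T y\<^esub> t y)" "a \<odot>\<^bsub>P\<^esub> t = (\<lambda>y\<in>Y. a \<odot>\<^bsub>T y\<^esub> t y)"
  by (simp_all add: incoming_sum_def Let_def)

lemma P_closed: "t \<in> carrier P \<Longrightarrow> y \<in> Y \<Longrightarrow> t y \<in> carrier (T y)"
  by (auto simp: P_simps)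

lemma P_eqI: "s \<in> carrier P \<Longrightarrow> t \<in> carrier P \<Longrightarrow> (\<And>y. y \<in> Y \<Longrightarrow> s y = t y) \<Longrightarrow> s = t"
  unfolding P_simps by (rule PiE_ext)

text \<open>The module \<open>T y\<close> changes with the index, so its laws are stated as rules
  conditional on \<open>y\<close>, ready for componentwise computation in \<open>P\<close>.\<close>

lemma TY_module_facts:
  assumes "y \<in> Y"
  shows "\<zero>\<^bsub>T y\<^esub> \<in> carrier (T y)"
    "s \<in> carrier (T y) \<Longrightarrow> t \<in> carrier (T y) \<Longrightarrow> s \<oplus>\<^bsub>T y\<^esub> t \<in> carrier (T y)"
    "s \<in> carrier (T y) \<Longrightarrow> t \<in> carrier (T y) \<Longrightarrow> u \<in> carrier (T y) \<Longrightarrow>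
      s \<oplus>\<^bsub>T y\<^esub> t \<oplus>\<^bsub>T y\<^esub> u = s \<oplus>\<^bsub>T y\<^esub> (t \<oplus>\<^bsub>T y\<^esub> u)"
    "s \<in> carrier (T y) \<Longrightarrow> t \<in> carrier (T y) \<Longrightarrow> s \<oplus>\<^bsub>T y\<^esub> t = t \<oplus>\<^bsub>T y\<^esub> s"
    "s \<in> carrier (T y) \<Longrightarrow> \<zero>\<^bsub>T y\<^esub> \<oplus>\<^bsub>T y\<^esub> s = s"
    "s \<in> carrier (T y) \<Longrightarrow> s \<oplus>\<^bsub>T y\<^esub> \<zero>\<^bsub>T y\<^esub> = s"
    "s \<in> carrier (T y) \<Longrightarrow> \<ominus>\<^bsub>T y\<^esub> s \<in> carrier (T y)"
    "s \<in> carrier (T y) \<Longrightarrow> \<ominus>\<^bsub>T y\<^esub> s \<oplus>\<^bsub>T y\<^esub> s = \<zero>\<^bsub>T y\<^esub>"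
    "a \<in> carrier (k x) \<Longrightarrow> s \<in> carrier (T y) \<Longrightarrow> a \<odot>\<^bsub>T y\<^esub> s \<in> carrier (T y)"
proof -
  interpret left_module "k x" "T y" using assms by (rule left_module_TY)
  show "\<zero>\<^bsub>T y\<^esub> \<in> carrier (T y)"
    "s \<in> carrier (T y) \<Longrightarrow> t \<in> carrier (T y) \<Longrightarrow> s \<oplus>\<^bsub>T y\<^esub> t \<in> carrier (T y)"
    "s \<in> carrier (T y) \<Longrightarrow> t \<in> carrier (T y) \<Longrightarrow> u \<in> carrier (T y) \<Longrightarrow>
      s \<oplus>\<^bsub>T y\<^esub> t \<oplus>\<^bsub>T y\<^esub> u = s \<oplus>\<^bsub>T y\<^esub> (t \<oplus>\<^bsub>T y\<^esub> u)"
    "s \<in> carrier (T y) \<Longrightarrow> t \<in> carrier (T y) \<Longrightarrow> s \<oplus>\<^bsub>T y\<^esub> t = t \<oplus>\<^bsub>T y\<^esub> s"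
    "s \<in> carrier (T y) \<Longrightarrow> \<zero>\<^bsub>T y\<^esub> \<oplus>\<^bsub>T y\<^esub> s = s"
    "s \<in> carrier (T y) \<Longrightarrow> s \<oplus>\<^bsub>T y\<^esub> \<zero>\<^bsub>T y\<^esub> = s"
    "s \<in> carrier (T y) \<Longrightarrow> \<ominus>\<^bsub>T y\<^esub> s \<in> carrier (T y)"
    "s \<in> carrier (T y) \<Longrightarrow> \<ominus>\<^bsub>T y\<^esub> s \<oplus>\<^bsub>T y\<^esub> s = \<zero>\<^bsub>T y\<^esub>"
    "a \<in> carrier (k x) \<Longrightarrow> s \<in> carrier (T y) \<Longrightarrow> a \<odot>\<^bsub>T y\<^esub> s \<in> carrier (T y)"
    by (simp_all add: smult_closed M.a_assoc M.l_neg) (simp add: M.a_comm)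
qed

lemma P_at:
  assumes "y \<in> Y"
  shows "\<zero>\<^bsub>P\<^esub> y = \<zero>\<^bsub>T y\<^esub>" "(s \<oplus>\<^bsub>P\<^esub> t) y = s y \<oplus>\<^bsub>T y\<^esub> t y" "(a \<odot>\<^bsub>P\<^esub> t) y = a \<odot>\<^bsub>T y\<^esub> t y"
  using assms by (simp_all add: P_simps)

lemma left_module_P: "left_module (k x) P"
proof (rule left_moduleI[OF ring_k])
  show zero: "\<zero>\<^bsub>P\<^esub> \<in> carrier P"
    unfolding P_simps by (rule restrict_PiE_iff[THEN iffD2]) (simp add: TY_module_facts(1))
  show add: "s \<oplus>\<^bsub>P\<^esub> t \<in> carrier P" if "s \<in> carrier P" "t \<in> carrier P" for s t
    using that[THEN P_closed] unfolding P_simps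
    by (intro restrict_PiE_iff[THEN iffD2]) (simp add: TY_module_facts(2))
  show smult: "a \<odot>\<^bsub>P\<^esub> t \<in> carrier P" if "a \<in> carrier (k x)" "t \<in> carrier P" for a t
    using that(1) P_closed[OF that(2)] unfolding P_simps
    by (intro restrict_PiE_iff[THEN iffD2]) (simp add: TY_module_facts(9))
  show "\<exists>s\<in>carrier P. s \<oplus>\<^bsub>P\<^esub> t = \<zero>\<^bsub>P\<^esub>" if t: "t \<in> carrier P" for t
  proof
    show n: "(\<lambda>y\<in>Y. \<ominus>\<^bsub>T y\<^esub> t y) \<in> carrier P"
      using P_closed[OF t] unfolding P_simps
      by (intro restrict_PiE_iff[THEN iffD2]) (simp add: TY_module_facts(7))
    show "(\<lambda>y\<in>Y. \<ominus>\<^bsub>T y\<^esub> t y) \<oplus>\<^bsub>P\<^esub> t = \<zero>\<^bsub>P\<^esub>"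
      by (rule P_eqI[OF add[OF n t] zero]) (simp add: P_at P_closed[OF t] TY_module_facts(8))
  qed
  show "(s \<oplus>\<^bsub>P\<^esub> t) \<oplus>\<^bsub>P\<^esub> u = s \<oplus>\<^bsub>P\<^esub> (t \<oplus>\<^bsub>P\<^esub> u)"
    if "s \<in> carrier P" "t \<in> carrier P" "u \<in> carrier P" for s t u
    by (rule P_eqI) (use that in \<open>simp_all add: add P_at TY_module_facts(3) P_closed\<close>)
  show "s \<oplus>\<^bsub>P\<^esub> t = t \<oplus>\<^bsub>P\<^esub> s" if "s \<in> carrier P" "t \<in> carrier P" for s t
    by (rule P_eqI) (use that in \<open>simp_all add: add P_at TY_module_facts(4) P_closed\<close>)
  show "\<zero>\<^bsub>P\<^esub> \<oplus>\<^bsub>P\<^esub> t = t" if "t \<in> carrier P" for t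
    by (rule P_eqI) (use that zero in \<open>simp_all add: add P_at TY_module_facts(5) P_closed\<close>)
  show "\<one>\<^bsub>k x\<^esub> \<odot>\<^bsub>P\<^esub> t = t" if "t \<in> carrier P" for t
    by (rule P_eqI)
      (use that ring.ring_simprules(6)[OF ring_k] in
        \<open>simp_all add: smult P_at left_module.smult_one[OF left_module_TY] P_closed\<close>)
  show "(a \<oplus>\<^bsub>k x\<^esub> b) \<odot>\<^bsub>P\<^esub> t = a \<odot>\<^bsub>P\<^esub> t \<oplus>\<^bsub>P\<^esub> b \<odot>\<^bsub>P\<^esub> t"
    if "a \<in> carrier (k x)" "b \<in> carrier (k x)" "t \<in> carrier P" for a b t
    by (rule P_eqI)
      (use that ring.ring_simprules(1)[OF ring_k] in
        \<open>simp_all add: smult add P_at left_module.smult_l_distr[OF left_module_TY] P_closed\<close>)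
  show "a \<odot>\<^bsub>P\<^esub> (s \<oplus>\<^bsub>P\<^esub> t) = a \<odot>\<^bsub>P\<^esub> s \<oplus>\<^bsub>P\<^esub> a \<odot>\<^bsub>P\<^esub> t"
    if "a \<in> carrier (k x)" "s \<in> carrier P" "t \<in> carrier P" for a s t
    by (rule P_eqI)
      (use that in \<open>simp_all add: smult add P_at left_module.smult_r_distr[OF left_module_TY] P_closed\<close>)
  show "(a \<otimes>\<^bsub>k x\<^esub> b) \<odot>\<^bsub>P\<^esub> t = a \<odot>\<^bsub>P\<^esub> (b \<odot>\<^bsub>P\<^esub> t)"
    if "a \<in> carrier (k x)" "b \<in> carrier (k x)" "t \<in> carrier P" for a b t
    by (rule P_eqI)
      (use that ring.ring_simprules(5)[OF ring_k] in
        \<open>simp_all add: smult P_at left_module.smult_assoc[OF left_module_TY] P_closed\<close>)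
qed

sublocale Vx: left_module "k x" "V x" by (rule left_module_V)
sublocale P: left_module "k x" P by (rule left_module_P)

lemma arr_closed: "y \<in> Y \<Longrightarrow> t \<in> carrier (T y) \<Longrightarrow> arr M y x t \<in> carrier (V x)"
  using left_linearD(1)[OF arrow_linear] by simp

lemma h_linear: "left_linear (k x) P (V x) h"
proof -
  have cl: "(\<lambda>y. arr M y x (t y)) \<in> Y \<rightarrow> carrier (V x)" if "t \<in> carrier P" for t
    using arr_closed P_closed[OF that] by auto
  have "h (s \<oplus>\<^bsub>P\<^esub> t) = h s \<oplus>\<^bsub>V x\<^esub> h t" if st: "s \<in> carrier P" "t \<in> carrier P" for s t
  proof -
    have "h (s \<oplus>\<^bsub>P\<^esub> t) = (\<Oplus>\<^bsub>V x\<^esub>y\<in>Y. arr M y x (s y) \<oplus>\<^bsub>V x\<^esub> arr M y x (t y))"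
      unfolding incoming_map_def
      by (rule Vx.M.finsum_cong')
        (use cl st P_closed[OF st(1)] P_closed[OF st(2)] left_linearD(2)[OF arrow_linear] arr_closed
          in \<open>auto simp: P_simps(3)\<close>)
    then show ?thesis
      using Vx.M.finsum_addf[OF cl[OF st(1)] cl[OF st(2)]] by (simp add: incoming_map_def)
  qed
  moreover have "h (a \<odot>\<^bsub>P\<^esub> t) = a \<odot>\<^bsub>V x\<^esub> h t" if at: "a \<in> carrier (k x)" "t \<in> carrier P" for a t
  proof -
    have "h (a \<odot>\<^bsub>P\<^esub> t) = (\<Oplus>\<^bsub>V x\<^esub>y\<in>Y. a \<odot>\<^bsub>V x\<^esub> arr M y x (t y))"
      unfolding incoming_map_def
      by (rule Vx.M.finsum_cong')
        (use at P_closed[OF at(2)] left_linearD(3)[OF arrow_linear] arr_closed Vx.smult_closed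
          in \<open>auto simp: P_simps(4)\<close>)
    then show ?thesis
      using Vx.smult_finsum[OF at(1) _ cl[OF at(2)]] by (simp add: incoming_map_def)
  qed
  moreover have "h t \<in> carrier (V x)" if "t \<in> carrier P" for t
    unfolding incoming_map_def using cl[OF that] by (rule Vx.M.finsum_closed)
  ultimately show ?thesis by (auto simp: left_linear_def)
qed

lemmas h_closed = left_linearD(1)[OF h_linear]
  and h_add = left_linearD(2)[OF h_linear]
  and h_smult = left_linearD(3)[OF h_linear]

lemma h_zero: "h \<zero>\<^bsub>P\<^esub> = \<zero>\<^bsub>V x\<^esub>"
  by (rule left_linear_zero[OF left_module_P left_module_V h_linear])

text \<open>Serves to realize the value of a single arrow into \<open>x\<close> as a value of
  \<open>h\<close>, so that suitable images under \<open>h\<close> absorb the arrows into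
  \<open>x\<close>.\<close>

definition single :: "'i \<Rightarrow> ('b, ('i, 'b, 'v) vec) tensor \<Rightarrow> 'i \<Rightarrow> ('b, ('i, 'b, 'v) vec) tensor"
  where "single y t = (\<lambda>z\<in>Y. if z = y then t else \<zero>\<^bsub>T z\<^esub>)"

lemma single_closed: "t \<in> carrier (T y) \<Longrightarrow> single y t \<in> carrier P"
  using TY_module_facts(1) by (auto simp: single_def P_simps)

lemma h_single:
  assumes y: "y \<in> Y" and t: "t \<in> carrier (T y)"
  shows "h (single y t) = arr M y x t"
proof -
  have z: "arr M z x \<zero>\<^bsub>T z\<^esub> = \<zero>\<^bsub>V x\<^esub>" if "z \<in> Y" for z
    by (rule left_linear_zero[OF left_module_TY[OF that] left_module_V arrow_linear]) (use that in simp)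
  have "h (single y t) = (\<Oplus>\<^bsub>V x\<^esub>z\<in>Y. if z = y then arr M y x t else \<zero>\<^bsub>V x\<^esub>)"
    unfolding incoming_map_def
    by (rule Vx.M.finsum_cong') (use z arr_closed[OF y t] in \<open>auto simp: single_def\<close>)
  also have "\<dots> = arr M y x t"
    using Vx.M.add.finprod_singleton_swap[OF y, of "\<lambda>_. arr M y x t"] arr_closed[OF y t] by auto
  finally show ?thesis .
qed

section \<open>The kernel and the reflected representation\<close>

lemma carrier_K: "carrier K = {t \<in> carrier P. h t = \<zero>\<^bsub>V x\<^esub>}"
  by (simp add: incoming_kernel_def)

lemma K_eq: "K = P\<lparr>carrier := carrier K\<rparr>"
  by (simp add: incoming_kernel_def)

lemma K_simps: "\<zero>\<^bsub>K\<^esub> = \<zero>\<^bsub>P\<^esub>" "s \<oplus>\<^bsub>K\<^esub> t = s \<oplus>\<^bsub>P\<^esub> t" "a \<odot>\<^bsub>K\<^esub> t = a \<odot>\<^bsub>P\<^esub> t"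
  by (simp_all add: incoming_kernel_def)

lemma submodule_K: "submodule (carrier K) (k x) P"
  by (rule P.submoduleI) (auto simp: carrier_K h_zero h_add h_smult P.smult_closed Vx.smult_zero_right)

lemma left_module_K: "left_module (k x) K"
  using P.left_module_submodule[OF submodule_K] K_eq by simp

text \<open>For every \<open>y\<close> in \<open>Y\<close> a name stores a list whose formal sum
  lies in the coset at \<open>y\<close>. Equal names thus give an element common to the two cosets,
  which are then equal.\<close>

lemma inj_name: "inj_on tensor_name (carrier P)"
proof (rule inj_onI)
  fix s t assume s: "s \<in> carrier P" and t: "t \<in> carrier P" and eq: "tensor_name s = tensor_name t"
  show "s = t"
  proof (rule P_eqI[OF s t])
    fix y assume y: "y \<in> Y"
    interpret t: tensor "k x" "k y" "bimod \<Gamma> x y" "V y" by (rule tensor_Y[OF y])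
    have ne: "\<exists>l. formal_sum l \<in> u" if u: "u \<in> carrier (T y)" for u
    proof -
      obtain z where "z \<in> u" using t.T_nonempty u by (auto simp: twisted_def)
      then show ?thesis using formal_sum_surj[of z] by blast
    qed
    let ?l = "SOME l. formal_sum l \<in> s y"
    have "?l = (SOME l. formal_sum l \<in> t y)"
      using eq unfolding tensor_name_def by (metis vec.inject(2))
    then have "formal_sum ?l \<in> s y" "formal_sum ?l \<in> t y"
      using someI_ex[OF ne[OF P_closed[OF s y]]] someI_ex[OF ne[OF P_closed[OF t y]]] by simp_all
    then show "s y = t y" using t.coset_eqD P_closed[OF s y] P_closed[OF t y] by (simp add: twisted_def)
  qed
qed

lemma inj_name_K: "inj_on tensor_name (carrier K)"
  using inj_name by (rule inj_on_subset) (auto simp: carrier_K)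

lemma space_N: "i \<noteq> x \<Longrightarrow> space N i = V i" "space N x = rename_module tensor_name K"
  by (simp_all add: reflect_def Let_def)

lemmas Nx_simps = rename_module_simps[OF inj_name_K, folded space_N(2), unfolded K_simps]

lemma left_module_N: "left_module (k i) (space N i)"
  using left_module_rename[OF left_module_K inj_name_K] left_module_V by (cases "i = x") (simp_all add: space_N)

lemma arr_N: "i \<noteq> x \<Longrightarrow> arr N i j = arr M i j"
  by (simp add: reflect_def Let_def)

lemma name_inv: "t \<in> carrier K \<Longrightarrow> inv_into (carrier K) tensor_name (tensor_name t) = t"
  using inj_name_K by (rule inv_into_f_f)

lemma pairing_dual:
  assumes "y \<in> Y" "b \<in> carrier (bimod \<Gamma> y x)"
  shows "pairing \<Gamma> x y b \<in> carrier (right_dual (k y) (bimod \<Gamma> x y))"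
proof -
  have "edge \<Gamma> x y" using assms arrow_edge by auto
  then have "bimodule_iso (k y) (k x) (bimod \<Gamma> y x) (right_dual (k y) (bimod \<Gamma> x y)) (pairing \<Gamma> x y)"
    using modulated by (simp add: modulated_graph_def)
  then show ?thesis using assms(2) by (auto simp: bimodule_iso_def left_linear_def)
qed

lemma pairing_simps:
  assumes y: "y \<in> Y" and b: "b \<in> carrier (bimod \<Gamma> y x)" and c: "c \<in> carrier (bimod \<Gamma> x y)"
  shows "b' \<in> carrier (bimod \<Gamma> y x) \<Longrightarrow>
      pairing \<Gamma> x y (b \<oplus>\<^bsub>bimod \<Gamma> y x\<^esub> b') c = pairing \<Gamma> x y b c \<oplus>\<^bsub>k y\<^esub> pairing \<Gamma> x y b' c"
    and "a \<in> carrier (k y) \<Longrightarrow> pairing \<Gamma> x y (a \<odot>\<^bsub>bimod \<Gamma> y x\<^esub> b) c = a \<otimes>\<^bsub>k y\<^esub> pairing \<Gamma> x y b c"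
    and "a' \<in> carrier (k x) \<Longrightarrow>
      pairing \<Gamma> x y (b \<odot>\<^sub>r\<^bsub>bimod \<Gamma> y x\<^esub> a') c = pairing \<Gamma> x y b (a' \<odot>\<^bsub>bimod \<Gamma> x y\<^esub> c)"
proof -
  have "edge \<Gamma> x y" using y arrow_edge by auto
  then have "bimodule_iso (k y) (k x) (bimod \<Gamma> y x) (right_dual (k y) (bimod \<Gamma> x y)) (pairing \<Gamma> x y)"
    using modulated by (simp add: modulated_graph_def)
  note iso = this[unfolded bimodule_iso_def left_linear_def]
  {
    assume "b' \<in> carrier (bimod \<Gamma> y x)"
    then have "pairing \<Gamma> x y (b \<oplus>\<^bsub>bimod \<Gamma> y x\<^esub> b') =
      pairing \<Gamma> x y b \<oplus>\<^bsub>right_dual (k y) (bimod \<Gamma> x y)\<^esub> pairing \<Gamma> x y b'" using iso b by blast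
    then show "pairing \<Gamma> x y (b \<oplus>\<^bsub>bimod \<Gamma> y x\<^esub> b') c = pairing \<Gamma> x y b c \<oplus>\<^bsub>k y\<^esub> pairing \<Gamma> x y b' c"
      using c by (simp add: right_dual_def)
  next
    assume "a \<in> carrier (k y)"
    then have "pairing \<Gamma> x y (a \<odot>\<^bsub>bimod \<Gamma> y x\<^esub> b) =
      a \<odot>\<^bsub>right_dual (k y) (bimod \<Gamma> x y)\<^esub> pairing \<Gamma> x y b" using iso b by blast
    then show "pairing \<Gamma> x y (a \<odot>\<^bsub>bimod \<Gamma> y x\<^esub> b) c = a \<otimes>\<^bsub>k y\<^esub> pairing \<Gamma> x y b c"
      using c by (simp add: right_dual_def)
  next
    assume "a' \<in> carrier (k x)"
    then have "pairing \<Gamma> x y (b \<odot>\<^sub>r\<^bsub>bimod \<Gamma> y x\<^esub> a') =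
      pairing \<Gamma> x y b \<odot>\<^sub>r\<^bsub>right_dual (k y) (bimod \<Gamma> x y)\<^esub> a'" using iso b by blast
    then show "pairing \<Gamma> x y (b \<odot>\<^sub>r\<^bsub>bimod \<Gamma> y x\<^esub> a') c = pairing \<Gamma> x y b (a' \<odot>\<^bsub>bimod \<Gamma> x y\<^esub> c)"
      using c by (simp add: right_dual_def)
  }
qed

text \<open>Of a kernel family \<open>t\<close> only the component \<open>t y\<close> matters,
  contracted with the functional \<open>pairing \<Gamma> x y b\<close>. Balancedness over
  \<open>k x\<close> and linearity over \<open>k y\<close> reflect the right and the left linearity
  of the bimodule map \<open>pairing \<Gamma> x y\<close>.\<close>

lemma
  assumes y: "y \<in> Y"
  shows reversed_arrow_pure: "b \<in> carrier (bimod \<Gamma> y x) \<Longrightarrow> t \<in> carrier K \<Longrightarrow>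
      arr N x y (pure_tensor (k x) (bimod \<Gamma> y x) (space N x) b (tensor_name t)) =
      tensor.contract (V y) (pairing \<Gamma> x y b) (t y)"
    and reversed_arrow_linear: "left_linear (k y) (twisted \<Gamma> N y x) (space N y) (arr N x y)"
proof -
  interpret t: tensor "k x" "k y" "bimod \<Gamma> x y" "V y" by (rule tensor_Y[OF y])
  interpret s: tensor "k y" "k x" "bimod \<Gamma> y x" "space N x"
    by (intro tensor.intro edge_bimodule left_module_N) (use y arrow_edge in auto)
  have T: "T y = tensor_product (k y) (bimod \<Gamma> x y) (V y)" by (simp add: twisted_def)
  define \<beta> where "\<beta> b w = t.contract (pairing \<Gamma> x y b) (inv_into (carrier K) tensor_name w y)" for b w
  have arr: "arr N x y = tensor_lift (V y) \<beta>"
    by (simp add: reflect_def Let_def \<beta>_def[abs_def] t.contract_def)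
  have \<beta>: "\<beta> b (tensor_name t) = t.contract (pairing \<Gamma> x y b) (t y)" if "t \<in> carrier K" for b t
    by (simp add: \<beta>_def name_inv[OF that])
  have ty: "t y \<in> carrier (tensor_product (k y) (bimod \<Gamma> x y) (V y))" if "t \<in> carrier K" for t
    using that P_closed[OF _ y] unfolding T carrier_K by blast
  note pd = pairing_dual[OF y]
  have "submodule (carrier K) (k x) P" by (rule submodule_K)
  note KD = P.submoduleD[OF this]
  have bal: "balanced (k x) (bimod \<Gamma> y x) (space N x) (V y) \<beta>"
    unfolding balanced_def
  proof (intro conjI ballI; (unfold Nx_simps(1), elim imageE, clarify)?)
    fix b t assume b: "b \<in> carrier (bimod \<Gamma> y x)" and t: "t \<in> carrier K"
    show "\<beta> b (tensor_name t) \<in> carrier (V y)" unfolding \<beta>[OF t]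
      by (rule t.contract_closed[OF pd[OF b] ty[OF t]])
    fix b' assume b': "b' \<in> carrier (bimod \<Gamma> y x)"
    show "\<beta> (b \<oplus>\<^bsub>bimod \<Gamma> y x\<^esub> b') (tensor_name t) =
      \<beta> b (tensor_name t) \<oplus>\<^bsub>V y\<^esub> \<beta> b' (tensor_name t)"
      unfolding \<beta>[OF t]
      by (rule t.contract_functional_add[OF pd[OF b] pd[OF b'] pd _ ty[OF t]])
        (use b b' pairing_simps(1)[OF y] in auto)
  next
    fix b s t assume b: "b \<in> carrier (bimod \<Gamma> y x)" and s: "s \<in> carrier K" and t: "t \<in> carrier K"
    show "\<beta> b (tensor_name s \<oplus>\<^bsub>space N x\<^esub> tensor_name t) =
      \<beta> b (tensor_name s) \<oplus>\<^bsub>V y\<^esub> \<beta> b (tensor_name t)"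
      unfolding Nx_simps(3)[OF s t] \<beta>[OF s] \<beta>[OF t] \<beta>[OF KD(3)[OF s t]]
      using t.contract_add[OF pd[OF b] ty[OF s] ty[OF t]] y by (simp add: P_simps(3) T)
  next
    fix b a t assume b: "b \<in> carrier (bimod \<Gamma> y x)" and a: "a \<in> carrier (k x)" and t: "t \<in> carrier K"
    have "t.contract (pairing \<Gamma> x y (b \<odot>\<^sub>r\<^bsub>bimod \<Gamma> y x\<^esub> a)) (t y) =
      t.contract (pairing \<Gamma> x y b) (a \<odot>\<^bsub>T y\<^esub> t y)" unfolding T
      by (rule t.contract_functional_rsmult[OF pd[OF b] a pd _ ty[OF t]])
        (use a b pairing_simps(3)[OF y] s.B.rsmult_closed in auto)
    then show "\<beta> (b \<odot>\<^sub>r\<^bsub>bimod \<Gamma> y x\<^esub> a) (tensor_name t) = \<beta> b (a \<odot>\<^bsub>space N x\<^esub> tensor_name t)"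
      unfolding Nx_simps(4)[OF t] \<beta>[OF t] \<beta>[OF KD(4)[OF a t]] using y by (simp add: P_simps(4))
  qed
  note lift = s.lift_pure[OF t.V.M.abelian_group_axioms bal]
    s.lift_closed[OF t.V.M.abelian_group_axioms bal] s.lift_add[OF t.V.M.abelian_group_axioms bal]
  show pure: "arr N x y (pure_tensor (k x) (bimod \<Gamma> y x) (space N x) b (tensor_name t)) =
      t.contract (pairing \<Gamma> x y b) (t y)" if "b \<in> carrier (bimod \<Gamma> y x)" "t \<in> carrier K" for b t
    unfolding arr using lift(1)[OF that(1), of "tensor_name t"] that(2) \<beta>[OF that(2)] by (simp add: Nx_simps(1))
  have zero: "tensor_lift (V y) \<beta> \<zero>\<^bsub>s.T\<^esub> = \<zero>\<^bsub>V y\<^esub>"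
    using additive_zero[OF s.abelian_group_T t.V.M.abelian_group_axioms, of "tensor_lift (V y) \<beta>"] lift(2,3)
    by auto
  have "tensor_lift (V y) \<beta> (a \<odot>\<^bsub>s.T\<^esub> u) = a \<odot>\<^bsub>V y\<^esub> tensor_lift (V y) \<beta> u"
    if a: "a \<in> carrier (k y)" and u: "u \<in> carrier s.T" for a u
    using u
  proof (induction rule: s.T_induct)
    case zero
    then show ?case using a by (simp add: s.T.smult_zero_right t.V.smult_zero_right \<open>tensor_lift _ _ _ = _\<close>)
  next
    case (pure b w)
    then obtain t where t: "w = tensor_name t" "t \<in> carrier K" by (auto simp: Nx_simps(1))
    have "t.contract (pairing \<Gamma> x y (a \<odot>\<^bsub>bimod \<Gamma> y x\<^esub> b)) (t y) =
      a \<odot>\<^bsub>V y\<^esub> t.contract (pairing \<Gamma> x y b) (t y)"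
      by (rule t.contract_functional_smult[OF pd[OF pure(1)] a pd _ ty[OF t(2)]])
        (use a pure pairing_simps(2)[OF y] s.B.smult_closed in auto)
    then show ?case using pure a s.B.smult_closed by (simp add: s.smult_pure lift(1) t \<beta>)
  next
    case (add u v)
    then show ?case using a by (simp add: s.T.smult_r_distr s.T.smult_closed lift t.V.smult_r_distr)
  qed
  then show "left_linear (k y) (twisted \<Gamma> N y x) (space N y) (arr N x y)"
    using lift(2,3) y Y_neq by (auto simp: left_linear_def twisted_def arr space_N)
qed

lemma module_rep_N: "module_rep \<Gamma> \<Lambda>' N"
  unfolding module_rep_def
proof (intro conjI allI ballI left_module_N, clarify)
  fix i j assume ij: "(i, j) \<in> \<Lambda>'"
  show "left_linear (k j) (twisted \<Gamma> N j i) (space N j) (arr N i j)"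
  proof (cases "i = x")
    case True
    then have "j \<in> Y" using ij sink by (auto simp: reverse_at_def sink_def)
    then show ?thesis using reversed_arrow_linear True by simp
  next
    case False
    then have "j \<noteq> x" "(i, j) \<in> \<Lambda>" using ij sink by (auto simp: reverse_at_def sink_def)
    then show ?thesis using arrow_linear False by (simp add: space_N arr_N twisted_def)
  qed
qed

text \<open>Tensor products with zero spaces vanish, so the whole domain of \<open>h\<close> is
  zero.\<close>

lemma kernel_trivial:
  assumes "\<And>y. y \<in> Y \<Longrightarrow> carrier (V y) = {\<zero>\<^bsub>V y\<^esub>}"
  shows "carrier (space N x) = {\<zero>\<^bsub>space N x\<^esub>}"
proof -
  have ty: "t y = \<zero>\<^bsub>T y\<^esub>" if y: "y \<in> Y" and t: "t \<in> carrier P" for t y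
  proof -
    interpret t: tensor "k x" "k y" "bimod \<Gamma> x y" "V y" by (rule tensor_Y[OF y])
    have "t y \<in> carrier (tensor_product (k y) (bimod \<Gamma> x y) (V y))"
      using P_closed[OF t y] by (simp add: twisted_def)
    then show ?thesis
      unfolding twisted_def
      by (induction rule: t.T_induct) (use assms[OF y] in \<open>auto simp: t.pure_zero_right\<close>)
  qed
  have "t = \<zero>\<^bsub>P\<^esub>" if "t \<in> carrier P" for t
    by (rule P_eqI[OF that P.zero_closed]) (use that ty in \<open>auto simp: P_at\<close>)
  then have "carrier K = {\<zero>\<^bsub>P\<^esub>}" using h_zero P.zero_closed unfolding carrier_K by blast
  then show ?thesis by (simp add: Nx_simps)
qed

lemma zero_rep_reflect: "zero_rep M \<Longrightarrow> zero_rep N"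
  unfolding zero_rep_def using kernel_trivial space_N(1) by metis

end


section \<open>Transporting decompositions of the reflected representation back to
  \<open>M\<close>\<close>

context reflection
begin

text \<open>
  If \<open>h\<close> is onto and \<open>W\<close> is a direct summand of the reflected representation, \<open>unreflect W\<close> is the
  summand of \<open>M\<close> that it comes from.
\<close>

definition family_sum :: "('i \<Rightarrow> ('i, 'b, 'v) vec set) \<Rightarrow> ('i \<Rightarrow> ('b, ('i, 'b, 'v) vec) tensor) set"
  where "family_sum W = {t \<in> carrier P. \<forall>y\<in>Y. t y \<in> tsp y (W y)}"

definition unreflect :: "('i \<Rightarrow> ('i, 'b, 'v) vec set) \<Rightarrow> 'i \<Rightarrow> ('i, 'b, 'v) vec set"
  where "unreflect W i = (if i = x then h ` family_sum W else W i)"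

lemma submodule_family_sum:
  assumes "\<And>y. y \<in> Y \<Longrightarrow> submodule (W y) (k y) (V y)"
  shows "submodule (family_sum W) (k x) P"
proof -
  have U: "submodule (tsp y (W y)) (k x) (T y)" if "y \<in> Y" for y
  proof -
    interpret t: tensor "k x" "k y" "bimod \<Gamma> x y" "V y" by (rule tensor_Y[OF that])
    show ?thesis using t.submodule_span[OF t.V.submoduleD(1)[OF assms[OF that]]] by (simp add: twisted_def)
  qed
  note D = left_module.submoduleD[OF left_module_TY U]
  show ?thesis
  proof (rule P.submoduleI)
    show "\<zero>\<^bsub>P\<^esub> \<in> family_sum W" using D(2) by (simp add: family_sum_def P_at)
    show "s \<oplus>\<^bsub>P\<^esub> t \<in> family_sum W" if "s \<in> family_sum W" "t \<in> family_sum W" for s t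
      using that D(3) by (simp add: family_sum_def P_at)
    show "a \<odot>\<^bsub>P\<^esub> t \<in> family_sum W" if "a \<in> carrier (k x)" "t \<in> family_sum W" for a t
      using that D(4) by (simp add: family_sum_def P_at P.smult_closed)
  qed (auto simp: family_sum_def)
qed

text \<open>Componentwise from \<open>span_direct_sum\<close>; the decompositions of all entries of
  a family are chosen simultaneously.\<close>

lemma family_sum_direct:
  assumes W: "\<And>y. y \<in> Y \<Longrightarrow> internal_direct_sum (k y) (V y) (W y) (W' y)"
  shows "internal_direct_sum (k x) P (family_sum W) (family_sum W')"
proof -
  have ds: "internal_direct_sum (k x) (T y) (tsp y (W y)) (tsp y (W' y))" if "y \<in> Y" for y
  proof -
    interpret t: tensor "k x" "k y" "bimod \<Gamma> x y" "V y" by (rule tensor_Y[OF that])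
    show ?thesis using t.span_direct_sum[OF W[OF that]] by (simp add: twisted_def)
  qed
  have sub: "submodule (tsp y (W y)) (k x) (T y)" "submodule (tsp y (W' y)) (k x) (T y)" if "y \<in> Y" for y
    using ds[OF that] by (auto simp: internal_direct_sum_def)
  have fs: "submodule (family_sum W) (k x) P" "submodule (family_sum W') (k x) P"
    using W by (auto intro!: submodule_family_sum simp: internal_direct_sum_def)
  have inter: "family_sum W \<inter> family_sum W' = {\<zero>\<^bsub>P\<^esub>}"
  proof -
    have "t = \<zero>\<^bsub>P\<^esub>" if t: "t \<in> family_sum W" "t \<in> family_sum W'" for t
    proof (rule P_eqI)
      show "t y = \<zero>\<^bsub>P\<^esub> y" if "y \<in> Y" for y
      proof -
        have "t y \<in> tsp y (W y) \<inter> tsp y (W' y)" using t \<open>y \<in> Y\<close> by (simp add: family_sum_def)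
        then show ?thesis using ds[OF \<open>y \<in> Y\<close>] P_at(1)[OF \<open>y \<in> Y\<close>] by (auto simp: internal_direct_sum_def)
      qed
    qed (use t in \<open>auto simp: family_sum_def\<close>)
    moreover have "\<zero>\<^bsub>P\<^esub> \<in> family_sum W" "\<zero>\<^bsub>P\<^esub> \<in> family_sum W'"
      using P.submoduleD(2)[OF fs(1)] P.submoduleD(2)[OF fs(2)] by auto
    ultimately show ?thesis by blast
  qed
  have "t \<in> family_sum W <+>\<^bsub>P\<^esub> family_sum W'" if t: "t \<in> carrier P" for t
  proof -
    have "\<exists>u. \<exists>u'. u \<in> tsp y (W y) \<and> u' \<in> tsp y (W' y) \<and> t y = u \<oplus>\<^bsub>T y\<^esub> u'" if y: "y \<in> Y" for y
    proof -
      have "t y \<in> tsp y (W y) <+>\<^bsub>T y\<^esub> tsp y (W' y)"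
        using ds[OF y] P_closed[OF t y] by (simp add: internal_direct_sum_def)
      then show ?thesis unfolding set_add_iff by blast
    qed
    then obtain u u' where u: "\<And>y. y \<in> Y \<Longrightarrow> u y \<in> tsp y (W y) \<and> u' y \<in> tsp y (W' y) \<and> t y = u y \<oplus>\<^bsub>T y\<^esub> u' y"
      by metis
    have c: "u y \<in> carrier (T y)" "u' y \<in> carrier (T y)" if "y \<in> Y" for y
      using u[OF that] left_module.submoduleD(1)[OF left_module_TY[OF that]] sub[OF that] by auto
    have r: "restrict u Y \<in> carrier P" "restrict u' Y \<in> carrier P"
      using c unfolding P_simps restrict_PiE_iff by auto
    then have "restrict u Y \<in> family_sum W" "restrict u' Y \<in> family_sum W'"
      using u by (auto simp: family_sum_def)
    moreover have "t = restrict u Y \<oplus>\<^bsub>P\<^esub> restrict u' Y"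
      by (rule P_eqI) (use t r u in \<open>auto simp: P_at\<close>)
    ultimately show ?thesis unfolding set_add_iff by blast
  qed
  moreover have "family_sum W <+>\<^bsub>P\<^esub> family_sum W' \<subseteq> carrier P"
    by (auto simp: set_add_iff family_sum_def)
  ultimately show ?thesis
    unfolding internal_direct_sum_def using fs inter by blast
qed

lemma subrep_submodule_V:
  assumes "subrepresentation \<Gamma> \<Lambda>' N W" "i \<noteq> x"
  shows "submodule (W i) (k i) (V i)"
proof -
  have "submodule (W i) (k i) (space N i)" using assms(1) unfolding subrepresentation_def by blast
  then show ?thesis by (simp add: space_N(1)[OF assms(2)])
qed

text \<open>
  The images of \<open>t\<close> under the reversed arrows are its contractions with all right linear functionals,
  and a tensor lies in a span as soon as its contractions with a dual basis lie in the subspace.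
\<close>

lemma subrep_kernel_in_family_sum:
  assumes W: "subrepresentation \<Gamma> \<Lambda>' N W" and t: "t \<in> carrier K" "tensor_name t \<in> W x"
  shows "t \<in> family_sum W"
proof -
  have tP: "t \<in> carrier P" using t by (simp add: carrier_K)
  moreover have "t y \<in> tsp y (W y)" if y: "y \<in> Y" for y
  proof -
    have yx: "y \<noteq> x" by (rule Y_neq[OF y])
    interpret t: tensor "k x" "k y" "bimod \<Gamma> x y" "V y" by (rule tensor_Y[OF y])
    have e: "edge \<Gamma> x y" "edge \<Gamma> y x" using y arrow_edge by auto
    obtain X \<phi> where X: "is_basis (k y) (bimod \<Gamma> y x) X"
      and \<phi>: "bimodule_iso (k x) (k y) (bimod \<Gamma> x y) (left_dual (k y) (bimod \<Gamma> y x)) \<phi>"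
      using modulated e unfolding modulated_graph_def has_dim_def by blast
    obtain e \<theta> where dual: "\<And>m. m \<in> X \<Longrightarrow> e m \<in> carrier (bimod \<Gamma> x y)"
      "\<And>m. m \<in> X \<Longrightarrow> \<theta> m \<in> carrier (right_dual (k y) (bimod \<Gamma> x y))"
      "\<And>b. b \<in> carrier (bimod \<Gamma> x y) \<Longrightarrow>
        b = (\<Oplus>\<^bsub>bimod \<Gamma> x y\<^esub>m\<in>X. e m \<odot>\<^sub>r\<^bsub>bimod \<Gamma> x y\<^esub> \<theta> m b)"
      using right_dual_basis[OF edge_bimodule[OF \<open>edge \<Gamma> x y\<close>] edge_bimodule[OF \<open>edge \<Gamma> y x\<close>] X \<phi>]
      by blast
    have con: "t.contract (\<theta> m) (t y) \<in> W y" if m: "m \<in> X" for m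
    proof -
      \<comment> \<open>Every right linear functional has the form
        \<open>pairing \<Gamma> x y b\<close>. So contracting with \<open>\<theta> m\<close> means
        applying the reversed arrow to the pure tensor of some \<open>b\<close> with the name of
        \<open>t\<close>, and \<open>W\<close> is closed under that.\<close>
      have "bimodule_iso (k y) (k x) (bimod \<Gamma> y x) (right_dual (k y) (bimod \<Gamma> x y)) (pairing \<Gamma> x y)"
        using modulated \<open>edge \<Gamma> x y\<close> by (simp add: modulated_graph_def)
      then obtain b where b: "b \<in> carrier (bimod \<Gamma> y x)" "pairing \<Gamma> x y b = \<theta> m"
        using dual(2)[OF m] unfolding bimodule_iso_def bij_betw_def by (metis imageE)
      have "(x, y) \<in> \<Lambda>'" using y by (auto simp: reverse_at_def)
      then have "arr N x y (pure_tensor (k x) (bimod \<Gamma> y x) (space N x) b (tensor_name t)) \<in> W y"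
        using W b(1) t(2) unfolding subrepresentation_def by blast
      then show ?thesis using reversed_arrow_pure[OF y b(1) t(1)] b(2) by simp
    qed
    show ?thesis
      using t.in_span_if_contractions[OF _ dual subrep_submodule_V[OF W yx] _ con] X P_closed[OF tP y]
      by (simp add: is_basis_def twisted_def)
  qed
  ultimately show ?thesis by (simp add: family_sum_def)
qed

text \<open>The value of an arrow from \<open>i\<close> to \<open>x\<close> at the pure tensor of
  \<open>b\<close> and \<open>u\<close> is \<open>h\<close> of the family concentrated at
  \<open>i\<close>, which lies in \<open>family_sum W\<close>. All other arrows of
  \<open>\<Lambda>\<close> avoid the sink \<open>x\<close> and are shared with the reflected
  representation.\<close>

lemma subrepresentation_unreflect:
  assumes W: "subrepresentation \<Gamma> \<Lambda>' N W"
  shows "subrepresentation \<Gamma> \<Lambda> M (unreflect W)"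
  unfolding subrepresentation_def
proof (intro conjI allI ballI, goal_cases)
  case (1 i)
  have "submodule (h ` family_sum W) (k x) (V x)"
    by (rule submodule_image[OF left_module_P left_module_V h_linear submodule_family_sum])
      (use subrep_submodule_V[OF W] Y_neq in auto)
  then show ?case using subrep_submodule_V[OF W] by (auto simp: unreflect_def)
next
  case (2 p)
  obtain i j where p: "p = (i, j)" "(i, j) \<in> \<Lambda>" using 2 by (cases p) auto
  then have ix: "i \<noteq> x" using sink by (auto simp: sink_def)
  have "arr M i j (pure_tensor (k i) (bimod \<Gamma> j i) (V i) b u) \<in> unreflect W j"
    if b: "b \<in> carrier (bimod \<Gamma> j i)" and u: "u \<in> unreflect W i" for b u
  proof (cases "j = x")
    case True
    then have y: "i \<in> Y" using p by simp
    interpret t: tensor "k x" "k i" "bimod \<Gamma> x i" "V i" by (rule tensor_Y[OF y])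
    let ?t = "pure_tensor (k i) (bimod \<Gamma> x i) (V i) b u"
    have u: "u \<in> W i" using u ix by (simp add: unreflect_def)
    then have "?t \<in> tsp i (W i)" using b True t.tspan.pure by simp
    moreover have "\<zero>\<^bsub>T z\<^esub> \<in> tsp z (W z)" if "z \<in> Y" for z
    proof -
      interpret z: tensor "k x" "k z" "bimod \<Gamma> x z" "V z" by (rule tensor_Y[OF that])
      show ?thesis using z.tspan.zero by (simp add: twisted_def)
    qed
    moreover have tc: "?t \<in> carrier (T i)"
      using b True u t.V.submoduleD(1)[OF subrep_submodule_V[OF W ix]] by (auto simp: twisted_def)
    ultimately have "single i ?t \<in> family_sum W"
      using single_closed[OF tc] by (auto simp: family_sum_def single_def)
    then show ?thesis using h_single[OF y tc] True by (auto simp: unreflect_def intro!: image_eqI)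
  next
    case False
    then have "(i, j) \<in> \<Lambda>'" using p ix by (auto simp: reverse_at_def)
    then have "arr N i j (pure_tensor (k i) (bimod \<Gamma> j i) (space N i) b u) \<in> W j"
      using W b u ix unfolding subrepresentation_def unreflect_def by auto
    then show ?thesis using False ix by (simp add: unreflect_def arr_N space_N)
  qed
  then show ?case using p by auto
qed

text \<open>At \<open>x\<close>, surjectivity of \<open>h\<close> takes care of the sum. If
  \<open>h s = h s'\<close> with \<open>s\<close> and \<open>s'\<close> in the two family sums, then
  their difference lies in the kernel, where it splits as \<open>u + u'\<close> with both summands
  in the kernel and in the respective family sums. Comparing components in the direct sum
  \<open>P\<close> gives \<open>s = u\<close>, so \<open>h s\<close> is zero.\<close>

lemma unreflect_direct:
  assumes W: "subrepresentation \<Gamma> \<Lambda>' N W" and W': "subrepresentation \<Gamma> \<Lambda>' N W'"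
    and ds: "\<And>i. W i <+>\<^bsub>space N i\<^esub> W' i = carrier (space N i) \<and> W i \<inter> W' i = {\<zero>\<^bsub>space N i\<^esub>}"
    and surj: "h ` carrier P = carrier (V x)"
  shows "unreflect W i <+>\<^bsub>V i\<^esub> unreflect W' i = carrier (V i) \<and>
    unreflect W i \<inter> unreflect W' i = {\<zero>\<^bsub>V i\<^esub>}"
proof (cases "i = x")
  case False
  then show ?thesis using ds[of i] by (simp add: unreflect_def space_N)
next
  case True
  have "internal_direct_sum (k y) (V y) (W y) (W' y)" if "y \<in> Y" for y
    using Y_neq[OF that] ds[of y] subrep_submodule_V[OF W] subrep_submodule_V[OF W']
    by (simp add: internal_direct_sum_def space_N)
  then have dsP: "internal_direct_sum (k x) P (family_sum W) (family_sum W')"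
    by (rule family_sum_direct)
  then have sub: "submodule (family_sum W) (k x) P" "submodule (family_sum W') (k x) P"
    and sum: "family_sum W <+>\<^bsub>P\<^esub> family_sum W' = carrier P"
    and disj: "family_sum W \<inter> family_sum W' = {\<zero>\<^bsub>P\<^esub>}" by (auto simp: internal_direct_sum_def)
  note D = P.submoduleD[OF sub(1)] and D' = P.submoduleD[OF sub(2)]
  have c: "t \<in> family_sum W \<Longrightarrow> t \<in> carrier P" "t \<in> family_sum W' \<Longrightarrow> t \<in> carrier P" for t
    by (auto simp: family_sum_def)
  have "v \<in> h ` family_sum W <+>\<^bsub>V x\<^esub> h ` family_sum W'" if v: "v \<in> carrier (V x)" for v
  proof -
    obtain t where t: "v = h t" "t \<in> carrier P" using v surj by blast
    then have "t \<in> family_sum W <+>\<^bsub>P\<^esub> family_sum W'" using sum by simp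
    then obtain u u' where "u \<in> family_sum W" "u' \<in> family_sum W'" "t = u \<oplus>\<^bsub>P\<^esub> u'"
      unfolding set_add_iff by blast
    moreover from this have "v = h u \<oplus>\<^bsub>V x\<^esub> h u'" using t h_add[OF c] by simp
    ultimately show ?thesis unfolding set_add_iff by blast
  qed
  moreover have "h ` family_sum W <+>\<^bsub>V x\<^esub> h ` family_sum W' \<subseteq> carrier (V x)"
    using h_closed c by (auto simp: set_add_iff)
  moreover have "v = \<zero>\<^bsub>V x\<^esub>" if v: "v \<in> h ` family_sum W" "v \<in> h ` family_sum W'" for v
  proof -
    obtain s s' where s: "s \<in> family_sum W" "v = h s" "s' \<in> family_sum W'" "v = h s'" using v by blast
    have sc: "s \<in> carrier P" "s' \<in> carrier P" using s c by auto
    have "h (s \<ominus>\<^bsub>P\<^esub> s') = h s \<oplus>\<^bsub>V x\<^esub> \<ominus>\<^bsub>V x\<^esub> h s'"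
      using sc additive_minus[OF P.M.abelian_group_axioms Vx.M.abelian_group_axioms, of h s'] h_closed h_add
      by (auto simp: P.M.minus_eq)
    also have "\<dots> = \<zero>\<^bsub>V x\<^esub>" using s h_closed[OF sc(1)] by (simp add: Vx.M.r_neg)
    finally have kK: "s \<ominus>\<^bsub>P\<^esub> s' \<in> carrier K" using sc by (simp add: carrier_K)
    then have "tensor_name (s \<ominus>\<^bsub>P\<^esub> s') \<in> W x <+>\<^bsub>space N x\<^esub> W' x"
      using ds[of x] by (simp add: Nx_simps(1))
    then obtain w w' where w: "w \<in> W x" "w' \<in> W' x" "tensor_name (s \<ominus>\<^bsub>P\<^esub> s') = w \<oplus>\<^bsub>space N x\<^esub> w'"
      unfolding set_add_iff by blast
    have "W x \<subseteq> carrier (space N x)" "W' x \<subseteq> carrier (space N x)"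
      using W W' left_module.submoduleD(1)[OF left_module_N] unfolding subrepresentation_def by blast+
    then have "w \<in> tensor_name ` carrier K" "w' \<in> tensor_name ` carrier K"
      using w(1,2) unfolding Nx_simps(1) by blast+
    then obtain u u' where u: "w = tensor_name u" "u \<in> carrier K" "w' = tensor_name u'" "u' \<in> carrier K"
      unfolding image_iff by blast
    have uW: "u \<in> family_sum W" "u' \<in> family_sum W'"
      using subrep_kernel_in_family_sum[OF W u(2)] subrep_kernel_in_family_sum[OF W' u(4)]
        w(1,2) unfolding u(1,3) by blast+
    have "tensor_name (s \<ominus>\<^bsub>P\<^esub> s') = tensor_name (u \<oplus>\<^bsub>P\<^esub> u')"
      using w(3) unfolding u(1,3) Nx_simps(3)[OF u(2,4)] .
    moreover have "u \<oplus>\<^bsub>P\<^esub> u' \<in> carrier K" using P.submoduleD(3)[OF submodule_K] u by simp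
    ultimately have eq: "s \<ominus>\<^bsub>P\<^esub> s' = u \<oplus>\<^bsub>P\<^esub> u'" using inj_name_K kK by (auto simp: inj_on_def)
    have uc: "u \<in> carrier P" "u' \<in> carrier P" using uW c by auto
    \<comment> \<open>Both ends of this chain decompose \<open>s\<close> along the two family sums,
      the first with zero as second component; the first components must agree.\<close>
    have "s \<oplus>\<^bsub>P\<^esub> \<zero>\<^bsub>P\<^esub> = (s \<ominus>\<^bsub>P\<^esub> s') \<oplus>\<^bsub>P\<^esub> s'"
      using sc by (simp add: P.M.minus_eq P.M.a_assoc P.M.l_neg)
    also have "\<dots> = u \<oplus>\<^bsub>P\<^esub> (u' \<oplus>\<^bsub>P\<^esub> s')" using eq uc sc by (simp add: P.M.a_assoc)
    finally have "s = u"
      using P.direct_sum_unique(1)[OF sub disj s(1) D'(2) uW(1) D'(3)[OF uW(2) s(3)]] by simp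
    then show ?thesis using s u by (simp add: carrier_K)
  qed
  moreover have "\<zero>\<^bsub>V x\<^esub> \<in> h ` family_sum W" "\<zero>\<^bsub>V x\<^esub> \<in> h ` family_sum W'"
    using h_zero D(2) D'(2) by (metis imageI)+
  ultimately have "h ` family_sum W <+>\<^bsub>V x\<^esub> h ` family_sum W' = carrier (V x)"
    "h ` family_sum W \<inter> h ` family_sum W' = {\<zero>\<^bsub>V x\<^esub>}" by blast+
  then show ?thesis using True by (simp add: unreflect_def)
qed

text \<open>Trivial parts at the vertices other than \<open>x\<close> leave only zero in
  \<open>family_sum W\<close>, and the part at \<open>x\<close> consists of names of families in
  it.\<close>

lemma unreflect_zero:
  assumes W: "subrepresentation \<Gamma> \<Lambda>' N W" and zero: "\<And>i. unreflect W i = {\<zero>\<^bsub>V i\<^esub>}"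
  shows "W i = {\<zero>\<^bsub>space N i\<^esub>}"
proof (cases "i = x")
  case False
  then show ?thesis using zero[of i] by (simp add: unreflect_def space_N)
next
  case True
  have "t = \<zero>\<^bsub>P\<^esub>" if "t \<in> family_sum W" for t
  proof (rule P_eqI)
    show "t y = \<zero>\<^bsub>P\<^esub> y" if y: "y \<in> Y" for y
    proof -
      interpret t: tensor "k x" "k y" "bimod \<Gamma> x y" "V y" by (rule tensor_Y[OF y])
      have "W y = {\<zero>\<^bsub>V y\<^esub>}" using zero[of y] Y_neq[OF y] by (simp add: unreflect_def)
      moreover have "t y \<in> tsp y (W y)" using \<open>t \<in> family_sum W\<close> y by (simp add: family_sum_def)
      ultimately have "t y \<in> {\<zero>\<^bsub>T y\<^esub>}" using t.span_zero by (simp only: twisted_def)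
      then show ?thesis using P_at(1)[OF y] by simp
    qed
  qed (use that in \<open>auto simp: family_sum_def\<close>)
  moreover have "submodule (W x) (k x) (space N x)" using W by (auto simp: subrepresentation_def)
  note D = left_module.submoduleD[OF left_module_N this]
  ultimately have "w = \<zero>\<^bsub>space N x\<^esub>" if "w \<in> W x" for w
  proof -
    assume triv: "\<And>t. t \<in> family_sum W \<Longrightarrow> t = \<zero>\<^bsub>P\<^esub>"
    have "w \<in> carrier (space N x)" using D(1) that by auto
    then obtain t where "w = tensor_name t" "t \<in> carrier K" by (auto simp: Nx_simps(1))
    then show ?thesis
      using triv[OF subrep_kernel_in_family_sum[OF W]] that by (simp add: Nx_simps(2))
  qed
  then show ?thesis using D(2) True by blast
qed

section \<open>Surjectivity of \<open>h\<close> and preservation of indecomposability\<close>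

lemma pure_tensor_zero:
  assumes "(i, j) \<in> \<Lambda>" "b \<in> carrier (bimod \<Gamma> j i)"
  shows "arr M i j (pure_tensor (k i) (bimod \<Gamma> j i) (V i) b \<zero>\<^bsub>V i\<^esub>) = \<zero>\<^bsub>V j\<^esub>"
proof -
  interpret t: tensor "k j" "k i" "bimod \<Gamma> j i" "V i"
    by (intro tensor.intro edge_bimodule left_module_V) (use assms in \<open>auto dest: arrow_edge\<close>)
  show ?thesis
    using left_linear_zero[OF left_module_twisted[OF assms(1)] left_module_V arrow_linear[OF assms(1)]]
      t.pure_zero_right[OF assms(2)] by (simp add: twisted_def)
qed

lemma arrow_pure_closed:
  assumes "(i, j) \<in> \<Lambda>" "b \<in> carrier (bimod \<Gamma> j i)" "u \<in> carrier (V i)"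
  shows "pure_tensor (k i) (bimod \<Gamma> j i) (V i) b u \<in> carrier (twisted \<Gamma> M j i)"
proof -
  interpret t: tensor "k j" "k i" "bimod \<Gamma> j i" "V i"
    by (intro tensor.intro edge_bimodule left_module_V) (use assms in \<open>auto dest: arrow_edge\<close>)
  show ?thesis using assms(2,3) by (simp add: twisted_def)
qed

text \<open>A complement \<open>C\<close> of the image, placed at \<open>x\<close>, is a
  subrepresentation because no arrow starts at \<open>x\<close>; the image together with all other
  spaces is the second summand. If the latter vanished, \<open>M\<close> would be concentrated at
  \<open>x\<close>, the domain of \<open>h\<close> would be zero, and \<open>N\<close> would be zero
  as well. Hence it is \<open>C\<close> that vanishes.\<close>

lemma h_onto:
  assumes ind: "indecomposable \<Gamma> \<Lambda> M" and nz: "\<not> zero_rep N"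
  shows "h ` carrier P = carrier (V x)"
proof -
  have im: "submodule (h ` carrier P) (k x) (V x)"
    by (rule submodule_image[OF left_module_P left_module_V h_linear P.submodule_carrier])
  have "skew_field (k x)" using modulated by (simp add: modulated_graph_def)
  from complement_exists[OF this left_module_V im]
  obtain C where C: "internal_direct_sum (k x) (V x) (h ` carrier P) C" ..
  then have subC: "submodule C (k x) (V x)" by (simp add: internal_direct_sum_def)
  define U where "U i = (if i = x then h ` carrier P else carrier (V i))" for i
  define U' where "U' i = (if i = x then C else {\<zero>\<^bsub>V i\<^esub>})" for i
  have "subrepresentation \<Gamma> \<Lambda> M U"
    unfolding subrepresentation_def
  proof (intro conjI allI ballI, goal_cases)
    case (1 i)
    then show ?case using im left_module.submodule_carrier[OF left_module_V] by (simp add: U_def)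
  next
    case (2 p)
    obtain i j where p: "p = (i, j)" "(i, j) \<in> \<Lambda>" using 2 by (cases p) auto
    then have ix: "i \<noteq> x" using sink by (auto simp: sink_def)
    have "arr M i j (pure_tensor (k i) (bimod \<Gamma> j i) (V i) b u) \<in> U j"
      if b: "b \<in> carrier (bimod \<Gamma> j i)" and u: "u \<in> U i" for b u
    proof -
      let ?t = "pure_tensor (k i) (bimod \<Gamma> j i) (V i) b u"
      have t: "?t \<in> carrier (twisted \<Gamma> M j i)" using arrow_pure_closed[OF p(2) b] u ix by (simp add: U_def)
      show ?thesis
      proof (cases "j = x")
        case True
        then have "h (single i ?t) = arr M i j ?t" "single i ?t \<in> carrier P"
          using h_single[of i ?t] single_closed[of ?t i] p t by auto
        then show ?thesis using True by (auto simp: U_def intro!: image_eqI)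
      next
        case False
        then show ?thesis using left_linearD(1)[OF arrow_linear[OF p(2)] t] by (simp add: U_def)
      qed
    qed
    then show ?case using p by auto
  qed
  moreover have "subrepresentation \<Gamma> \<Lambda> M U'"
    unfolding subrepresentation_def
  proof (intro conjI allI ballI, goal_cases)
    case (1 i)
    then show ?case using subC left_module.submodule_zero[OF left_module_V] by (simp add: U'_def)
  next
    case (2 p)
    obtain i j where p: "p = (i, j)" "(i, j) \<in> \<Lambda>" using 2 by (cases p) auto
    then have ix: "i \<noteq> x" using sink by (auto simp: sink_def)
    have "\<zero>\<^bsub>V j\<^esub> \<in> U' j" using Vx.submoduleD(2)[OF subC] by (simp add: U'_def)
    then show ?case using p ix pure_tensor_zero[OF p(2)] by (auto simp: U'_def)
  qed
  moreover have "U i <+>\<^bsub>V i\<^esub> U' i = carrier (V i) \<and> U i \<inter> U' i = {\<zero>\<^bsub>V i\<^esub>}" for i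
  proof (cases "i = x")
    case True
    then show ?thesis using C by (simp add: U_def U'_def internal_direct_sum_def)
  next
    case False
    interpret Vi: left_module "k i" "V i" by (rule left_module_V)
    have "carrier (V i) <+>\<^bsub>V i\<^esub> {\<zero>\<^bsub>V i\<^esub>} = carrier (V i)" by (auto simp: set_add_iff)
    then show ?thesis using False by (auto simp: U_def U'_def)
  qed
  ultimately have "(\<forall>i. U i = {\<zero>\<^bsub>V i\<^esub>}) \<or> (\<forall>i. U' i = {\<zero>\<^bsub>V i\<^esub>})"
    using ind unfolding indecomposable_def by blast
  then show ?thesis
  proof
    assume "\<forall>i. U i = {\<zero>\<^bsub>V i\<^esub>}"
    then have z: "carrier (V i) = {\<zero>\<^bsub>V i\<^esub>}" if "i \<noteq> x" for i
      using that U_def[of i] by simp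
    then have "carrier (space N x) = {\<zero>\<^bsub>space N x\<^esub>}" using kernel_trivial Y_neq by blast
    then have "zero_rep N" unfolding zero_rep_def using z space_N(1) by metis
    then show ?thesis using nz by simp
  next
    assume "\<forall>i. U' i = {\<zero>\<^bsub>V i\<^esub>}"
    then have "C = {\<zero>\<^bsub>V x\<^esub>}" using U'_def[of x] by simp
    then have sum: "h ` carrier P <+>\<^bsub>V x\<^esub> {\<zero>\<^bsub>V x\<^esub>} = carrier (V x)"
      using C by (simp add: internal_direct_sum_def)
    have "v \<in> h ` carrier P" if "v \<in> carrier (V x)" for v
    proof -
      obtain t where "t \<in> carrier P" "v = h t \<oplus>\<^bsub>V x\<^esub> \<zero>\<^bsub>V x\<^esub>"
        using \<open>v \<in> _\<close>[folded sum] unfolding set_add_iff by blast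
      then show ?thesis using h_closed by simp
    qed
    then show ?thesis using h_closed by blast
  qed
qed

lemma indecomposable_reflect:
  assumes ind: "indecomposable \<Gamma> \<Lambda> M" and nz: "\<not> zero_rep N"
  shows "indecomposable \<Gamma> \<Lambda>' N"
  unfolding indecomposable_def
proof (intro conjI nz allI impI)
  fix W W'
  assume "subrepresentation \<Gamma> \<Lambda>' N W \<and> subrepresentation \<Gamma> \<Lambda>' N W' \<and>
    (\<forall>i. W i <+>\<^bsub>space N i\<^esub> W' i = carrier (space N i) \<and> W i \<inter> W' i = {\<zero>\<^bsub>space N i\<^esub>})"
  then have W: "subrepresentation \<Gamma> \<Lambda>' N W" "subrepresentation \<Gamma> \<Lambda>' N W'"
    and ds: "\<And>i. W i <+>\<^bsub>space N i\<^esub> W' i = carrier (space N i) \<and> W i \<inter> W' i = {\<zero>\<^bsub>space N i\<^esub>}"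
    by auto
  have "(\<forall>i. unreflect W i = {\<zero>\<^bsub>V i\<^esub>}) \<or> (\<forall>i. unreflect W' i = {\<zero>\<^bsub>V i\<^esub>})"
    using ind subrepresentation_unreflect[OF W(1)] subrepresentation_unreflect[OF W(2)]
      unreflect_direct[OF W ds h_onto[OF ind nz]]
    unfolding indecomposable_def by blast
  then show "(\<forall>i. W i = {\<zero>\<^bsub>space N i\<^esub>}) \<or> (\<forall>i. W' i = {\<zero>\<^bsub>space N i\<^esub>})"
    using unreflect_zero[OF W(1)] unreflect_zero[OF W(2)] by blast
qed

end


section \<open>Invariance under interchanges\<close>

lemma reflect_along_append:
  "reflect_along \<Gamma> \<Lambda> (S @ T) M = reflect_along \<Gamma> (reverse_along S \<Lambda>) T (reflect_along \<Gamma> \<Lambda> S M)"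
  by (induction S arbitrary: \<Lambda> M) auto

lemma module_rep_reflect_along:
  assumes "modulated_graph \<Gamma>" "orientation \<Gamma> \<Lambda>" "module_rep \<Gamma> \<Lambda> M" "admissible \<Lambda> S"
  shows "module_rep \<Gamma> (reverse_along S \<Lambda>) (reflect_along \<Gamma> \<Lambda> S M)"
  using assms
proof (induction S arbitrary: \<Lambda> M)
  case (Cons x S)
  interpret reflection \<Gamma> \<Lambda> x M by unfold_locales (use Cons.prems in auto)
  show ?case
    using Cons.IH[OF Cons.prems(1) orientation_reverse_at[OF oriented sink] module_rep_N] Cons.prems(4)
    by simp
qed simp

text \<open>The kernel sees only the arrows into \<open>x\<close> with the spaces and maps attached
  to them. Literal equality carries over to the renamed kernels, hence to the reflected
  spaces.\<close>

lemma (in reflection) incoming_kernel_cong: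
  assumes Y: "{y. (y, x) \<in> \<Lambda>2} = Y" and sx: "space M2 x = V x"
    and s: "\<And>y. y \<in> Y \<Longrightarrow> space M2 y = V y" and a: "\<And>y. y \<in> Y \<Longrightarrow> arr M2 y x = arr M y x"
  shows "incoming_kernel \<Gamma> \<Lambda>2 x M2 = K"
proof -
  have tw: "twisted \<Gamma> M2 x y = T y" if "y \<in> Y" for y using s[OF that] by (simp add: twisted_def)
  have "(\<Pi>\<^sub>E y\<in>Y. carrier (twisted \<Gamma> M2 x y)) = (\<Pi>\<^sub>E y\<in>Y. carrier (T y))"
    by (rule PiE_cong) (use tw in simp)
  moreover have "(\<lambda>y\<in>Y. \<zero>\<^bsub>twisted \<Gamma> M2 x y\<^esub>) = (\<lambda>y\<in>Y. \<zero>\<^bsub>T y\<^esub>)"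
    by (rule restrict_ext) (use tw in simp)
  moreover have "(\<lambda>s t. \<lambda>y\<in>Y. s y \<oplus>\<^bsub>twisted \<Gamma> M2 x y\<^esub> t y) = (\<lambda>s t. \<lambda>y\<in>Y. s y \<oplus>\<^bsub>T y\<^esub> t y)"
    by (intro ext restrict_ext) (use tw in simp)
  moreover have "(\<lambda>a t. \<lambda>y\<in>Y. a \<odot>\<^bsub>twisted \<Gamma> M2 x y\<^esub> t y) = (\<lambda>a t. \<lambda>y\<in>Y. a \<odot>\<^bsub>T y\<^esub> t y)"
    by (intro ext restrict_ext) (use tw in simp)
  ultimately have P: "incoming_sum \<Gamma> \<Lambda>2 x M2 = P"
    unfolding incoming_sum_def Let_def Y by simp
  have "incoming_map \<Lambda>2 x M2 t = h t" if t: "t \<in> carrier P" for t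
    unfolding incoming_map_def Y sx
  proof (rule Vx.M.finsum_cong')
    show "(\<lambda>y. arr M y x (t y)) \<in> Y \<rightarrow> carrier (V x)" using arr_closed P_closed[OF t] by blast
  qed (use a in auto)
  then have "{t \<in> carrier P. incoming_map \<Lambda>2 x M2 t = \<zero>\<^bsub>V x\<^esub>} = {t \<in> carrier P. h t = \<zero>\<^bsub>V x\<^esub>}"
    by auto
  then show ?thesis unfolding incoming_kernel_def P sx by simp
qed

text \<open>Entries of \<open>arr\<close> outside the arrows are junk, so reflections commute only up to \<open>agree\<close>.\<close>

definition agree :: "'i rel \<Rightarrow> ('i, 'd, 'b, 'v) rep \<Rightarrow> ('i, 'd, 'b, 'v) rep \<Rightarrow> bool"
  where "agree \<Lambda> M M2 \<longleftrightarrow> space M2 = space M \<and> (\<forall>(i, j)\<in>\<Lambda>. arr M2 i j = arr M i j)"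

lemma reflect_simps:
  "space (reflect \<Gamma> \<Lambda> x M) =
    (space M)(x := rename_module tensor_name (incoming_kernel \<Gamma> \<Lambda> x M))"
  "i \<noteq> x \<Longrightarrow> arr (reflect \<Gamma> \<Lambda> x M) i j = arr M i j"
  "arr (reflect \<Gamma> \<Lambda> x M) x j = tensor_lift (space M j) (\<lambda>b' w.
    tensor_lift (space M j) (\<lambda>b v. pairing \<Gamma> x j b' b \<odot>\<^bsub>space M j\<^esub> v)
      (inv_into (carrier (incoming_kernel \<Gamma> \<Lambda> x M)) tensor_name w j))"
  by (simp_all add: reflect_def Let_def)

lemma (in reflection) agree_reflect:
  assumes "agree \<Lambda> M M2"
  shows "agree \<Lambda>' N (reflect \<Gamma> \<Lambda> x M2)"
proof -
  have sp: "space M2 = V" and ar: "\<And>i j. (i, j) \<in> \<Lambda> \<Longrightarrow> arr M2 i j = arr M i j"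
    using assms by (auto simp: agree_def)
  have K: "incoming_kernel \<Gamma> \<Lambda> x M2 = K"
    by (rule incoming_kernel_cong) (use sp ar in auto)
  have "arr (reflect \<Gamma> \<Lambda> x M2) i j = arr N i j" if "(i, j) \<in> \<Lambda>'" for i j
  proof (cases "i = x")
    case True
    then show ?thesis by (simp add: reflect_simps K sp)
  next
    case False
    then have "(i, j) \<in> \<Lambda>" using that sink by (auto simp: reverse_at_def sink_def)
    then show ?thesis using False by (simp add: reflect_simps ar)
  qed
  then show ?thesis by (auto simp: agree_def reflect_simps K sp)
qed

lemma agree_reflect_along:
  assumes "modulated_graph \<Gamma>" "orientation \<Gamma> \<Lambda>" "module_rep \<Gamma> \<Lambda> M" "admissible \<Lambda> S" "agree \<Lambda> M M2"
  shows "agree (reverse_along S \<Lambda>) (reflect_along \<Gamma> \<Lambda> S M) (reflect_along \<Gamma> \<Lambda> S M2)"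
  using assms
proof (induction S arbitrary: \<Lambda> M M2)
  case (Cons x S)
  interpret reflection \<Gamma> \<Lambda> x M by unfold_locales (use Cons.prems in auto)
  show ?case
    using Cons.IH[OF Cons.prems(1) orientation_reverse_at[OF oriented sink] module_rep_N _
        agree_reflect[OF Cons.prems(5)]] Cons.prems(4)
    by simp
qed simp

text \<open>Reflection at one of two nonadjacent sinks leaves the other sink, its neighbours and its
  incoming maps as they were. So the kernels at both vertices, including the names of their
  elements, are the same in either order.\<close>

lemma reflect_commute:
  assumes mg: "modulated_graph \<Gamma>" and or: "orientation \<Gamma> \<Lambda>" and rep: "module_rep \<Gamma> \<Lambda> M"
    and x: "sink \<Lambda> x" and y: "sink \<Lambda> y" and xy: "x \<noteq> y" and ne: "\<not> edge \<Gamma> x y"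
  shows "agree (reverse_at y (reverse_at x \<Lambda>))
    (reflect \<Gamma> (reverse_at x \<Lambda>) y (reflect \<Gamma> \<Lambda> x M))
    (reflect \<Gamma> (reverse_at y \<Lambda>) x (reflect \<Gamma> \<Lambda> y M))"
proof -
  interpret x: reflection \<Gamma> \<Lambda> x M by unfold_locales fact+
  interpret y: reflection \<Gamma> \<Lambda> y M by unfold_locales fact+
  have na: "(x, y) \<notin> \<Lambda>" "(y, x) \<notin> \<Lambda>" using ne edge_iff[OF or] by auto
  have Ky: "incoming_kernel \<Gamma> (reverse_at x \<Lambda>) y (reflect \<Gamma> \<Lambda> x M) = incoming_kernel \<Gamma> \<Lambda> y M"
  proof (rule y.incoming_kernel_cong)
    show "{z. (z, y) \<in> reverse_at x \<Lambda>} = {z. (z, y) \<in> \<Lambda>}" using na xy by (auto simp: reverse_at_def)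
    show "arr (reflect \<Gamma> \<Lambda> x M) z y = arr M z y" if "z \<in> {z. (z, y) \<in> \<Lambda>}" for z
      using that na by (intro reflect_simps(2)) auto
  qed (use xy na in \<open>auto simp: reflect_simps(1)\<close>)
  have Kx: "incoming_kernel \<Gamma> (reverse_at y \<Lambda>) x (reflect \<Gamma> \<Lambda> y M) = incoming_kernel \<Gamma> \<Lambda> x M"
  proof (rule x.incoming_kernel_cong)
    show "{z. (z, x) \<in> reverse_at y \<Lambda>} = {z. (z, x) \<in> \<Lambda>}" using na xy by (auto simp: reverse_at_def)
    show "arr (reflect \<Gamma> \<Lambda> y M) z x = arr M z x" if "z \<in> {z. (z, x) \<in> \<Lambda>}" for z
      using that na by (intro reflect_simps(2)) auto
  qed (use xy na in \<open>auto simp: reflect_simps(1)\<close>)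
  have "arr (reflect \<Gamma> (reverse_at y \<Lambda>) x (reflect \<Gamma> \<Lambda> y M)) i j =
    arr (reflect \<Gamma> (reverse_at x \<Lambda>) y (reflect \<Gamma> \<Lambda> x M)) i j"
    if ij: "(i, j) \<in> reverse_at y (reverse_at x \<Lambda>)" for i j
  proof -
    \<comment> \<open>An arrow starting at one of the two vertices does not end at the other, so its
      map is built with a space at \<open>j\<close> that the reflection at the other vertex has not
      changed.\<close>
    have "i = x \<Longrightarrow> j \<noteq> y" "i = y \<Longrightarrow> j \<noteq> x" using ij na by (auto simp: reverse_at_def)
    then show ?thesis using xy by (cases "i = x"; cases "i = y") (simp_all add: reflect_simps Kx Ky)
  qed
  moreover have "space (reflect \<Gamma> (reverse_at y \<Lambda>) x (reflect \<Gamma> \<Lambda> y M)) =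
    space (reflect \<Gamma> (reverse_at x \<Lambda>) y (reflect \<Gamma> \<Lambda> x M))"
    using xy by (simp add: reflect_simps Kx Ky fun_upd_twist)
  ultimately show ?thesis by (auto simp: agree_def)
qed

text \<open>Agreement after the two swapped steps persists along the common tail, and vanishing of a
  representation is seen on its spaces, which agreeing representations share.\<close>

lemma interchange_annihilates:
  assumes mg: "modulated_graph \<Gamma>" and or: "orientation \<Gamma> \<Lambda>" and rep: "module_rep \<Gamma> \<Lambda> M"
    and S: "interchange \<Gamma> \<Lambda> S T" and ann: "annihilates \<Gamma> \<Lambda> S M"
  shows "annihilates \<Gamma> \<Lambda> T M"
proof -
  obtain A B x y where eq: "S = A @ [x, y] @ B" "T = A @ [y, x] @ B" "\<not> edge \<Gamma> x y"
    and adm: "admissible \<Lambda> S" "admissible \<Lambda> T" using S by (auto simp: interchange_def)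
  show ?thesis
  proof (cases "x = y")
    case True
    then show ?thesis using ann eq by simp
  next
    case False
    define \<Lambda>1 where "\<Lambda>1 = reverse_along A \<Lambda>"
    define M1 where "M1 = reflect_along \<Gamma> \<Lambda> A M"
    have admA: "admissible \<Lambda> A" using adm eq by (simp add: admissible_append)
    have or1: "orientation \<Gamma> \<Lambda>1" unfolding \<Lambda>1_def by (rule orientation_reverse_along[OF or admA])
    have rep1: "module_rep \<Gamma> \<Lambda>1 M1"
      unfolding \<Lambda>1_def M1_def by (rule module_rep_reflect_along[OF mg or rep admA])
    have sinks: "sink \<Lambda>1 x" "sink \<Lambda>1 y"
      and adm2: "admissible \<Lambda>1 [x, y]" and adm3: "admissible (reverse_along [x, y] \<Lambda>1) B"
      using adm eq by (simp_all add: admissible_append \<Lambda>1_def)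
    have ag: "agree (reverse_along [x, y] \<Lambda>1) (reflect_along \<Gamma> \<Lambda>1 [x, y] M1) (reflect_along \<Gamma> \<Lambda>1 [y, x] M1)"
      using reflect_commute[OF mg or1 rep1 sinks False eq(3)] by simp
    have "agree (reverse_along B (reverse_along [x, y] \<Lambda>1))
      (reflect_along \<Gamma> (reverse_along [x, y] \<Lambda>1) B (reflect_along \<Gamma> \<Lambda>1 [x, y] M1))
      (reflect_along \<Gamma> (reverse_along [x, y] \<Lambda>1) B (reflect_along \<Gamma> \<Lambda>1 [y, x] M1))"
      by (rule agree_reflect_along[OF mg orientation_reverse_along[OF or1 adm2]
            module_rep_reflect_along[OF mg or1 rep1 adm2] adm3 ag])
    moreover have "reverse_along [y, x] \<Lambda>1 = reverse_along [x, y] \<Lambda>1" by (simp add: reverse_at_commute)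
    ultimately have "space (reflect_along \<Gamma> \<Lambda> T M) = space (reflect_along \<Gamma> \<Lambda> S M)"
      unfolding agree_def eq reflect_along_append \<Lambda>1_def[symmetric] M1_def[symmetric] by metis
    then show ?thesis using ann adm by (simp add: annihilates_def zero_rep_def)
  qed
qed

lemma seq_equiv_annihilates:
  assumes mg: "modulated_graph \<Gamma>" and or: "orientation \<Gamma> \<Lambda>" and rep: "module_rep \<Gamma> \<Lambda> M"
    and S: "seq_equiv \<Gamma> \<Lambda> S T" and ann: "annihilates \<Gamma> \<Lambda> S M"
  shows "annihilates \<Gamma> \<Lambda> T M"
  using or S
proof (induction rule: seq_equiv_induct)
  case (step T U)
  then show ?case using interchange_annihilates[OF mg or rep] by blast
qed (rule ann)


section \<open>Shortest annihilating sequences\<close>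

text \<open>A zero representation stays zero under reflections. So a nonzero end result means that
  no intermediate representation is zero, and each single step preserves indecomposability.\<close>

lemma indecomposable_reflect_along:
  assumes "modulated_graph \<Gamma>" "orientation \<Gamma> \<Lambda>" "module_rep \<Gamma> \<Lambda> M" "admissible \<Lambda> S"
    and "indecomposable \<Gamma> \<Lambda> M" "\<not> zero_rep (reflect_along \<Gamma> \<Lambda> S M)"
  shows "indecomposable \<Gamma> (reverse_along S \<Lambda>) (reflect_along \<Gamma> \<Lambda> S M)"
  using assms
proof (induction S arbitrary: \<Lambda> M)
  case (Cons x S)
  interpret reflection \<Gamma> \<Lambda> x M by unfold_locales (use Cons.prems in auto)
  have or: "orientation \<Gamma> \<Lambda>'" by (rule orientation_reverse_at[OF oriented sink])
  have adm: "admissible \<Lambda>' S" using Cons.prems(4) by simp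
  have nz: "\<not> zero_rep N"
  proof
    assume "zero_rep N"
    then have "zero_rep (reflect_along \<Gamma> \<Lambda>' S N)"
      using or module_rep_N adm
    proof (induction S arbitrary: rule: rev_induct)
      case (snoc z S)
      then have "admissible \<Lambda>' S" and z: "sink (reverse_along S \<Lambda>') z" by (auto simp: admissible_append)
      interpret z: reflection \<Gamma> "reverse_along S \<Lambda>'" z "reflect_along \<Gamma> \<Lambda>' S N"
        by unfold_locales
          (use modulated z or orientation_reverse_along[OF or \<open>admissible \<Lambda>' S\<close>]
            module_rep_reflect_along[OF modulated or module_rep_N \<open>admissible \<Lambda>' S\<close>] in auto)
      show ?case
        using z.zero_rep_reflect snoc.IH[OF snoc.prems(1-3) \<open>admissible \<Lambda>' S\<close>]
        by (simp add: reflect_along_append)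
    qed simp
    then show False using Cons.prems(6) by simp
  qed
  show ?case
    using Cons.IH[OF Cons.prems(1) or module_rep_N adm indecomposable_reflect[OF Cons.prems(5) nz]]
      Cons.prems(6) by simp
qed simp

text \<open>
  A representation killed by two commuting reflections is supported at the two sinks, so it is the
  direct sum of its parts at them.
\<close>

lemma indecomposable_two_sinks:
  assumes mg: "modulated_graph \<Gamma>" and or: "orientation \<Gamma> \<Lambda>" and rep: "module_rep \<Gamma> \<Lambda> M"
    and u: "sink \<Lambda> u" and v: "sink \<Lambda> v" and uv: "u \<noteq> v" and ind: "indecomposable \<Gamma> \<Lambda> M"
    and zero: "zero_rep (reflect_along \<Gamma> \<Lambda> [u, v] M)"
  shows "zero_rep (reflect \<Gamma> \<Lambda> u M) \<or> zero_rep (reflect \<Gamma> \<Lambda> v M)"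
proof -
  interpret u: reflection \<Gamma> \<Lambda> u M by unfold_locales fact+
  interpret v: reflection \<Gamma> \<Lambda> v M by unfold_locales fact+
  \<comment> \<open>The two reflections change no space away from \<open>u\<close> and
    \<open>v\<close>, so these spaces are zero in \<open>M\<close> already.\<close>
  have out: "carrier (space M i) = {\<zero>\<^bsub>space M i\<^esub>}" if "i \<noteq> u" "i \<noteq> v" for i
    using zero that by (auto simp: zero_rep_def reflect_simps dest!: spec[of _ i])
  define part where "part w i = (if i = w then carrier (space M i) else {\<zero>\<^bsub>space M i\<^esub>})" for w i
  \<comment> \<open>No arrow starts at the sink \<open>w\<close>, and at any other vertex there is
    only zero to be mapped.\<close>
  have sub: "subrepresentation \<Gamma> \<Lambda> M (part w)" if "sink \<Lambda> w" for w
    unfolding subrepresentation_def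
  proof (intro conjI allI ballI, goal_cases)
    case (1 i)
    show ?case
      using left_module.submodule_carrier[OF u.left_module_V] left_module.submodule_zero[OF u.left_module_V]
      by (simp add: part_def)
  next
    case (2 p)
    obtain i j where p: "p = (i, j)" "(i, j) \<in> \<Lambda>" using 2 by (cases p) auto
    have "i \<noteq> w" using p that by (auto simp: sink_def)
    interpret Vj: left_module "dring \<Gamma> j" "space M j" by (rule u.left_module_V)
    have "\<zero>\<^bsub>space M j\<^esub> \<in> part w j" 
      using Vj.M.zero_closed unfolding part_def
      by (cases "j = w") (simp_all only: if_True if_False singleton_iff simp_thms)
    then show ?case using p \<open>i \<noteq> w\<close> u.pure_tensor_zero[OF p(2)] by (auto simp: part_def[of w i])
  qed
  have "part u i <+>\<^bsub>space M i\<^esub> part v i = carrier (space M i) \<and>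
    part u i \<inter> part v i = {\<zero>\<^bsub>space M i\<^esub>}" for i
  proof -
    interpret Vi: left_module "dring \<Gamma> i" "space M i" by (rule u.left_module_V)
    have "{\<zero>\<^bsub>space M i\<^esub>} <+>\<^bsub>space M i\<^esub> carrier (space M i) = carrier (space M i)"
      "carrier (space M i) <+>\<^bsub>space M i\<^esub> {\<zero>\<^bsub>space M i\<^esub>} = carrier (space M i)"
      "{\<zero>\<^bsub>space M i\<^esub>} <+>\<^bsub>space M i\<^esub> {\<zero>\<^bsub>space M i\<^esub>} = {\<zero>\<^bsub>space M i\<^esub>}"
      by (auto simp: set_add_iff)
    then show ?thesis using uv out[of i] by (auto simp: part_def)
  qed
  then have "(\<forall>i. part u i = {\<zero>\<^bsub>space M i\<^esub>}) \<or> (\<forall>i. part v i = {\<zero>\<^bsub>space M i\<^esub>})"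
    using ind sub[OF u] sub[OF v] unfolding indecomposable_def by blast
  then show ?thesis
  proof
    \<comment> \<open>Then \<open>M\<close> lives at \<open>v\<close> alone: the sources of the
      arrows into \<open>v\<close> carry zero spaces, the kernel at \<open>v\<close> is zero, and
      reflection at \<open>v\<close> kills \<open>M\<close>.\<close>
    assume "\<forall>i. part u i = {\<zero>\<^bsub>space M i\<^esub>}"
    then have "carrier (space M u) = {\<zero>\<^bsub>space M u\<^esub>}" using part_def[of u u] by simp
    then have *: "carrier (space M i) = {\<zero>\<^bsub>space M i\<^esub>}" if "i \<noteq> v" for i using out that by metis
    then have "carrier (space (reflect \<Gamma> \<Lambda> v M) v) = {\<zero>\<^bsub>space (reflect \<Gamma> \<Lambda> v M) v\<^esub>}"
      using v.kernel_trivial v.Y_neq by blast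
    then have "zero_rep (reflect \<Gamma> \<Lambda> v M)"
      unfolding zero_rep_def using * v.space_N(1) by metis
    then show ?thesis ..
  next
    assume "\<forall>i. part v i = {\<zero>\<^bsub>space M i\<^esub>}"
    then have "carrier (space M v) = {\<zero>\<^bsub>space M v\<^esub>}" using part_def[of v v] by simp
    then have *: "carrier (space M i) = {\<zero>\<^bsub>space M i\<^esub>}" if "i \<noteq> u" for i using out that by metis
    then have "carrier (space (reflect \<Gamma> \<Lambda> u M) u) = {\<zero>\<^bsub>space (reflect \<Gamma> \<Lambda> u M) u\<^esub>}"
      using u.kernel_trivial u.Y_neq by blast
    then have "zero_rep (reflect \<Gamma> \<Lambda> u M)"
      unfolding zero_rep_def using * u.space_N(1) by metis
    then show ?thesis ..
  qed
qed

lemma shortest_annihilating_unique_last_vertex: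
  assumes mg: "modulated_graph \<Gamma>" and or: "orientation \<Gamma> \<Lambda>" and rep: "module_rep \<Gamma> \<Lambda> M"
    and ind: "indecomposable \<Gamma> \<Lambda> M" and S: "shortest_annihilating \<Gamma> \<Lambda> S M"
    and u: "last_vertex \<Gamma> \<Lambda> S u" and v: "last_vertex \<Gamma> \<Lambda> S v"
  shows "u = v"
proof (rule ccontr)
  assume uv: "u \<noteq> v"
  have ann: "annihilates \<Gamma> \<Lambda> S M" and adm: "admissible \<Lambda> S"
    and min: "\<And>T. subsequence \<Gamma> \<Lambda> T S \<Longrightarrow> \<not> seq_equiv \<Gamma> \<Lambda> T S \<Longrightarrow> \<not> annihilates \<Gamma> \<Lambda> T M"
    using S by (auto simp: shortest_annihilating_def annihilates_def)
  obtain U where ne: "\<not> edge \<Gamma> u v" and U: "seq_equiv \<Gamma> \<Lambda> S (U @ [u, v])"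
    using two_last_vertices[OF or adm u v uv] by blast
  have admU: "admissible \<Lambda> (U @ [u, v])" and admU': "admissible \<Lambda> (U @ [v, u])"
    using seq_equiv_invariants(1)[OF or U adm] admissible_swap[OF or ne, of U "[]"] by auto
  then have "interchange \<Gamma> \<Lambda> (U @ [u, v]) (U @ [v, u])"
    using ne unfolding interchange_def by (metis append_Nil2)
  then have U': "seq_equiv \<Gamma> \<Lambda> S (U @ [v, u])"
    using U interchange_imp_seq_equiv seq_equiv_trans by metis
  \<comment> \<open>Dropping the final \<open>b\<close> gives a proper subsequence, since equivalent
    sequences contain \<open>b\<close> equally often.\<close>
  have proper: "\<not> annihilates \<Gamma> \<Lambda> (U @ [a]) M"
    if eq: "seq_equiv \<Gamma> \<Lambda> S (U @ [a, b])" and ab: "admissible \<Lambda> (U @ [a, b])" for a b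
  proof (rule min)
    have a: "admissible \<Lambda> (U @ [a])" using ab by (auto simp: admissible_append)
    show "subsequence \<Gamma> \<Lambda> (U @ [a]) S"
      unfolding subsequence_def
      using a adm ab eq
      by (intro conjI exI[of _ "[b]"]) (auto simp: admissible_append reverse_along_append)
    show "\<not> seq_equiv \<Gamma> \<Lambda> (U @ [a]) S"
    proof
      assume "seq_equiv \<Gamma> \<Lambda> (U @ [a]) S"
      then have "seq_equiv \<Gamma> \<Lambda> (U @ [a]) (U @ [a, b])" using eq seq_equiv_trans by metis
      then have "count_list (U @ [a, b]) b = count_list (U @ [a]) b"
        using seq_equiv_invariants(2)[OF or _ a] by metis
      then show False by (simp split: if_splits)
    qed
  qed
  define \<Lambda>1 where "\<Lambda>1 = reverse_along U \<Lambda>"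
  define M1 where "M1 = reflect_along \<Gamma> \<Lambda> U M"
  have aU: "admissible \<Lambda> U" and sinks: "sink \<Lambda>1 u" "sink \<Lambda>1 v"
    using admU admU' by (auto simp: admissible_append \<Lambda>1_def)
  have or1: "orientation \<Gamma> \<Lambda>1" unfolding \<Lambda>1_def by (rule orientation_reverse_along[OF or aU])
  have rep1: "module_rep \<Gamma> \<Lambda>1 M1"
    unfolding \<Lambda>1_def M1_def by (rule module_rep_reflect_along[OF mg or rep aU])
  have nz: "\<not> zero_rep (reflect \<Gamma> \<Lambda>1 u M1)" "\<not> zero_rep (reflect \<Gamma> \<Lambda>1 v M1)"
    using proper[OF U admU] proper[OF U' admU'] admU admU'
    by (auto simp: annihilates_def admissible_append reflect_along_append \<Lambda>1_def M1_def)
  interpret u: reflection \<Gamma> \<Lambda>1 u M1 by unfold_locales fact+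
  \<comment> \<open>Minimality makes the reflection at \<open>u\<close> nonzero, and reflections of
    zero are zero. This nonvanishing is what carries indecomposability along
    \<open>U\<close>.\<close>
  have "\<not> zero_rep M1" using nz(1) u.zero_rep_reflect by blast
  then have ind1: "indecomposable \<Gamma> \<Lambda>1 M1"
    using indecomposable_reflect_along[OF mg or rep aU ind] by (simp add: \<Lambda>1_def M1_def)
  have "zero_rep (reflect_along \<Gamma> \<Lambda>1 [u, v] M1)"
    using seq_equiv_annihilates[OF mg or rep U ann]
    by (simp add: annihilates_def reflect_along_append \<Lambda>1_def M1_def)
  from indecomposable_two_sinks[OF mg or1 rep1 sinks uv ind1 this] nz show False by blast
qed

theorem theorem2p6:
  fixes \<Gamma> :: "('i :: finite, 'c, 'd, 'b) modulation"
    and \<Lambda> :: "'i rel"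
    and M :: "('i, 'd, 'b, ('i, 'b, 'v) vec) rep"
    and S :: "'i list"
  assumes "modulated_graph \<Gamma>"
    and "orientation \<Gamma> \<Lambda>"
    and "quiver_rep \<Gamma> \<Lambda> M"
    and "indecomposable \<Gamma> \<Lambda> M"
    and "preprojective \<Gamma> \<Lambda> M"
    and "shortest_annihilating \<Gamma> \<Lambda> S M"
  shows "principal_seq \<Gamma> \<Lambda> S"
proof (rule principal_seq_if_unique_last_vertex)
  have rep: "module_rep \<Gamma> \<Lambda> M" using assms(3) by (auto simp: quiver_rep_def module_rep_def)
  show "orientation \<Gamma> \<Lambda>" by fact
  have ann: "annihilates \<Gamma> \<Lambda> S M" using assms(6) by (simp add: shortest_annihilating_def)
  then show "admissible \<Lambda> S" by (simp add: annihilates_def)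
  \<comment> \<open>The empty sequence would leave \<open>M\<close> unchanged, and an indecomposable
    \<open>M\<close> is nonzero.\<close>
  show "S \<noteq> []" using ann assms(4) by (auto simp: annihilates_def indecomposable_def)
  show "u = v" if "last_vertex \<Gamma> \<Lambda> S u" "last_vertex \<Gamma> \<Lambda> S v" for u v
    using shortest_annihilating_unique_last_vertex[OF assms(1,2) rep assms(4,6) that] .
qed

end
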